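(* Let $(X,d)$ be a compact metric space with $\dim_{\mathrm{A}}(X,d)<\infty$. Then \[ \dim_{\mathrm{CA}}(X,d)=\mathrm{CE}(X,d)=\inf\{\dim_{\mathrm{A}}(X,\theta):\theta\in\mathcal J_p(X,d)\}. \] (Here $\mathrm{CE}(X,d)$ may be computed with any admissible choice of the parameters $a,\lambda,L>1$ and of the separated sets $X_k$, as described in the context.)
   Context: For a metric space $(X,d)$ and $A\subset X$, $N_r(A)$ is the minimal number of balls of radius $r$ needed to cover $A$. The Assouad dimension is $\dim_{\mathrm A}(X,d)=\inf\{\beta>0:\exists C>0,\ N_r(B(x,R))\le C(R/r)^\beta \text{ for all }x\in X,\,0<r<R\}$. A metric $d$ on $X$ is quasisymmetric to another metric $\theta$ on $X$ if there is a homeomorphism $\eta:[0,\infty)\to[0,\infty)$ with $\theta(x,a)/\theta(x,b)\le\eta(d(x,a)/d(x,b))$ for all $x,a,b\in X$, $x\ne b$; it is power quasisymmetric if $\eta$ can be taken of the form $\eta(t)=C(t^\alpha\vee t^{1/\alpha})$ with $C,\alpha\ge1$. The conformal gauge $\mathcal J(X,d)$ is the set of metrics $\theta$ on $X$ such that $d$ is quasisymmetric to $\theta$, and $\mathcal J_p(X,d)$ is the set of $\theta\in\mathcal J(X,d)$ that are power quasisymmetric to $d$. The conformal Assouad dimension is $\dim_{\mathrm{CA}}(X,d)=\inf\{\dim_{\mathrm A}(X,\theta):\theta\in\mathcal J(X,d)\}$. Combinatorial modulus: for a graph $G=(V,E)$ and a family $\Gamma$ of paths (finite sequences of vertices, consecutive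 ones adjacent), $\mathrm{Mod}_p(\Gamma,G)=\inf\{\sum_{v\in V}\rho(v)^p:\rho:V\to[0,\infty),\ \sum_{v\in\gamma}\rho(v)\ge1\ \forall\gamma\in\Gamma\}$, with $\mathrm{Mod}_p(\emptyset,G)=0$. Critical exponent: fix $a,\lambda,L>1$ and, for each $k\ge0$, a maximal $a^{-k}$-separated subset $X_k$ of $X$ (distinct points at mutual distance $\ge a^{-k}$, maximal for inclusion). Let $\mathcal S_k=\{(x,k):x\in X_k\}$, $\mathcal S=\bigcup_{k\ge0}\mathcal S_k$, $\pi_1(x,k)=x$, $\pi_2(x,k)=k$, $B_v=B(\pi_1(v),a^{-\pi_2(v)})$. Let $G_k$ be the graph with vertex set $\mathcal S_k$, distinct $v,w$ adjacent iff $B(\pi_1(v),\lambda a^{-k})\cap B(\pi_1(w),\lambda a^{-k})\ne\emptyset$. For $v\in\mathcal S$ and $k\in\mathbb N$, $\Gamma_{k,L}(v)$ is the set of paths $(v_1,\dots,v_n)$ in $G_{\pi_2(v)+k}$ with $\pi_1(v_1)\in B_v$ and $\pi_1(v_n)\notin B(\pi_1(v),La^{-\pi_2(v)})$. Set $M_{p,k}(L)=\sup_{v\in\mathcal S}\mathrm{Mod}_p(\Gamma_{k,L}(v),G_{\pi_2(v)+k})$, $M_p(L)=\liminf_{k\to\infty}M_{p,k}(L)$, and $\mathrm{CE}(X,d)=\inf\{p>0:M_p(L)=0\}$. *)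

theory Defs
  imports "HOL-Analysis.Analysis" "HOL-Library.Liminf_Limsup"
begin

text \<open>N_r(A): minimal number of (open) balls of radius r, centred in X, covering A;
  the value is infinite if no finite cover exists.\<close>
definition cover_num :: "'a set \<Rightarrow> ('a \<Rightarrow> 'a \<Rightarrow> real) \<Rightarrow> real \<Rightarrow> 'a set \<Rightarrow> ereal" where
  "cover_num X d r A =
     Inf ((\<lambda>C. ereal (real (card C))) `
          {C. finite C \<and> C \<subseteq> X \<and> A \<subseteq> (\<Union>c\<in>C. Metric_space.mball X d c r)})"

definition assouad_dim :: "'a set \<Rightarrow> ('a \<Rightarrow> 'a \<Rightarrow> real) \<Rightarrow> ereal" where
  "assouad_dim X d = Inf (ereal ` {\<beta>. \<beta> > 0 \<and> (\<exists>C>0. \<forall>x\<in>X. \<forall>r R. 0 < r \<and> r < R \<longrightarrow>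
        cover_num X d r (Metric_space.mball X d x R) \<le> ereal (C * (R / r) powr \<beta>))})"

definition quasisymmetric :: "'a set \<Rightarrow> ('a \<Rightarrow> 'a \<Rightarrow> real) \<Rightarrow> ('a \<Rightarrow> 'a \<Rightarrow> real) \<Rightarrow> bool" where
  "quasisymmetric X d \<theta> \<longleftrightarrow>
     (\<exists>\<eta> \<eta>'. homeomorphism {0..} {0..} \<eta> \<eta>' \<and>
        (\<forall>x\<in>X. \<forall>a\<in>X. \<forall>b\<in>X. x \<noteq> b \<longrightarrow> \<theta> x a / \<theta> x b \<le> \<eta> (d x a / d x b)))"

definition power_quasisymmetric :: "'a set \<Rightarrow> ('a \<Rightarrow> 'a \<Rightarrow> real) \<Rightarrow> ('a \<Rightarrow> 'a \<Rightarrow> real) \<Rightarrow> bool" where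
  "power_quasisymmetric X d \<theta> \<longleftrightarrow>
     (\<exists>C \<alpha>. C \<ge> 1 \<and> \<alpha> \<ge> 1 \<and>
        (\<forall>x\<in>X. \<forall>a\<in>X. \<forall>b\<in>X. x \<noteq> b \<longrightarrow>
           \<theta> x a / \<theta> x b \<le> C * max ((d x a / d x b) powr \<alpha>) ((d x a / d x b) powr (1 / \<alpha>))))"

definition conformal_gauge :: "'a set \<Rightarrow> ('a \<Rightarrow> 'a \<Rightarrow> real) \<Rightarrow> ('a \<Rightarrow> 'a \<Rightarrow> real) set" where
  "conformal_gauge X d = {\<theta>. Metric_space X \<theta> \<and> quasisymmetric X d \<theta>}"

definition power_conformal_gauge :: "'a set \<Rightarrow> ('a \<Rightarrow> 'a \<Rightarrow> real) \<Rightarrow> ('a \<Rightarrow> 'a \<Rightarrow> real) set" where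
  "power_conformal_gauge X d = {\<theta>\<in>conformal_gauge X d. power_quasisymmetric X \<theta> d}"

definition conf_assouad_dim :: "'a set \<Rightarrow> ('a \<Rightarrow> 'a \<Rightarrow> real) \<Rightarrow> ereal" where
  "conf_assouad_dim X d = Inf (assouad_dim X ` conformal_gauge X d)"

definition is_path :: "'v set \<Rightarrow> ('v \<Rightarrow> 'v \<Rightarrow> bool) \<Rightarrow> 'v list \<Rightarrow> bool" where
  "is_path V E \<gamma> \<longleftrightarrow> \<gamma> \<noteq> [] \<and> set \<gamma> \<subseteq> V \<and>
     (\<forall>i. Suc i < length \<gamma> \<longrightarrow> E (\<gamma> ! i) (\<gamma> ! Suc i))"

text \<open>Mod_p(\<Gamma>, G) for a finite graph G with vertex set V; the sum along a path is over
  the vertices of the path.  (For \<Gamma> = {} the function \<rho> = 0 is admissible, giving 0.)\<close>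
definition comb_modulus :: "real \<Rightarrow> 'v list set \<Rightarrow> 'v set \<Rightarrow> ereal" where
  "comb_modulus p \<Gamma> V = Inf ((\<lambda>\<rho>. ereal (\<Sum>v\<in>V. \<rho> v powr p)) `
       {\<rho>. (\<forall>v\<in>V. 0 \<le> \<rho> v) \<and> (\<forall>\<gamma>\<in>\<Gamma>. (\<Sum>v\<in>set \<gamma>. \<rho> v) \<ge> 1)})"

definition separated_set :: "'a set \<Rightarrow> ('a \<Rightarrow> 'a \<Rightarrow> real) \<Rightarrow> real \<Rightarrow> 'a set \<Rightarrow> bool" where
  "separated_set X d r S \<longleftrightarrow> S \<subseteq> X \<and> (\<forall>x\<in>S. \<forall>y\<in>S. x \<noteq> y \<longrightarrow> d x y \<ge> r)"

definition maximal_separated :: "'a set \<Rightarrow> ('a \<Rightarrow> 'a \<Rightarrow> real) \<Rightarrow> real \<Rightarrow> 'a set \<Rightarrow> bool" where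
  "maximal_separated X d r S \<longleftrightarrow> separated_set X d r S \<and>
     (\<forall>T. separated_set X d r T \<and> S \<subseteq> T \<longrightarrow> T = S)"

definition level_vertices :: "(nat \<Rightarrow> 'a set) \<Rightarrow> nat \<Rightarrow> ('a \<times> nat) set" where
  "level_vertices Xs k = {(x, k) | x. x \<in> Xs k}"

definition all_vertices :: "(nat \<Rightarrow> 'a set) \<Rightarrow> ('a \<times> nat) set" where
  "all_vertices Xs = (\<Union>k. level_vertices Xs k)"

definition level_adj :: "'a set \<Rightarrow> ('a \<Rightarrow> 'a \<Rightarrow> real) \<Rightarrow> real \<Rightarrow> real \<Rightarrow> nat \<Rightarrow>
    'a \<times> nat \<Rightarrow> 'a \<times> nat \<Rightarrow> bool" where
  "level_adj X d a lam k v w \<longleftrightarrow> v \<noteq> w \<and>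
     Metric_space.mball X d (fst v) (lam * (1 / a ^ k)) \<inter>
     Metric_space.mball X d (fst w) (lam * (1 / a ^ k)) \<noteq> {}"

definition Gamma_kL :: "'a set \<Rightarrow> ('a \<Rightarrow> 'a \<Rightarrow> real) \<Rightarrow> real \<Rightarrow> real \<Rightarrow> real \<Rightarrow> (nat \<Rightarrow> 'a set) \<Rightarrow>
    nat \<Rightarrow> 'a \<times> nat \<Rightarrow> ('a \<times> nat) list set" where
  "Gamma_kL X d a lam L Xs k v =
     {\<gamma>. is_path (level_vertices Xs (snd v + k)) (level_adj X d a lam (snd v + k)) \<gamma> \<and>
          fst (hd \<gamma>) \<in> Metric_space.mball X d (fst v) (1 / a ^ snd v) \<and>
          fst (last \<gamma>) \<notin> Metric_space.mball X d (fst v) (L * (1 / a ^ snd v))}"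

text \<open>M_{p,k}(L): supremum in [0,\<infinity>] over v \<in> S.\<close>
definition M_pk :: "'a set \<Rightarrow> ('a \<Rightarrow> 'a \<Rightarrow> real) \<Rightarrow> real \<Rightarrow> real \<Rightarrow> real \<Rightarrow> (nat \<Rightarrow> 'a set) \<Rightarrow>
    real \<Rightarrow> nat \<Rightarrow> ereal" where
  "M_pk X d a lam L Xs p k = Sup (insert 0 ((\<lambda>v. comb_modulus p (Gamma_kL X d a lam L Xs k v)
        (level_vertices Xs (snd v + k))) ` all_vertices Xs))"

definition M_p :: "'a set \<Rightarrow> ('a \<Rightarrow> 'a \<Rightarrow> real) \<Rightarrow> real \<Rightarrow> real \<Rightarrow> real \<Rightarrow> (nat \<Rightarrow> 'a set) \<Rightarrow>
    real \<Rightarrow> ereal" where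
  "M_p X d a lam L Xs p = liminf (\<lambda>k. M_pk X d a lam L Xs p k)"

definition crit_exp :: "'a set \<Rightarrow> ('a \<Rightarrow> 'a \<Rightarrow> real) \<Rightarrow> real \<Rightarrow> real \<Rightarrow> real \<Rightarrow> (nat \<Rightarrow> 'a set) \<Rightarrow> ereal" where
  "crit_exp X d a lam L Xs = Inf (ereal ` {p. p > 0 \<and> M_p X d a lam L Xs p = 0})"

end

(*
  The critical exponent is at most the Assouad dimension of every theta in the gauge: if theta has
  dimension below p, then the theta-radii of the balls of level n + k, divided by a fixed multiple
  of the theta-size of B_v, are admissible for Gamma_{k,L}(v); they are uniformly small by
  quasisymmetry, and counting theta-separated points bounds their p-th powers.

  Conversely, if the modulus of exponent p gets arbitrarily small, its almost optimal functions are
  multiplied along the scales 1 / A^n, A = a^N, to weights W n x which are log-Lipschitz at scale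
  1 / A^n, decay at a rate bounded above and below, satisfy (sum over the children of x of W^p) <=
  W(x)^p, and are such that every path of level n + 1 crossing an annulus at x of size 1 / A^n costs
  at least W n x. The chain metric in which a jump of length about 1 / A^n starting at x costs W n x
  is then comparable to W n x at distance 1 / A^n, since the path condition allows fine jumps to be
  replaced by coarser ones at no extra cost. Hence it is power quasisymmetric to d, and the
  summability condition bounds its Assouad dimension by p.
*)
theory Submission
  imports Defs "HOL-Real_Asymp.Real_Asymp"
begin

section \<open>The chain metric of a system of weights\<close>

text \<open>The lower bound for the chain metric passes through arbitrarily many levels, so a
  multiplicative loss per level would compound and leave nothing. Hence \<open>W_path\<close> has
  constant 1, and short detours are absorbed into free movement instead of being paid for. The
  weights are shaped by the same demand: a factor in \<open>s\<close> cancels exactly what the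
  kernel and the log-Lipschitz bound lose in one step. The other obstacle is the order of the
  constants. The sum over the children splits into a part from the admissible functions, where the
  bound \<epsilon> on their energy is multiplied by a factor depending on \<open>j\<close> only, and
  a part from a floor \<eta>, whose factor depends on \<open>N\<close>. So \<open>j\<close> is fixed
  by \<tau> and \<open>L\<close>, then \<epsilon>, then a level difference \<open>k\<close> at which
  the modulus is below \<epsilon>, which gives \<open>N = j + k\<close>, and \<eta> comes last. The
  floor keeps the decay of the weights bounded below; it may be tiny, because \<kappa> only has to
  be positive.\<close>

locale weight_system = Metric_space M d for M :: "'a set" and d +
  fixes A \<tau> p \<kappa> h :: real and W :: "nat \<Rightarrow> 'a \<Rightarrow> real"
  assumes A_ge: "2 \<le> A"
    and tau: "0 < \<tau>" "2 * \<tau> \<le> 1" "1 \<le> 2 * \<tau> * A"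
    and p_pos: "0 < p"
    and kappa: "0 < \<kappa>" "\<kappa> < 1"
    and h: "0 < h" "h < 1"
    and W_0: "x \<in> M \<Longrightarrow> W 0 x = 1"
    and W_pos: "x \<in> M \<Longrightarrow> 0 < W n x"
    and W_lip: "\<lbrakk>x \<in> M; y \<in> M\<rbrakk> \<Longrightarrow> W n x \<le> exp (d x y * A ^ n) * W n y"
    and W_lower: "x \<in> M \<Longrightarrow> \<kappa> * W n x \<le> W (Suc n) x"
    and W_upper: "x \<in> M \<Longrightarrow> W (Suc n) x \<le> h * W n x"
    and W_path: "\<lbrakk>z \<in> M; ps \<noteq> []; set ps \<subseteq> M; d z (hd ps) < \<tau> / A ^ Suc m;
        successively (\<lambda>x y. d x y < 3 * \<tau> / A ^ Suc m) ps;
        \<forall>x\<in>set ps. d z x < \<tau> / A ^ m; (\<tau> / 2 - 2 * \<tau> / A) / A ^ m \<le> d z (last ps)\<rbrakk>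
        \<Longrightarrow> W m z \<le> sum_list (map (W (Suc m)) ps)"
    and W_branch: "x \<in> M \<Longrightarrow> \<exists>U. finite U \<and> U \<subseteq> M \<and> (\<forall>u\<in>U. d x u < 2 / A ^ n) \<and>
        mball x (1 / A ^ n) \<subseteq> (\<Union>u\<in>U. mball u (1 / A ^ Suc n)) \<and>
        (\<Sum>u\<in>U. W (Suc n) u powr p) \<le> W n x powr p"
    and finite_cover: "\<exists>U. finite U \<and> U \<subseteq> M \<and> M \<subseteq> (\<Union>u\<in>U. mball u 1)"
begin

lemma A_pos: "0 < A" and A_pow_pos: "0 < A ^ n"
  using A_ge by auto

lemma W_antimono:
  assumes "x \<in> M" "m \<le> n"
  shows "W n x \<le> W m x"
  using assms(2)
proof (induction n rule: dec_induct)
  case (step n)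
  have "W (Suc n) x \<le> h * W n x" using W_upper assms by blast
  also have "\<dots> \<le> 1 * W n x"
    using h W_pos[OF \<open>x \<in> M\<close>, of n] by (intro mult_right_mono) auto
  finally show ?case using step by simp
qed simp

section \<open>Chains of jumps and their coarsening\<close>

definition jump :: "nat \<Rightarrow> 'a \<Rightarrow> 'a \<Rightarrow> bool" where
  "jump n x y \<longleftrightarrow> n = 0 \<or> d x y \<le> 2 * \<tau> / A ^ n"

text \<open>The free movement between jumps makes room for the fine jumps that are discarded when a chain
  is coarsened from level \<open>m + 1\<close> to level \<open>m\<close>.\<close>

inductive loose_chain :: "nat \<Rightarrow> 'a \<Rightarrow> real \<Rightarrow> 'a \<Rightarrow> bool" for m where
  base: "\<lbrakk>x \<in> M; y \<in> M; d x y < \<tau> / A ^ m\<rbrakk> \<Longrightarrow> loose_chain m x 0 y"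
| step: "\<lbrakk>x \<in> M; x' \<in> M; d x x' < \<tau> / A ^ m; n \<le> m; q \<in> M; jump n x' q; loose_chain m q c y\<rbrakk>
    \<Longrightarrow> loose_chain m x (W n x' + c) y"

inductive chain :: "'a \<Rightarrow> real \<Rightarrow> 'a \<Rightarrow> bool" where
  base: "x \<in> M \<Longrightarrow> chain x 0 x"
| step: "\<lbrakk>x \<in> M; q \<in> M; jump n x q; chain q c y\<rbrakk> \<Longrightarrow> chain x (W n x + c) y"

lemma loose_chain_nonneg: "loose_chain m x c y \<Longrightarrow> 0 \<le> c"
  by (induction rule: loose_chain.induct) (auto intro!: add_nonneg_nonneg less_imp_le[OF W_pos])

lemma loose_chain_carrier: "loose_chain m x c y \<Longrightarrow> x \<in> M \<and> y \<in> M"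
  by (induction rule: loose_chain.induct) auto

lemma chain_nonneg: "chain x c y \<Longrightarrow> 0 \<le> c"
  by (induction rule: chain.induct) (auto intro!: add_nonneg_nonneg less_imp_le[OF W_pos])

text \<open>A run is the list of starting points of the fine jumps made since the coarse point
  \<open>z\<close>; its clauses are the hypotheses of \<open>W_path\<close> except the exit
  condition. In units of \<open>1 / A ^ Suc m\<close>, the step bound \<open>3 * \<tau>\<close> is a
  jump of length at most \<open>2 * \<tau>\<close> followed by free movement below \<tau>.\<close>

definition run :: "nat \<Rightarrow> 'a \<Rightarrow> 'a list \<Rightarrow> 'a \<Rightarrow> bool" where
  "run m z ps x \<longleftrightarrow> d z x < \<tau> / 2 / A ^ m \<and> set ps \<subseteq> M \<and> (\<forall>y\<in>set ps. d z y < \<tau> / A ^ m) \<and>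
     successively (\<lambda>x y. d x y < 3 * \<tau> / A ^ Suc m) ps \<and> (ps = [] \<longrightarrow> x = z) \<and>
     (ps \<noteq> [] \<longrightarrow> d z (hd ps) < \<tau> / A ^ Suc m \<and> d (last ps) x \<le> 2 * \<tau> / A ^ Suc m)"

lemma run_Nil: "z \<in> M \<Longrightarrow> run m z [] z"
  using tau A_pow_pos by (simp add: run_def)

text \<open>The jumps of level \<open>m + 1\<close> are collected in \<open>ps\<close> until they leave a ball of radius comparable
  to \<open>1 / A ^ m\<close>, when the path condition pays for a single jump of level \<open>m\<close>; if a coarser jump
  comes first, they are absorbed into the free movement before it.\<close>

lemma loose_chain_coarsen_aux:
  assumes "loose_chain (Suc m) x c y" "z \<in> M" "run m z ps x"
  shows "\<exists>c'\<le>sum_list (map (W (Suc m)) ps) + c. loose_chain m z c' y"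
  using assms
proof (induction arbitrary: z ps rule: loose_chain.induct)
  case (base x y)
  \<comment> \<open>As \<open>A\<close> is at least 2, one free movement of level
    \<open>Suc m\<close> takes at most half of the free radius of level \<open>m\<close>; the other
    half is the allowance for the run.\<close>
  have *: "\<tau> / A ^ Suc m \<le> \<tau> / 2 / A ^ m"
    using A_ge tau A_pow_pos[of m] by (simp add: field_simps)
  have "d z y \<le> d z x + d x y"
    using base by (intro triangle) auto
  also have "\<dots> < \<tau> / 2 / A ^ m + \<tau> / 2 / A ^ m"
    using base * by (simp add: run_def)
  finally have "d z y < \<tau> / A ^ m" by simp
  then have "loose_chain m z 0 y" using base by (intro loose_chain.base)
  moreover have "0 \<le> sum_list (map (W (Suc m)) ps)"
    using base by (intro sum_list_nonneg) (auto simp: run_def intro!: less_imp_le[OF W_pos])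
  ultimately show ?case by auto
next
  case (step x x' n q c y)
  have *: "\<tau> / A ^ Suc m \<le> \<tau> / 2 / A ^ m"
    using A_ge tau A_pow_pos[of m] by (simp add: field_simps)
  have "d z x' \<le> d z x + d x x'"
    using step by (intro triangle) auto
  also have "\<dots> < \<tau> / 2 / A ^ m + \<tau> / 2 / A ^ m"
    using step * by (simp add: run_def)
  finally have zx': "d z x' < \<tau> / A ^ m" by simp
  have sum_nonneg: "0 \<le> sum_list (map (W (Suc m)) ps)"
    using step by (intro sum_list_nonneg) (auto simp: run_def intro!: less_imp_le[OF W_pos])
  show ?case
  proof (cases "n \<le> m")
    case True
    obtain c' where "c' \<le> c" "loose_chain m q c' y"
      using step.IH[OF \<open>q \<in> M\<close> run_Nil] step by auto
    then have "loose_chain m z (W n x' + c') y" "W n x' + c' \<le> W n x' + c"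
      using step zx' True by (auto intro!: loose_chain.step[of z x' m n q])
    then show ?thesis using sum_nonneg
      by (intro exI[of _ "W n x' + c'"]) auto
  next
    case False
    then have n: "n = Suc m" using step by simp
    have x'q: "d x' q \<le> 2 * \<tau> / A ^ Suc m"
      using step n by (simp add: jump_def)
    define ps' where "ps' = ps @ [x']"
    have succ: "successively (\<lambda>x y. d x y < 3 * \<tau> / A ^ Suc m) ps'"
    proof (cases "ps = []")
      case False
      then have "last ps \<in> M" using step by (auto simp: run_def)
      then have "d (last ps) x' \<le> d (last ps) x + d x x'"
        using step by (intro triangle) auto
      also have "\<dots> < 2 * \<tau> / A ^ Suc m + \<tau> / A ^ Suc m"
        using step False unfolding run_def by (intro add_le_less_mono) auto
      also have "\<dots> = 3 * \<tau> / A ^ Suc m" by (simp add: field_simps)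
      finally show ?thesis using False step
        by (simp add: ps'_def successively_append_iff run_def)
    qed (simp add: ps'_def)
    have hd: "d z (hd ps') < \<tau> / A ^ Suc m"
      using step by (cases "ps = []") (auto simp: ps'_def run_def)
    have near: "\<forall>y\<in>set ps'. d z y < \<tau> / A ^ m"
      using step zx' by (auto simp: ps'_def run_def)
    have sub: "set ps' \<subseteq> M" using step by (auto simp: ps'_def run_def)
    have last: "last ps' = x'" "ps' \<noteq> []" by (auto simp: ps'_def)
    have sum': "sum_list (map (W (Suc m)) ps') + c = sum_list (map (W (Suc m)) ps) + (W n x' + c)"
      by (simp add: ps'_def n)
    show ?thesis
    proof (cases "d z q < \<tau> / 2 / A ^ m")
      case True
      then have "run m z ps' q"
        using succ hd near sub last x'q by (simp add: run_def)
      from step.IH[OF \<open>z \<in> M\<close> this] show ?thesis using sum' by simp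
    next
      case False
      have zq: "d z q \<le> d z x' + d x' q" using step by (intro triangle) auto
      \<comment> \<open>The run exits at \<open>q\<close>, but the list ends at \<open>x'\<close>,
        where the last jump starts. This costs one jump length and explains the radius
        \<open>\<tau> / 2 - 2 * \<tau> / A\<close> in \<open>W_path\<close>.\<close>
      have "\<tau> / 2 / A ^ m \<le> d z x' + 2 * \<tau> / A ^ Suc m"
        using zq x'q False by linarith
      then have "(\<tau> / 2 - 2 * \<tau> / A) / A ^ m \<le> d z (last ps')"
        using A_pos by (simp add: last diff_divide_distrib)
      then have W: "W m z \<le> sum_list (map (W (Suc m)) ps')"
        using W_path[OF \<open>z \<in> M\<close> _ sub hd succ near] last by simp
      \<comment> \<open>The single jump of level \<open>m\<close> that replaces the run goes from
        \<open>z\<close> straight to the exit point \<open>q\<close>, after which a new empty run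
        starts.\<close>
      have "d z q \<le> \<tau> / A ^ m + 2 * (\<tau> / 2 / A ^ m)"
        using zq x'q zx' * by simp
      then have "jump m z q" by (simp add: jump_def)
      obtain c' where "c' \<le> c" "loose_chain m q c' y"
        using step.IH[OF \<open>q \<in> M\<close> run_Nil] step by auto
      then have "loose_chain m z (W m z + c') y"
        using step \<open>jump m z q\<close> tau A_pow_pos by (intro loose_chain.step[of z z m m q]) auto
      then show ?thesis using W sum' \<open>c' \<le> c\<close>
        by (intro exI[of _ "W m z + c'"]) auto
    qed
  qed
qed

lemma loose_chain_coarsen:
  assumes "loose_chain m x c y" "n \<le> m"
  shows "\<exists>c'\<le>c. loose_chain n x c' y"
  using assms(2,1)
proof (induction arbitrary: c rule: dec_induct)
  case (step m)
  then obtain c' where "c' \<le> c" "loose_chain m x c' y"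
    using loose_chain_coarsen_aux[OF step.prems _ run_Nil] loose_chain_carrier by fastforce
  with step.IH show ?case by (meson order_trans)
qed auto

text \<open>Free movement alone stays below \<open>\<tau> / A ^ n\<close>, so a chain this long has
  a first jump. Its level is at most \<open>n\<close>, hence it costs at least \<open>W n\<close> of
  its starting point, and moving that weight to \<open>x\<close> costs the factor
  \<open>exp (-1)\<close>.\<close>

lemma loose_chain_cost:
  assumes "loose_chain n x c y" "\<tau> / A ^ n \<le> d x y"
  shows "exp (-1) * W n x \<le> c"
  using assms
proof cases
  case (step x' k q c')
  have "d x x' * A ^ n < \<tau>"
    using step A_pow_pos[of n] by (simp add: field_simps)
  then have "W n x \<le> exp 1 * W n x'"
    using W_lip[of x x' n] step tau W_pos[of x' n]
    by (intro order_trans[OF W_lip[of x x' n]] mult_right_mono) auto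
  then have "exp (-1) * W n x \<le> W n x'"
    by (simp add: exp_minus field_simps)
  also have "\<dots> \<le> W k x'" using W_antimono step by blast
  finally show ?thesis using step loose_chain_nonneg by fastforce
qed (use assms in auto)

lemma chain_imp_loose_chain: "chain x c y \<Longrightarrow> \<exists>N. \<forall>m\<ge>N. loose_chain m x c y"
proof (induction rule: chain.induct)
  case (base x)
  then show ?case using tau A_pow_pos by (auto intro!: loose_chain.base)
next
  case (step x q n c y)
  then obtain N where "\<forall>m\<ge>N. loose_chain m q c y" by blast
  then have "\<forall>m\<ge>max N n. loose_chain m x (W n x + c) y"
    using step tau A_pow_pos by (auto intro!: loose_chain.step[of x x _ n q])
  then show ?case by blast
qed

text \<open>A chain has finitely many jumps, so it is a loose chain of every sufficiently fine
  level; coarsening down to level \<open>n\<close> does not raise the cost. Thus no accumulation of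
  cheap fine jumps undercuts a jump of level \<open>n\<close>.\<close>

lemma chain_cost:
  assumes "chain x c y" "\<tau> / A ^ n \<le> d x y"
  shows "exp (-1) * W n x \<le> c"
proof -
  obtain N where "\<forall>m\<ge>N. loose_chain m x c y" using chain_imp_loose_chain assms by blast
  then have "loose_chain (max N n) x c y" by simp
  then obtain c' where "c' \<le> c" "loose_chain n x c' y"
    using loose_chain_coarsen by (metis max.cobounded2)
  with loose_chain_cost assms show ?thesis by fastforce
qed

lemma chain_trans: "chain x c y \<Longrightarrow> chain y c' z \<Longrightarrow> chain x (c + c') z"
proof (induction rule: chain.induct)
  case (step x q n c y)
  then show ?case using chain.step[of x q n "c + c'" z] by (simp add: add.assoc)
qed simp

lemma chain_jump: "x \<in> M \<Longrightarrow> y \<in> M \<Longrightarrow> jump n x y \<Longrightarrow> chain x (W n x) y"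
  using chain.step[of x y n 0 y] chain.base by simp

section \<open>The infimum of the costs and its symmetrization\<close>

definition chain_cost_inf :: "'a \<Rightarrow> 'a \<Rightarrow> real" where
  "chain_cost_inf x y = Inf {c. chain x c y}"

text \<open>Jumps of level 0 have no length bound, so any two points are joined by one of them, at
  cost 1.\<close>

lemma chain_exists: "x \<in> M \<Longrightarrow> y \<in> M \<Longrightarrow> \<exists>c. chain x c y"
  using chain_jump[of x y 0] by (auto simp: jump_def)

lemma chain_cost_inf_le: "chain x c y \<Longrightarrow> chain_cost_inf x y \<le> c"
  unfolding chain_cost_inf_def
  by (intro cInf_lower bdd_belowI[of _ 0]) (auto dest: chain_nonneg)

lemma chain_cost_inf_ge:
  assumes "x \<in> M" "y \<in> M" "\<And>c. chain x c y \<Longrightarrow> b \<le> c"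
  shows "b \<le> chain_cost_inf x y"
  unfolding chain_cost_inf_def using assms chain_exists
  by (intro cInf_greatest) auto

lemma chain_cost_inf_triangle:
  assumes "x \<in> M" "y \<in> M" "z \<in> M"
  shows "chain_cost_inf x z \<le> chain_cost_inf x y + chain_cost_inf y z"
proof -
  have "chain_cost_inf x z - c' \<le> chain_cost_inf x y" if c': "chain y c' z" for c'
    using assms chain_cost_inf_le[OF chain_trans[OF _ c']]
    by (intro chain_cost_inf_ge) (auto simp: algebra_simps)
  then have "chain_cost_inf x z - chain_cost_inf x y \<le> chain_cost_inf y z"
    using assms by (intro chain_cost_inf_ge) (auto simp: algebra_simps)
  then show ?thesis by simp
qed

text \<open>A jump is charged at its starting point, which makes the cost asymmetric; adding both
  directions repairs this. The value 0 off \<open>M\<close> serves the axioms of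
  \<open>Metric_space\<close> that range over the whole type.\<close>

definition theta :: "'a \<Rightarrow> 'a \<Rightarrow> real" where
  "theta x y = (if x \<in> M \<and> y \<in> M then chain_cost_inf x y + chain_cost_inf y x else 0)"

lemma chain_cost_inf_nonneg: "x \<in> M \<Longrightarrow> y \<in> M \<Longrightarrow> 0 \<le> chain_cost_inf x y"
  using chain_nonneg by (intro chain_cost_inf_ge) auto

lemma theta_lower:
  assumes "x \<in> M" "y \<in> M" "\<tau> / A ^ n \<le> d x y"
  shows "exp (-1) * W n x \<le> theta x y"
proof -
  have "exp (-1) * W n x \<le> chain_cost_inf x y"
    using assms by (intro chain_cost_inf_ge chain_cost[of x _ y n]) auto
  then show ?thesis
    using assms chain_cost_inf_nonneg[of y x] by (simp add: theta_def)
qed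

lemma theta_upper:
  assumes "x \<in> M" "y \<in> M" "jump n x y"
  shows "theta x y \<le> 4 * W n x"
proof -
  \<comment> \<open>The constant 4 is 1 for the jump from \<open>x\<close> plus 3, a bound for
    \<open>exp 1\<close>, for the jump back from \<open>y\<close>.\<close>
  have "W n y \<le> 3 * W n x"
  proof (cases "n = 0")
    case False
    then have "d y x * A ^ n \<le> 1"
      using assms tau A_pow_pos[of n] by (simp add: jump_def commute field_simps)
    then have "W n y \<le> exp 1 * W n x"
      using assms W_pos[of x n]
      by (intro order_trans[OF W_lip[of y x n]] mult_right_mono) auto
    also have "\<dots> \<le> 3 * W n x"
      using exp_le W_pos[of x n] assms by (intro mult_right_mono) auto
    finally show ?thesis .
  qed (use assms W_0 in auto)
  moreover have "chain x (W n x) y" "chain y (W n y) x"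
    using assms by (auto intro!: chain_jump simp: jump_def commute)
  ultimately show ?thesis
    using assms chain_cost_inf_le[of x "W n x" y] chain_cost_inf_le[of y "W n y" x]
    by (simp add: theta_def)
qed

lemma tau_scale_le_dist:
  assumes "x \<in> M" "y \<in> M" "x \<noteq> y"
  shows "\<exists>n. \<tau> / A ^ n \<le> d x y"
proof -
  have "0 < d x y" using assms by simp
  moreover have "(\<lambda>n. \<tau> * (1 / A) ^ n) \<longlonglongrightarrow> \<tau> * 0"
    using A_ge by (intro tendsto_mult tendsto_const LIMSEQ_power_zero) auto
  ultimately have "\<forall>\<^sub>F n in sequentially. \<tau> * (1 / A) ^ n < d x y"
    by (intro order_tendstoD) auto
  then show ?thesis
    unfolding eventually_sequentially by (metis less_imp_le order_refl power_one_over times_divide_eq_right mult.right_neutral)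
qed

lemma theta_metric: "Metric_space M theta"
proof
  show "0 \<le> theta x y" for x y
    by (simp add: theta_def chain_cost_inf_nonneg)
  show "theta x y = theta y x" for x y by (simp add: theta_def)
  show "theta x y = 0 \<longleftrightarrow> x = y" if "x \<in> M" "y \<in> M" for x y
  proof
    show "x = y" if "theta x y = 0"
    proof (rule ccontr)
      assume "x \<noteq> y"
      then obtain n where "\<tau> / A ^ n \<le> d x y"
        using tau_scale_le_dist \<open>x \<in> M\<close> \<open>y \<in> M\<close> by blast
      then have "exp (-1) * W n x \<le> 0"
        using theta_lower[of x y n] that \<open>x \<in> M\<close> \<open>y \<in> M\<close> by simp
      then show False using W_pos[OF \<open>x \<in> M\<close>, of n] by (simp add: mult_le_0_iff)
    qed
    show "theta x y = 0" if "x = y"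
      using chain_cost_inf_le[OF chain.base] chain_cost_inf_nonneg[of x x] that \<open>x \<in> M\<close>
      by (force simp: theta_def)
  qed
  show "theta x z \<le> theta x y + theta y z" if "x \<in> M" "y \<in> M" "z \<in> M" for x y z
    using that chain_cost_inf_triangle[of x y z] chain_cost_inf_triangle[of z y x]
    by (simp add: theta_def)
qed

end

section \<open>Power quasisymmetry\<close>

lemma geometric_bounds:
  fixes u :: "nat \<Rightarrow> real"
  assumes "\<And>n. l * u n \<le> u (Suc n)" "\<And>n. u (Suc n) \<le> h * u n" "0 \<le> l" "0 \<le> h"
  shows "l ^ k * u n \<le> u (n + k)" "u (n + k) \<le> h ^ k * u n"
proof (induction k)
  case (Suc k)
  case 1
  have "l ^ Suc k * u n \<le> l * u (n + k)"
    using mult_left_mono[OF Suc(1) assms(3)] by (simp add: mult_ac)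
  also have "\<dots> \<le> u (n + Suc k)" using assms(1) by simp
  finally show ?case .
  case 2
  have "u (n + Suc k) \<le> h * u (n + k)" using assms(2) by simp
  also have "\<dots> \<le> h ^ Suc k * u n"
    using mult_left_mono[OF Suc(2) assms(4)] by (simp add: mult_ac)
  finally show ?case .
qed auto

text \<open>Both ratios are exponential in the level difference \<open>k\<close>, so it suffices to
  compare rates per level. For \<open>m \<ge> n\<close> the comparison is of \<open>h ^ k\<close>
  with \<open>l' ^ k\<close> and gives the exponent \<open>1 / \<alpha>\<close>; for
  \<open>m < n\<close> it is of \<open>1 / l ^ k\<close> with \<open>1 / h' ^ k\<close> and gives
  \<alpha>.\<close>

lemma geometric_ratio_le:
  fixes u w :: "nat \<Rightarrow> real"
  assumes u: "\<And>n. 0 < u n" "\<And>n. l * u n \<le> u (Suc n)" "\<And>n. u (Suc n) \<le> h * u n" "0 < l" "0 < h"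
    and w: "\<And>n. 0 < w n" "\<And>n. l' * w n \<le> w (Suc n)" "\<And>n. w (Suc n) \<le> h' * w n" "0 < l'" "0 < h'"
    and \<alpha>: "0 < \<alpha>" "h \<le> l' powr (1 / \<alpha>)" "h' powr \<alpha> \<le> l"
  shows "u m / u n \<le> max ((w m / w n) powr \<alpha>) ((w m / w n) powr (1 / \<alpha>))"
proof (cases "n \<le> m")
  case True
  then obtain k where k: "m = n + k" using le_Suc_ex by blast
  have "u m / u n \<le> h ^ k"
    using geometric_bounds(2)[of l u h n k] u k by (simp add: field_simps less_imp_le)
  also have "\<dots> \<le> (l' powr (1 / \<alpha>)) ^ k"
    using \<alpha> u by (intro power_mono) auto
  also have "\<dots> = (l' ^ k) powr (1 / \<alpha>)"
    using w by (simp add: powr_power flip: powr_realpow powr_powr) (simp add: powr_powr mult.commute)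
  also have "\<dots> \<le> (w m / w n) powr (1 / \<alpha>)"
    using geometric_bounds(1)[of l' w h' k n] w k \<alpha>
    by (intro powr_mono2) (auto simp: field_simps less_imp_le)
  finally show ?thesis by simp
next
  case False
  then obtain k where k: "n = m + k" using le_Suc_ex by (metis nat_le_linear)
  have "u m / u n \<le> 1 / l ^ k"
    using geometric_bounds(1)[of l u h k m] u k by (simp add: field_simps less_imp_le)
  also have "\<dots> \<le> 1 / (h' powr \<alpha>) ^ k"
    using \<alpha> u w by (intro divide_left_mono power_mono) auto
  also have "\<dots> = (1 / h' ^ k) powr \<alpha>"
    using w by (simp add: powr_divide powr_power flip: powr_realpow) (simp add: powr_powr mult.commute)
  also have "\<dots> \<le> (w m / w n) powr \<alpha>"
    using geometric_bounds(2)[of l' w h' m k] w k \<alpha>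
    by (intro powr_mono2) (auto simp: field_simps less_imp_le)
  finally show ?thesis by simp
qed

lemma geometric_ratio_exponent:
  fixes l h l' h' :: real
  assumes "0 < l" "0 < h" "h < 1" "0 < l'" "0 < h'" "h' < 1"
    and \<alpha>: "1 \<le> \<alpha>" "ln l' / ln h \<le> \<alpha>" "ln l / ln h' \<le> \<alpha>"
  shows "h \<le> l' powr (1 / \<alpha>)" "h' powr \<alpha> \<le> l"
proof -
  have "\<alpha> * ln h \<le> ln l'" using assms by (simp add: field_simps)
  then have "ln h \<le> ln l' / \<alpha>" using \<alpha> by (simp add: field_simps)
  then show "h \<le> l' powr (1 / \<alpha>)"
    using assms by (simp add: powr_def) (metis exp_le_cancel_iff exp_ln)
  have "\<alpha> * ln h' \<le> ln l" using assms by (simp add: field_simps)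
  then show "h' powr \<alpha> \<le> l"
    using assms by (simp add: powr_def) (metis exp_le_cancel_iff exp_ln)
qed

text \<open>Transfers an inequality between model ratios to the true ones. Each quotient picks up
  \<open>K\<close> in the numerator and in the denominator; inside the powers
  \<open>K\<^sup>2 \<ge> 1\<close> and \<open>1 / \<alpha> \<le> \<alpha>\<close> bound both
  resulting factors by \<open>K\<^sup>2 powr \<alpha>\<close>.\<close>

lemma comparable_ratio_le:
  fixes f g s t u v w z K \<alpha> :: real
  assumes "1 \<le> K" "1 \<le> \<alpha>" "f \<le> K * u" "v \<le> K * g" "w \<le> K * s" "t \<le> K * z"
    and pos: "0 < u" "0 < v" "0 < w" "0 < z" "0 < g" "0 < s" "0 < t"
    and le: "u / v \<le> max ((w / z) powr \<alpha>) ((w / z) powr (1 / \<alpha>))"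
  shows "f / g \<le> (K\<^sup>2 * K\<^sup>2 powr \<alpha>) * max ((s / t) powr \<alpha>) ((s / t) powr (1 / \<alpha>))"
proof -
  have "1 \<le> K\<^sup>2" using assms(1) by simp
  have "w * t \<le> (K * s) * (K * z)"
    using assms by (intro mult_mono) auto
  then have wz: "w / z \<le> K\<^sup>2 * (s / t)"
    using pos by (simp add: field_simps power2_eq_square)
  have "f * v \<le> (K * u) * (K * g)"
    using assms by (intro mult_mono) auto
  then have "f / g \<le> K\<^sup>2 * (u / v)"
    using pos by (simp add: field_simps power2_eq_square)
  also have "\<dots> \<le> K\<^sup>2 * max ((w / z) powr \<alpha>) ((w / z) powr (1 / \<alpha>))"
    using le by (intro mult_left_mono) auto
  also have "\<dots> \<le> K\<^sup>2 * max ((K\<^sup>2 * (s / t)) powr \<alpha>) ((K\<^sup>2 * (s / t)) powr (1 / \<alpha>))"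
    using wz pos assms(2) by (intro mult_left_mono max.mono powr_mono2) auto
  also have "\<dots> \<le> K\<^sup>2 * max (K\<^sup>2 powr \<alpha> * (s / t) powr \<alpha>) (K\<^sup>2 powr \<alpha> * (s / t) powr (1 / \<alpha>))"
  proof -
    have "1 / \<alpha> \<le> \<alpha>" by (rule order_trans[of _ 1]) (use assms(2) in auto)
    then show ?thesis
      using pos \<open>1 \<le> K\<^sup>2\<close>
      unfolding powr_mult
      by (intro mult_left_mono max.mono mult_right_mono powr_mono) auto
  qed
  also have "\<dots> = (K\<^sup>2 * K\<^sup>2 powr \<alpha>) * max ((s / t) powr \<alpha>) ((s / t) powr (1 / \<alpha>))"
    by (simp add: max_mult_distrib_left)
  finally show ?thesis .
qed

text \<open>The two powers change order at 1, which both fix: the maximum is the power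
  \<open>1 / \<alpha>\<close> below 1 and the power \<alpha> above. Inverting each branch gives the
  minimum of the same two powers.\<close>

lemma power_homeomorphism:
  fixes C \<alpha> :: real
  assumes "0 < C" "1 \<le> \<alpha>"
  shows "homeomorphism {0..} {0..} (\<lambda>t. C * max (t powr \<alpha>) (t powr (1 / \<alpha>)))
    (\<lambda>s. min ((s / C) powr (1 / \<alpha>)) ((s / C) powr \<alpha>))"
proof -
  have \<alpha>: "0 < \<alpha>" using assms(2) by simp
  have \<alpha>': "1 / \<alpha> \<le> \<alpha>" by (rule order_trans[of _ 1]) (use assms(2) in auto)
  have max_le: "max (t powr \<alpha>) (t powr (1 / \<alpha>)) = t powr (1 / \<alpha>)" if "0 \<le> t" "t \<le> 1" for t :: real
    using that powr_mono'[of "1 / \<alpha>" \<alpha> t] \<alpha> \<alpha>' by (simp add: max_absorb2)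
  have max_ge: "max (t powr \<alpha>) (t powr (1 / \<alpha>)) = t powr \<alpha>" if "1 \<le> t" for t :: real
    using that powr_mono[of "1 / \<alpha>" \<alpha> t] \<alpha> \<alpha>' by (simp add: max_absorb1)
  have min_le: "min (t powr (1 / \<alpha>)) (t powr \<alpha>) = t powr \<alpha>" if "0 \<le> t" "t \<le> 1" for t :: real
    using that powr_mono'[of "1 / \<alpha>" \<alpha> t] \<alpha> \<alpha>' by (simp add: min_absorb2)
  have min_ge: "min (t powr (1 / \<alpha>)) (t powr \<alpha>) = t powr (1 / \<alpha>)" if "1 \<le> t" for t :: real
    using that powr_mono[of "1 / \<alpha>" \<alpha> t] \<alpha> \<alpha>' by (simp add: min_absorb1)
  have inv: "(s powr (1 / \<alpha>)) powr \<alpha> = s" "(s powr \<alpha>) powr (1 / \<alpha>) = s" if "0 \<le> s" for s :: real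
    using that \<alpha> by (auto simp: powr_powr)
  have le1: "s powr b \<le> 1" if "0 \<le> s" "s \<le> 1" "0 \<le> b" for s b :: real
    using powr_mono2[of b s 1] that by simp
  have cont: "continuous_on {0..} (\<lambda>t. C * max (t powr \<alpha>) (t powr (1 / \<alpha>)))"
    "continuous_on {0..} (\<lambda>s. min ((s / C) powr (1 / \<alpha>)) ((s / C) powr \<alpha>))"
    using \<alpha> assms by (auto intro!: continuous_intros continuous_on_powr')
  have 1: "min ((C * max (t powr \<alpha>) (t powr (1 / \<alpha>)) / C) powr (1 / \<alpha>)) ((C * max (t powr \<alpha>) (t powr (1 / \<alpha>)) / C) powr \<alpha>) = t"
    if "0 \<le> t" for t
  proof (cases "t \<le> 1")
    case True
    have "C * max (t powr \<alpha>) (t powr (1 / \<alpha>)) / C = t powr (1 / \<alpha>)"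
      using that True assms by (simp add: max_le)
    then show ?thesis
      using that True \<alpha> min_le[of "t powr (1 / \<alpha>)"] by (simp add: le1 inv)
  next
    case False
    have "C * max (t powr \<alpha>) (t powr (1 / \<alpha>)) / C = t powr \<alpha>"
      using that False assms by (simp add: max_ge)
    then show ?thesis
      using that False \<alpha> min_ge[of "t powr \<alpha>"] by (simp add: ge_one_powr_ge_zero inv)
  qed
  have 2: "C * max (min ((s / C) powr (1 / \<alpha>)) ((s / C) powr \<alpha>) powr \<alpha>) (min ((s / C) powr (1 / \<alpha>)) ((s / C) powr \<alpha>) powr (1 / \<alpha>)) = s"
    if "0 \<le> s" for s
  proof (cases "s / C \<le> 1")
    case True
    have "0 \<le> s / C" using that assms by simp
    then show ?thesis
      using assms \<alpha> True max_le[of "(s / C) powr \<alpha>"]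
      unfolding min_le[OF \<open>0 \<le> s / C\<close> True] by (simp add: le1 inv)
  next
    case False
    then have "1 \<le> s / C" by simp
    then show ?thesis
      using assms \<alpha> max_ge[of "(s / C) powr (1 / \<alpha>)"]
      unfolding min_ge[OF \<open>1 \<le> s / C\<close>] by (simp add: ge_one_powr_ge_zero inv)
  qed
  show ?thesis
  proof (rule homeomorphismI[OF cont])
    show "(\<lambda>t. C * max (t powr \<alpha>) (t powr (1 / \<alpha>))) ` {0..} \<subseteq> {0..}"
      using assms by (auto simp: le_max_iff_disj)
    show "(\<lambda>s. min ((s / C) powr (1 / \<alpha>)) ((s / C) powr \<alpha>)) ` {0..} \<subseteq> {0..}"
      by auto
  qed (rule 1 2, simp)+
qed

lemma quasisymmetricI_power:
  assumes "0 < C" "1 \<le> \<alpha>"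
    and "\<And>x a b. \<lbrakk>x \<in> X; a \<in> X; b \<in> X; x \<noteq> b\<rbrakk> \<Longrightarrow>
      \<theta> x a / \<theta> x b \<le> C * max ((d x a / d x b) powr \<alpha>) ((d x a / d x b) powr (1 / \<alpha>))"
  shows "quasisymmetric X d \<theta>"
  unfolding quasisymmetric_def
  by (intro exI conjI, rule power_homeomorphism[OF assms(1,2)]) (intro ballI impI, rule assms(3))

lemma cover_num_le:
  assumes "finite S" "S \<subseteq> X" "B \<subseteq> (\<Union>c\<in>S. Metric_space.mball X d c r)" "real (card S) \<le> b"
  shows "cover_num X d r B \<le> ereal b"
proof -
  have "cover_num X d r B \<le> ereal (real (card S))"
    unfolding cover_num_def using assms by (intro Inf_lower) auto
  also have "\<dots> \<le> ereal b" using assms by simp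
  finally show ?thesis .
qed

lemma assouad_dim_le:
  assumes "0 < \<beta>" "0 < C"
    and "\<And>x r R. \<lbrakk>x \<in> X; 0 < r; r < R\<rbrakk> \<Longrightarrow>
      cover_num X d r (Metric_space.mball X d x R) \<le> ereal (C * (R / r) powr \<beta>)"
  shows "assouad_dim X d \<le> ereal \<beta>"
  unfolding assouad_dim_def
proof (intro Inf_lower imageI CollectI conjI)
  show "\<exists>C>0. \<forall>x\<in>X. \<forall>r R. 0 < r \<and> r < R \<longrightarrow>
      cover_num X d r (Metric_space.mball X d x R) \<le> ereal (C * (R / r) powr \<beta>)"
    using assms(2,3) by (intro exI[of _ C]) simp
qed (rule assms(1))

section \<open>Comparison of the chain metric with the weights\<close>

context weight_system begin

lemma bounded_dist: "\<exists>D>0. \<forall>x\<in>M. \<forall>y\<in>M. d x y \<le> D"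
proof -
  obtain U where U: "finite U" "U \<subseteq> M" "M \<subseteq> (\<Union>u\<in>U. mball u 1)"
    using finite_cover by blast
  define D where "D = 2 + (\<Sum>u\<in>U. \<Sum>u'\<in>U. d u u')"
  have "d x y \<le> D" if xy: "x \<in> M" "y \<in> M" for x y
  proof -
    obtain u u' where u: "u \<in> U" "u' \<in> U" "x \<in> mball u 1" "y \<in> mball u' 1"
      using xy U by blast
    have "d u u' \<le> (\<Sum>u'\<in>U. d u u')"
      using u U by (intro member_le_sum) auto
    also have "\<dots> \<le> (\<Sum>u\<in>U. \<Sum>u'\<in>U. d u u')"
      using u U by (intro member_le_sum[of u U "\<lambda>u. \<Sum>u'\<in>U. d u u'"]) (auto intro: sum_nonneg)
    finally have "d u u' \<le> D - 2" by (simp add: D_def)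
    moreover have "d x y \<le> d x u + d u u' + d u' y"
      using triangle[of x u y] triangle[of u u' y] u U by (auto simp: subset_iff)
    ultimately show ?thesis using u by (auto simp: commute)
  qed
  moreover have "0 < D" unfolding D_def by (intro add_pos_nonneg sum_nonneg) auto
  ultimately show ?thesis by blast
qed

lemma scale_of_pair:
  assumes "x \<in> M" "y \<in> M" "x \<noteq> y"
  obtains n where "\<tau> / A ^ n \<le> d x y" "n = 0 \<or> d x y < \<tau> / A ^ (n - 1)"
proof -
  define n where "n = (LEAST n. \<tau> / A ^ n \<le> d x y)"
  have "\<tau> / A ^ n \<le> d x y"
    unfolding n_def using tau_scale_le_dist[OF assms] by (rule LeastI_ex)
  moreover have "n = 0 \<or> \<not> \<tau> / A ^ (n - 1) \<le> d x y"
    unfolding n_def using not_less_Least[of "n - 1" "\<lambda>n. \<tau> / A ^ n \<le> d x y"] n_def by fastforce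
  ultimately show ?thesis using that by force
qed

text \<open>The level of a pair is the first \<open>n\<close> with
  \<open>\<tau> / A ^ n \<le> d x y\<close>. Then \<open>theta_lower\<close> applies at
  \<open>n\<close> and \<open>theta_upper\<close> at \<open>n - 1\<close>; the shift by one level
  costs \<open>1 / \<kappa>\<close> for the weight and \<open>A\<close> for the distance. At level 0
  the diameter bounds the distance.\<close>

lemma theta_comparable:
  "\<exists>K\<ge>1. \<forall>x\<in>M. \<forall>y\<in>M. x \<noteq> y \<longrightarrow> (\<exists>n. theta x y \<le> K * W n x \<and> W n x \<le> K * theta x y \<and>
      d x y \<le> K * (1 / A ^ n) \<and> 1 / A ^ n \<le> K * d x y)"
proof -
  obtain D where D: "0 < D" "\<forall>x\<in>M. \<forall>y\<in>M. d x y \<le> D"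
    using bounded_dist by blast
  define K where "K = max (max (4 / \<kappa>) 3) (max (max D A) (1 / \<tau>))"
  have K: "4 / \<kappa> \<le> K" "3 \<le> K" "D \<le> K" "A \<le> K" "1 / \<tau> \<le> K"
    by (auto simp: K_def)
  have "\<exists>n. theta x y \<le> K * W n x \<and> W n x \<le> K * theta x y \<and>
      d x y \<le> K * (1 / A ^ n) \<and> 1 / A ^ n \<le> K * d x y" if xy: "x \<in> M" "y \<in> M" "x \<noteq> y" for x y
  proof -
    obtain n where n: "\<tau> / A ^ n \<le> d x y" "n = 0 \<or> d x y < \<tau> / A ^ (n - 1)"
      using scale_of_pair[OF xy] .
    have th0: "0 \<le> theta x y" by (simp add: theta_def chain_cost_inf_nonneg)
    have "W n x \<le> exp 1 * theta x y"
      using theta_lower[OF xy(1,2) n(1)] by (simp add: exp_minus field_simps)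
    also have "\<dots> \<le> K * theta x y"
      using exp_le K th0 by (intro mult_right_mono) auto
    finally have 1: "W n x \<le> K * theta x y" .
    have "1 / A ^ n \<le> 1 / \<tau> * d x y"
      using n tau A_pow_pos[of n] by (simp add: field_simps)
    also have "\<dots> \<le> K * d x y" using K by (intro mult_right_mono) auto
    finally have 2: "1 / A ^ n \<le> K * d x y" .
    have 3: "theta x y \<le> K * W n x \<and> d x y \<le> K * (1 / A ^ n)"
    proof (cases n)
      case 0
      have "theta x y \<le> 4 * 1"
        using theta_upper[of x y 0] xy W_0 by (simp add: jump_def)
      also have "\<dots> \<le> 4 / \<kappa>" using kappa by (simp add: field_simps)
      finally show ?thesis using 0 D K xy W_0 by auto (meson order_trans)
    next
      case (Suc k)
      then have dk: "d x y < \<tau> / A ^ k" using n by simp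
      also have "\<dots> \<le> 2 * \<tau> / A ^ k" using tau A_pow_pos[of k] by (intro divide_right_mono) auto
      finally have "theta x y \<le> 4 * W k x"
        using theta_upper[of x y k] xy by (simp add: jump_def)
      also have "\<dots> \<le> 4 / \<kappa> * W n x"
        using W_lower[of x k] xy kappa Suc by (simp add: field_simps)
      also have "\<dots> \<le> K * W n x"
        using K W_pos[of x n] xy by (intro mult_right_mono) auto
      finally have "theta x y \<le> K * W n x" .
      moreover have "d x y \<le> 1 / A ^ k"
        using dk tau A_pow_pos[of k] by (simp add: field_simps)
      then have "d x y \<le> A * (1 / A ^ n)" using Suc A_pos by simp
      then have "d x y \<le> K * (1 / A ^ n)"
        using K A_pow_pos[of n] by (elim order_trans) (intro mult_right_mono, auto)
      ultimately show ?thesis by blast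
    qed
    show ?thesis using 1 2 3 by blast
  qed
  then show ?thesis using K by (intro exI[of _ K]) auto
qed

lemma theta_ratio_bounds:
  "\<exists>C \<alpha>. 1 \<le> C \<and> 1 \<le> \<alpha> \<and> (\<forall>x\<in>M. \<forall>a\<in>M. \<forall>b\<in>M. x \<noteq> b \<longrightarrow>
     theta x a / theta x b \<le> C * max ((d x a / d x b) powr \<alpha>) ((d x a / d x b) powr (1 / \<alpha>)) \<and>
     d x a / d x b \<le> C * max ((theta x a / theta x b) powr \<alpha>) ((theta x a / theta x b) powr (1 / \<alpha>)))"
proof -
  interpret T: Metric_space M theta by (rule theta_metric)
  obtain K where K: "1 \<le> K" "\<And>x y. \<lbrakk>x \<in> M; y \<in> M; x \<noteq> y\<rbrakk> \<Longrightarrow> \<exists>n. theta x y \<le> K * W n x \<and>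
      W n x \<le> K * theta x y \<and> d x y \<le> K * (1 / A ^ n) \<and> 1 / A ^ n \<le> K * d x y"
    using theta_comparable by blast
  \<comment> \<open>Per level the weights at a point decay by a factor between \<kappa> and
    \<open>h\<close>, distances by exactly \<open>1 / A\<close>. The same two quotients of
    logarithms are needed for both directions, since exchanging the two sequences exchanges the
    quotients.\<close>
  define \<alpha> where "\<alpha> = Max {1, ln (1 / A) / ln h, ln \<kappa> / ln (1 / A)}"
  have \<alpha>: "1 \<le> \<alpha>" "ln (1 / A) / ln h \<le> \<alpha>" "ln \<kappa> / ln (1 / A) \<le> \<alpha>"
    by (auto simp: \<alpha>_def)
  define C where "C = K\<^sup>2 * K\<^sup>2 powr \<alpha>"
  have "1 \<le> C" unfolding C_def using K(1) \<alpha>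
    using mult_mono[of 1 "K\<^sup>2" 1 "K\<^sup>2 powr \<alpha>"] ge_one_powr_ge_zero[of "K\<^sup>2" \<alpha>] by simp
  have exps: "h \<le> (1 / A) powr (1 / \<alpha>)" "(1 / A) powr \<alpha> \<le> \<kappa>"
    using geometric_ratio_exponent[of \<kappa> h "1 / A" "1 / A" \<alpha>] \<alpha> kappa h A_ge by auto
  have exps': "1 / A \<le> \<kappa> powr (1 / \<alpha>)" "h powr \<alpha> \<le> 1 / A"
    using geometric_ratio_exponent[of "1 / A" "1 / A" \<kappa> h \<alpha>] \<alpha> kappa h A_ge by auto
  have "theta x a / theta x b \<le> C * max ((d x a / d x b) powr \<alpha>) ((d x a / d x b) powr (1 / \<alpha>)) \<and>
     d x a / d x b \<le> C * max ((theta x a / theta x b) powr \<alpha>) ((theta x a / theta x b) powr (1 / \<alpha>))"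
    if xab: "x \<in> M" "a \<in> M" "b \<in> M" "x \<noteq> b" for x a b
  proof (cases "a = x")
    case True
    then show ?thesis using xab \<open>1 \<le> C\<close> by simp
  next
    case False
    obtain m where m: "theta x a \<le> K * W m x" "W m x \<le> K * theta x a" "d x a \<le> K * (1 / A ^ m)"
        "1 / A ^ m \<le> K * d x a"
      using K(2)[of x a] xab False by blast
    obtain n where n: "theta x b \<le> K * W n x" "W n x \<le> K * theta x b" "d x b \<le> K * (1 / A ^ n)"
        "1 / A ^ n \<le> K * d x b"
      using K(2)[of x b] xab by blast
    have pos: "0 < theta x a" "0 < theta x b" "0 < d x a" "0 < d x b"
      using xab False by auto
    have Wpos: "0 < W k x" and Apos: "0 < 1 / A ^ k" for k using W_pos xab A_pow_pos by auto
    have Wl: "\<kappa> * W k x \<le> W (Suc k) x" and Wh: "W (Suc k) x \<le> h * W k x" for k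
      using W_lower W_upper xab by auto
    have Apos1: "0 < 1 / A" and \<alpha>0: "0 < \<alpha>" using A_pos \<alpha> by auto
    have Ae: "1 / A * (1 / A ^ k) = 1 / A ^ Suc k" for k by simp
    have Al: "1 / A * (1 / A ^ k) \<le> 1 / A ^ Suc k" "1 / A ^ Suc k \<le> 1 / A * (1 / A ^ k)" for k
      unfolding Ae by simp_all
    have "W m x / W n x \<le> max ((1 / A ^ m / (1 / A ^ n)) powr \<alpha>) ((1 / A ^ m / (1 / A ^ n)) powr (1 / \<alpha>))"
      by (rule geometric_ratio_le[of "\<lambda>n. W n x" \<kappa> h "\<lambda>n. 1 / A ^ n" "1 / A" "1 / A",
            OF Wpos Wl Wh kappa(1) h(1) Apos Al(1) Al(2) Apos1 Apos1 \<alpha>0 exps])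
    then have "theta x a / theta x b \<le> C * max ((d x a / d x b) powr \<alpha>) ((d x a / d x b) powr (1 / \<alpha>))"
      unfolding C_def
      by (rule comparable_ratio_le[OF K(1) \<alpha>(1) m(1) n(2) m(4) n(3) Wpos Wpos Apos Apos pos(2,3,4)])
    moreover have "1 / A ^ m / (1 / A ^ n) \<le> max ((W m x / W n x) powr \<alpha>) ((W m x / W n x) powr (1 / \<alpha>))"
      by (rule geometric_ratio_le[of "\<lambda>n. 1 / A ^ n" "1 / A" "1 / A" "\<lambda>n. W n x" \<kappa> h,
            OF Apos Al(1) Al(2) Apos1 Apos1 Wpos Wl Wh kappa(1) h(1) \<alpha>0 exps'])
    then have "d x a / d x b \<le> C * max ((theta x a / theta x b) powr \<alpha>) ((theta x a / theta x b) powr (1 / \<alpha>))"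
      unfolding C_def
      by (rule comparable_ratio_le[OF K(1) \<alpha>(1) m(3) n(4) m(2) n(1) Apos Apos Wpos Wpos pos(4,1,2)])
    ultimately show ?thesis by blast
  qed
  then show ?thesis using \<open>1 \<le> C\<close> \<alpha> by blast
qed

lemma theta_in_power_conformal_gauge: "theta \<in> power_conformal_gauge M d"
proof -
  obtain C \<alpha> where *: "1 \<le> C" "1 \<le> \<alpha>" "\<And>x a b. \<lbrakk>x \<in> M; a \<in> M; b \<in> M; x \<noteq> b\<rbrakk> \<Longrightarrow>
     theta x a / theta x b \<le> C * max ((d x a / d x b) powr \<alpha>) ((d x a / d x b) powr (1 / \<alpha>)) \<and>
     d x a / d x b \<le> C * max ((theta x a / theta x b) powr \<alpha>) ((theta x a / theta x b) powr (1 / \<alpha>))"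
    using theta_ratio_bounds by blast
  have "quasisymmetric M d theta"
    using * by (intro quasisymmetricI_power[of C \<alpha>]) auto
  then show ?thesis
    unfolding power_conformal_gauge_def conformal_gauge_def power_quasisymmetric_def
    using * theta_metric by blast
qed

end

section \<open>Assouad dimension of the chain metric\<close>

context weight_system begin

lemma W_le_power: "x \<in> M \<Longrightarrow> W n x \<le> h ^ n"
  using geometric_bounds(2)[of \<kappa> "\<lambda>n. W n x" h 0 n] W_lower[of x] W_upper[of x] W_0[of x] kappa h
  by simp

text \<open>The least weight, relative to \<open>r\<close>, of a ball reached by the subdivision
  below: its parent has weight at least \<open>\<kappa> / 4 * r\<close>, moving to a child's centre
  within \<open>2 / A ^ n\<close> loses \<open>exp (-2)\<close>, and descending one level loses
  \<kappa>.\<close>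

definition cov_const :: real where
  "cov_const = \<kappa> * exp (-2) * (\<kappa> / 4)"

lemma cov_const: "0 < cov_const" "cov_const < 1 / 4"
proof -
  have "\<kappa> * exp (-2) \<le> 1 * 1" using kappa by (intro mult_mono) auto
  then have "(\<kappa> * exp (-2)) * (\<kappa> / 4) \<le> 1 * (\<kappa> / 4)"
    using kappa by (intro mult_right_mono) auto
  also have "\<dots> < 1 / 4"
    using kappa by simp
  finally show "cov_const < 1 / 4" by (simp add: cov_const_def)
qed (use kappa in \<open>simp add: cov_const_def\<close>)

lemma ball_cover_single:
  assumes "v \<in> M" "W n v < \<kappa> / 4 * r"
  shows "mball v (1 / A ^ n) \<subseteq> Metric_space.mball M theta v r"
proof
  interpret T: Metric_space M theta by (rule theta_metric)
  fix y assume y: "y \<in> mball v (1 / A ^ n)"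
  have jump: "jump (n - 1) v y"
  proof (cases n)
    case (Suc k)
    have "d v y \<le> 1 / A ^ n" using y by simp
    also have "\<dots> \<le> (2 * \<tau> * A) / A ^ n" using tau A_pow_pos[of n] by (intro divide_right_mono) auto
    also have "\<dots> = 2 * \<tau> / A ^ (n - 1)" using Suc A_pos by simp
    finally show ?thesis by (simp add: jump_def)
  qed (simp add: jump_def)
  have "\<kappa> * W (n - 1) v \<le> W n v"
  proof (cases n)
    case 0
    have "\<kappa> * W 0 v \<le> 1 * W 0 v"
      using kappa W_pos[of v 0] assms by (intro mult_right_mono) auto
    then show ?thesis using 0 by simp
  next
    case (Suc k)
    then show ?thesis using W_lower[of v k] assms by simp
  qed
  then have "\<kappa> * W (n - 1) v < \<kappa> * (r / 4)"
    using assms by simp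
  then have "4 * W (n - 1) v < r"
    using kappa by simp
  then have "theta v y < r"
    using theta_upper[OF assms(1) _ jump] y by auto
  then show "y \<in> T.mball v r" using y assms(1) by auto
qed

text \<open>A stopping argument: subdivide by \<open>W_branch\<close> until the weight is below
  \<open>\<kappa> / 4 * r\<close>, when one theta-ball suffices. The sum of the \<open>p\<close>-th
  powers does not grow under subdivision, and a stopped ball still has weight at least
  \<open>cov_const * r\<close>, so it contributes at least 1 to the bound. As \<open>W n v\<close>
  is at most \<open>h ^ n\<close>, at most \<open>j\<close> subdivisions are needed.\<close>

lemma ball_cover:
  assumes r: "0 < r" and "v \<in> M" "cov_const * r \<le> W n v" "h ^ (n + j) < \<kappa> / 4 * r"
  shows "\<exists>S. finite S \<and> S \<subseteq> M \<and> mball v (1 / A ^ n) \<subseteq> (\<Union>s\<in>S. Metric_space.mball M theta s r) \<and>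
      real (card S) \<le> (W n v / (cov_const * r)) powr p"
proof -
  have pos: "0 < cov_const * r" using cov_const r by simp
  have single: "\<exists>S. finite S \<and> S \<subseteq> M \<and> mball v (1 / A ^ n) \<subseteq> (\<Union>s\<in>S. Metric_space.mball M theta s r) \<and>
      real (card S) \<le> (W n v / (cov_const * r)) powr p"
    if "v \<in> M" "cov_const * r \<le> W n v" "W n v < \<kappa> / 4 * r" for n v
  proof (intro exI[of _ "{v}"] conjI)
    show "mball v (1 / A ^ n) \<subseteq> (\<Union>s\<in>{v}. Metric_space.mball M theta s r)"
      using ball_cover_single[OF that(1,3)] by simp
    have "1 \<le> W n v / (cov_const * r)" using that(2) pos by simp
    then show "real (card {v}) \<le> (W n v / (cov_const * r)) powr p"
      using p_pos by (simp add: ge_one_powr_ge_zero)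
  qed (use that(1) in simp_all)
  show ?thesis using assms(2-)
  proof (induction j arbitrary: n v)
    case 0
    then show ?case using W_le_power[of v n] by (intro single) simp_all
  next
    case (Suc j)
    show ?case
    proof (cases "W n v < \<kappa> / 4 * r")
      case True
      with Suc.prems show ?thesis by (intro single)
    next
      case False
      obtain U where U: "finite U" "U \<subseteq> M" "\<And>u. u \<in> U \<Longrightarrow> d v u < 2 / A ^ n"
        "mball v (1 / A ^ n) \<subseteq> (\<Union>u\<in>U. mball u (1 / A ^ Suc n))"
        "(\<Sum>u\<in>U. W (Suc n) u powr p) \<le> W n v powr p"
        using W_branch[OF Suc.prems(1), of n] by blast
      have "\<exists>S. finite S \<and> S \<subseteq> M \<and> mball u (1 / A ^ Suc n) \<subseteq> (\<Union>s\<in>S. Metric_space.mball M theta s r) \<and>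
        real (card S) \<le> (W (Suc n) u / (cov_const * r)) powr p" if u: "u \<in> U" for u
      proof (rule Suc.IH)
        show "u \<in> M" using u U by blast
        have "d v u * A ^ n \<le> 2" using U(3)[OF u] A_pow_pos[of n] by (simp add: field_simps)
        then have "W n v \<le> exp 2 * W n u"
          using u U Suc.prems W_pos[of u n]
          by (intro order_trans[OF W_lip[of v u n]] mult_right_mono) auto
        then have "exp (-2) * W n v \<le> W n u" by (simp add: exp_minus field_simps)
        then have "exp (-2) * (\<kappa> / 4 * r) \<le> W n u"
          using False by (intro order_trans[OF _ \<open>exp (-2) * W n v \<le> W n u\<close>] mult_left_mono) auto
        then have "\<kappa> * (exp (-2) * (\<kappa> / 4 * r)) \<le> \<kappa> * W n u"
          using kappa by (intro mult_left_mono) auto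
        also have "\<dots> \<le> W (Suc n) u" using W_lower u U by blast
        finally show "cov_const * r \<le> W (Suc n) u" by (simp add: cov_const_def mult_ac)
        show "h ^ (Suc n + j) < \<kappa> / 4 * r" using Suc.prems by simp
      qed
      then obtain S where S: "\<And>u. u \<in> U \<Longrightarrow> finite (S u) \<and> S u \<subseteq> M \<and>
          mball u (1 / A ^ Suc n) \<subseteq> (\<Union>s\<in>S u. Metric_space.mball M theta s r) \<and>
          real (card (S u)) \<le> (W (Suc n) u / (cov_const * r)) powr p"
        by metis
      have "real (card (\<Union>u\<in>U. S u)) \<le> (\<Sum>u\<in>U. real (card (S u)))"
        using card_UN_le[OF U(1), of S] by (simp flip: of_nat_sum)
      also have "\<dots> \<le> (\<Sum>u\<in>U. (W (Suc n) u / (cov_const * r)) powr p)"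
        using S by (intro sum_mono) blast
      also have "\<dots> = (\<Sum>u\<in>U. W (Suc n) u powr p) / (cov_const * r) powr p"
        using pos W_pos U(2) by (auto simp: sum_divide_distrib powr_divide less_imp_le intro!: sum.cong)
      also have "\<dots> \<le> W n v powr p / (cov_const * r) powr p"
        by (intro divide_right_mono U(5)) simp
      also have "\<dots> = (W n v / (cov_const * r)) powr p"
        using pos W_pos[OF Suc.prems(1), of n] by (simp add: powr_divide less_imp_le)
      finally have "real (card (\<Union>u\<in>U. S u)) \<le> (W n v / (cov_const * r)) powr p" .
      moreover have "mball v (1 / A ^ n) \<subseteq> (\<Union>s\<in>(\<Union>u\<in>U. S u). Metric_space.mball M theta s r)"
      proof (rule order_trans[OF U(4)], rule UN_least)
        fix u assume u: "u \<in> U"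
        then have "mball u (1 / A ^ Suc n) \<subseteq> (\<Union>s\<in>S u. Metric_space.mball M theta s r)"
          using S by simp
        also have "\<dots> \<subseteq> (\<Union>s\<in>(\<Union>u\<in>U. S u). Metric_space.mball M theta s r)"
          using u by (intro UN_mono) auto
        finally show "mball u (1 / A ^ Suc n) \<subseteq> (\<Union>s\<in>(\<Union>u\<in>U. S u). Metric_space.mball M theta s r)" .
      qed
      moreover have "finite (\<Union>u\<in>U. S u)" using U(1) S by simp
      moreover have "(\<Union>u\<in>U. S u) \<subseteq> M" using S by (intro UN_least) simp
      ultimately show ?thesis by (intro exI[of _ "\<Union>u\<in>U. S u"] conjI)
    qed
  qed
qed

lemma power_h_less:
  assumes "0 < c"
  shows "\<exists>n. h ^ n < c"
  using real_arch_pow_inv[OF assms h(2)] by blast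

lemma ball_cover_num:
  assumes "0 < r" "v \<in> M" "cov_const * r \<le> W n v"
  shows "\<exists>S. finite S \<and> S \<subseteq> M \<and> mball v (1 / A ^ n) \<subseteq> (\<Union>s\<in>S. Metric_space.mball M theta s r) \<and>
      real (card S) \<le> (W n v / (cov_const * r)) powr p"
proof -
  obtain j where "h ^ j < \<kappa> / 4 * r" using power_h_less[of "\<kappa> / 4 * r"] assms kappa by auto
  moreover have "h ^ (n + j) \<le> h ^ j" using h by (intro power_decreasing) auto
  ultimately have "h ^ (n + j) < \<kappa> / 4 * r" by simp
  with ball_cover[OF assms] show ?thesis by blast
qed

lemma assouad_dim_theta: "assouad_dim M theta \<le> ereal p"
proof -
  interpret T: Metric_space M theta by (rule theta_metric)
  obtain U where U: "finite U" "U \<subseteq> M" "M \<subseteq> (\<Union>u\<in>U. mball u 1)"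
    using finite_cover by blast
  define C where "C = (real (card U) + 1) * (exp 1 / (\<kappa> * cov_const)) powr p"
  have K1: "1 \<le> exp 1 / (\<kappa> * cov_const)"
  proof -
    have "\<kappa> * cov_const \<le> 1 * 1" using kappa cov_const by (intro mult_mono) auto
    also have "\<dots> \<le> exp (1::real)" by simp
    finally show ?thesis using kappa cov_const by simp
  qed
  have "0 < C" unfolding C_def using kappa cov_const by (intro mult_pos_pos add_nonneg_pos) auto
  moreover have "cover_num M theta r (T.mball x R) \<le> ereal (C * (R / r) powr p)"
    if x: "x \<in> M" and r: "0 < r" "r < R" for x r R
  proof -
    have Rr: "0 \<le> R / r" "1 \<le> R / r" using r by auto
    have C_split: "C * (R / r) powr p = (real (card U) + 1) * (exp 1 * R / (\<kappa> * cov_const * r)) powr p"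
    proof -
      have "exp 1 * R / (\<kappa> * cov_const * r) = (exp 1 / (\<kappa> * cov_const)) * (R / r)" by simp
      then show ?thesis unfolding C_def by (simp only: powr_mult mult.assoc)
    qed
    show ?thesis
    \<comment> \<open>Since \<open>W 0 x = 1\<close>, this case provides a last level
      \<open>n\<close> before the weight of \<open>x\<close> first drops below
      \<open>exp 1 * R\<close>; by \<open>theta_lower\<close> the theta-ball of radius
      \<open>R\<close> lies in the ball of radius \<open>1 / A ^ n\<close>. For larger
      \<open>R\<close> the whole space is covered, starting from the unit balls of
      \<open>U\<close>.\<close>
    proof (cases "exp 1 * R \<le> 1")
      case True
      obtain k where "h ^ k < exp 1 * R" using power_h_less[of "exp 1 * R"] r by auto
      then have "W k x < exp 1 * R" using W_le_power[OF x, of k] by simp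
      define N where "N = (LEAST n. W n x < exp 1 * R)"
      have N: "W N x < exp 1 * R" unfolding N_def using \<open>W k x < _\<close> by (rule LeastI)
      then have "N \<noteq> 0" using True W_0[OF x] by (intro notI) auto
      then obtain n where n: "N = Suc n" using not0_implies_Suc by blast
      have Wn: "exp 1 * R \<le> W n x"
        using not_less_Least[of n "\<lambda>n. W n x < exp 1 * R"] n N_def by fastforce
      have "\<kappa> * W n x < exp 1 * R" using W_lower[OF x, of n] N n by simp
      then have Wn': "W n x \<le> exp 1 * R / \<kappa>" using kappa by (simp add: field_simps)
      have "cov_const * r \<le> 1 * R" using cov_const r by (intro mult_mono) auto
      also have "\<dots> \<le> exp 1 * R" using r by (intro mult_right_mono) auto
      finally have "cov_const * r \<le> W n x" using Wn by simp
      from ball_cover_num[OF r(1) x this] obtain S where S: "finite S" "S \<subseteq> M" "mball x (1 / A ^ n) \<subseteq> (\<Union>s\<in>S. T.mball s r)"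
          "real (card S) \<le> (W n x / (cov_const * r)) powr p"
        by (elim exE conjE) (rule that)
      have "T.mball x R \<subseteq> mball x (1 / A ^ n)"
      proof
        fix y assume y: "y \<in> T.mball x R"
        have "\<not> \<tau> / A ^ n \<le> d x y"
        proof
          assume "\<tau> / A ^ n \<le> d x y"
          then have "exp (-1) * W n x < R" using theta_lower[of x y n] y by simp
          then have "W n x < exp 1 * R" by (simp add: exp_minus divide_less_eq inverse_eq_divide mult.commute)
          then show False using Wn by simp
        qed
        moreover have "\<tau> / A ^ n \<le> 1 / A ^ n"
          using tau A_pow_pos[of n] by (intro divide_right_mono) auto
        ultimately show "y \<in> mball x (1 / A ^ n)" using y by simp
      qed
      moreover have "real (card S) \<le> C * (R / r) powr p"
      proof -
        have "(W n x / (cov_const * r)) powr p \<le> (exp 1 * R / (\<kappa> * cov_const * r)) powr p"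
        proof (intro powr_mono2)
          show "W n x / (cov_const * r) \<le> exp 1 * R / (\<kappa> * cov_const * r)"
            using divide_right_mono[OF Wn', of "cov_const * r"] cov_const r by (simp add: mult.assoc)
        qed (use W_pos[OF x, of n] cov_const r p_pos in auto)
        also have "\<dots> \<le> C * (R / r) powr p"
          unfolding C_split
          using mult_right_mono[of 1 "real (card U) + 1" "(exp 1 * R / (\<kappa> * cov_const * r)) powr p"]
          by simp
        finally show ?thesis using S by simp
      qed
      ultimately show ?thesis
        using S(1,2) by (intro cover_num_le[of S] order_trans[OF _ S(3)])
    next
      case False
      show ?thesis
      proof (cases "cov_const * r \<le> 1")
        case True
        have "\<exists>S. finite S \<and> S \<subseteq> M \<and> mball u 1 \<subseteq> (\<Union>s\<in>S. T.mball s r) \<and>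
          real (card S) \<le> (1 / (cov_const * r)) powr p" if "u \<in> U" for u
        proof -
          have "u \<in> M" using U that by blast
          then show ?thesis using ball_cover_num[OF r(1), of u 0] True W_0[of u] by simp
        qed
        then obtain S where S: "\<And>u. u \<in> U \<Longrightarrow> finite (S u) \<and> S u \<subseteq> M \<and>
            mball u 1 \<subseteq> (\<Union>s\<in>S u. T.mball s r) \<and> real (card (S u)) \<le> (1 / (cov_const * r)) powr p"
          by metis
        have "real (card (\<Union>u\<in>U. S u)) \<le> (\<Sum>u\<in>U. real (card (S u)))"
          using card_UN_le[OF U(1), of S] by (simp flip: of_nat_sum)
        also have "\<dots> \<le> (\<Sum>u\<in>U. (1 / (cov_const * r)) powr p)"
          using S by (intro sum_mono) auto
        also have "\<dots> \<le> (real (card U) + 1) * (1 / (cov_const * r)) powr p"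
          by (simp add: mult_right_mono)
        also have "\<dots> \<le> C * (R / r) powr p"
          unfolding C_split
        proof (intro mult_left_mono powr_mono2)
          have "\<kappa> * 1 \<le> 1 * (exp 1 * R)" using kappa False by (intro mult_mono) auto
          then show "1 / (cov_const * r) \<le> exp 1 * R / (\<kappa> * cov_const * r)"
            using kappa cov_const r by (simp add: field_simps)
        qed (use p_pos cov_const r in auto)
        finally have "real (card (\<Union>u\<in>U. S u)) \<le> C * (R / r) powr p" .
        moreover have "T.mball x R \<subseteq> (\<Union>s\<in>(\<Union>u\<in>U. S u). T.mball s r)"
        proof (rule order_trans[OF T.mball_subset_mspace], rule order_trans[OF U(3)], rule UN_least)
          fix u assume u: "u \<in> U"
          then have "mball u 1 \<subseteq> (\<Union>s\<in>S u. T.mball s r)" using S by simp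
          also have "\<dots> \<subseteq> (\<Union>s\<in>(\<Union>u\<in>U. S u). T.mball s r)"
            using u by (intro UN_mono) auto
          finally show "mball u 1 \<subseteq> (\<Union>s\<in>(\<Union>u\<in>U. S u). T.mball s r)" .
        qed
        moreover have "finite (\<Union>u\<in>U. S u)" using U(1) S by simp
        moreover have "(\<Union>u\<in>U. S u) \<subseteq> M" using S by (intro UN_least) simp
        ultimately show ?thesis by (intro cover_num_le[of "\<Union>u\<in>U. S u"])
      next
        case False
        \<comment> \<open>As \<open>cov_const < 1 / 4\<close>, this radius exceeds 4, the bound for
          theta that comes from jumps of level 0; one ball covers the space.\<close>
        then have "1 < cov_const * r" by simp
        also have "\<dots> < 1 / 4 * r" using cov_const r by (intro mult_strict_right_mono) auto
        finally have "4 < r" by simp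
        then have "T.mball x R \<subseteq> (\<Union>s\<in>{x}. T.mball s r)"
          using theta_upper[of x _ 0] W_0 x by (fastforce simp: jump_def)
        moreover have "1 \<le> C * (R / r) powr p"
        proof -
          have "1 * 1 \<le> C"
            unfolding C_def using K1 p_pos by (intro mult_mono ge_one_powr_ge_zero) auto
          then have "1 * 1 \<le> C * (R / r) powr p"
            using Rr p_pos by (intro mult_mono ge_one_powr_ge_zero) auto
          then show ?thesis by simp
        qed
        ultimately show ?thesis using x by (intro cover_num_le[of "{x}"]) auto
      qed
    qed
  qed
  ultimately show ?thesis by (intro assouad_dim_le[OF p_pos]) auto
qed

end

section \<open>Separated sets\<close>

text \<open>Layers by the integer part of \<open>f\<close>: layer \<open>k\<close> has at most
  \<open>N k\<close> points, each contributing at most \<open>exp (- t * real k)\<close>. Both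
  halves of the proof turn dimension bounds into sums in this way.\<close>

lemma sum_exp_le_counting:
  fixes f :: "'b \<Rightarrow> real" and N :: "nat \<Rightarrow> real"
  assumes "finite F" "\<And>u. u \<in> F \<Longrightarrow> 0 \<le> f u" "0 \<le> t"
    and card: "\<And>k. real (card {u\<in>F. f u < real k + 1}) \<le> N k"
    and summ: "summable (\<lambda>k. N k * exp (- t * real k))"
  shows "(\<Sum>u\<in>F. exp (- t * f u)) \<le> (\<Sum>k. N k * exp (- t * real k))"
proof -
  define g where "g u = nat \<lfloor>f u\<rfloor>" for u
  have g: "real (g u) \<le> f u" "f u < real (g u) + 1" if "u \<in> F" for u
    using assms(2)[OF that] by (auto simp: g_def floor_less_iff)
  have N0: "0 \<le> N k" for k using order_trans[OF _ card[of k]] by simp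
  have "(\<Sum>u\<in>F. exp (- t * f u)) \<le> (\<Sum>u\<in>F. exp (- t * real (g u)))"
    using g assms(3) by (intro sum_mono) (simp add: mult_left_mono)
  also have "\<dots> = (\<Sum>k\<in>g ` F. \<Sum>u\<in>{u\<in>F. g u = k}. exp (- t * real (g u)))"
    by (rule sum.image_gen[OF assms(1)])
  also have "\<dots> = (\<Sum>k\<in>g ` F. real (card {u\<in>F. g u = k}) * exp (- t * real k))"
    by (intro sum.cong refl) simp
  also have "\<dots> \<le> (\<Sum>k\<in>g ` F. N k * exp (- t * real k))"
  proof (intro sum_mono mult_right_mono)
    fix k
    have "{u\<in>F. g u = k} \<subseteq> {u\<in>F. f u < real k + 1}" using g by auto
    then have "card {u\<in>F. g u = k} \<le> card {u\<in>F. f u < real k + 1}"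
      using assms(1) by (intro card_mono) auto
    then show "real (card {u\<in>F. g u = k}) \<le> N k" using card[of k] by linarith
  qed simp
  also have "\<dots> \<le> (\<Sum>k. N k * exp (- t * real k))"
    using assms(1) N0 by (intro sum_le_suminf[OF summ]) auto
  finally show ?thesis .
qed

lemma assouad_dim_lessD:
  assumes "assouad_dim X d < s"
  obtains \<beta> C where "0 < \<beta>" "ereal \<beta> < s" "0 < C" "\<And>x r R. \<lbrakk>x \<in> X; 0 < r; r < R\<rbrakk> \<Longrightarrow>
      cover_num X d r (Metric_space.mball X d x R) \<le> ereal (C * (R / r) powr \<beta>)"
proof -
  obtain b where b: "b \<in> ereal ` {\<beta>. \<beta> > 0 \<and> (\<exists>C>0. \<forall>x\<in>X. \<forall>r R. 0 < r \<and> r < R \<longrightarrow>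
        cover_num X d r (Metric_space.mball X d x R) \<le> ereal (C * (R / r) powr \<beta>))}" "b < s"
    using assms unfolding assouad_dim_def Inf_less_iff by blast
  from b(1) obtain \<beta> C where "b = ereal \<beta>" "0 < \<beta>" "0 < C" "\<forall>x\<in>X. \<forall>r R. 0 < r \<and> r < R \<longrightarrow>
        cover_num X d r (Metric_space.mball X d x R) \<le> ereal (C * (R / r) powr \<beta>)"
    by blast
  with b(2) show ?thesis by (intro that[of \<beta> C]) simp_all
qed

context Metric_space begin

text \<open>A ball of radius \<open>r\<close> contains at most one point of a
  \<open>2 * r\<close>-separated set. The slack \<open>e\<close> provides an actual finite cover
  from the infimum \<open>cover_num\<close>.\<close>

lemma separated_card_le:
  assumes cov: "cover_num M d r B \<le> ereal b" and S: "S \<subseteq> B" "separated_set M d (2 * r) S"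
  shows "finite S" "real (card S) \<le> b"
proof -
  have *: "finite S \<and> real (card S) < b + e" if "0 < e" for e
  proof -
    have "cover_num M d r B < ereal (b + e)" using cov that by (simp add: le_less_trans)
    then obtain C where C: "finite C" "C \<subseteq> M" "B \<subseteq> (\<Union>c\<in>C. mball c r)" "real (card C) < b + e"
      unfolding cover_num_def Inf_less_iff by auto
    have "\<forall>s\<in>S. \<exists>c\<in>C. s \<in> mball c r" using S(1) C(3) by blast
    then obtain c where c: "\<And>s. s \<in> S \<Longrightarrow> c s \<in> C" "\<And>s. s \<in> S \<Longrightarrow> s \<in> mball (c s) r"
      by metis
    have inj: "inj_on c S"
    proof (rule inj_onI, rule ccontr)
      fix s s' assume s: "s \<in> S" "s' \<in> S" "c s = c s'" "s \<noteq> s'"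
      have "d s s' \<le> d s (c s) + d (c s) s'"
        using c(2)[OF s(1)] c(2)[OF s(2)] s(3) by (intro triangle) auto
      also have "\<dots> < r + r"
        using c(2)[OF s(1)] c(2)[OF s(2)] s(3) by (intro add_strict_mono) (auto simp: commute)
      finally show False using S(2) s unfolding separated_set_def by fastforce
    qed
    have "c ` S \<subseteq> C" using c(1) by blast
    then have "finite S" "card S \<le> card C"
      using inj C(1) finite_subset[OF _ C(1)] finite_imageD[OF _ inj] card_inj_on_le[OF inj _ C(1)] by blast+
    then show ?thesis using C(4) by simp
  qed
  show "finite S" using *[of 1] by simp
  show "real (card S) \<le> b"
  proof (rule field_le_epsilon)
    fix e :: real assume "0 < e"
    then show "real (card S) \<le> b + e" using *[of e] by simp
  qed
qed

text \<open>The number of points within \<open>(k + 1) * r\<close> grows polynomially in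
  \<open>k\<close>, which the exponential beats. The bound is uniform in \<open>x\<close>,
  \<open>r\<close> and \<open>F\<close>, so one constant per rate \<open>t\<close> serves all levels
  of the construction.\<close>

lemma exp_decay_sum:
  assumes "0 < C" and cov: "\<And>x r R. \<lbrakk>x \<in> M; 0 < r; r < R\<rbrakk> \<Longrightarrow>
      cover_num M d r (mball x R) \<le> ereal (C * (R / r) powr \<beta>)"
    and "0 < t"
  obtains K where "\<And>x r F. \<lbrakk>x \<in> M; 0 < r; finite F; separated_set M d r F\<rbrakk> \<Longrightarrow>
    (\<Sum>u\<in>F. exp (- t * (d x u / r))) \<le> K"
proof
  fix x r F assume *: "x \<in> M" "0 < r" "finite F" "separated_set M d r F"
  have "real (card {u\<in>F. d x u / r < real k + 1}) \<le> C * (2 * (real k + 1)) powr \<beta>" for k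
  proof -
    have "cover_num M d (r / 2) (mball x ((real k + 1) * r)) \<le>
        ereal (C * ((real k + 1) * r / (r / 2)) powr \<beta>)"
    proof (rule cov)
      have "1 * r \<le> (real k + 1) * r" using *(2) by (intro mult_right_mono) auto
      then show "r / 2 < (real k + 1) * r" using *(2) by linarith
    qed (use * in auto)
    also have "(real k + 1) * r / (r / 2) = 2 * (real k + 1)" using *(2) by (simp add: field_simps)
    finally have c: "cover_num M d (r / 2) (mball x ((real k + 1) * r)) \<le>
      ereal (C * (2 * (real k + 1)) powr \<beta>)" .
    show ?thesis
      by (rule separated_card_le(2)[OF c])
        (use * in \<open>auto simp: separated_set_def divide_less_eq\<close>)
  qed
  moreover have "summable (\<lambda>k. C * (2 * (real k + 1)) powr \<beta> * exp (- t * real k))"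
  proof (rule summable_comparison_test_bigo)
    have "summable (\<lambda>k. exp (- t / 2) ^ k)"
      using assms(3) by (intro summable_geometric) simp
    then show "summable (\<lambda>k. norm (exp (- (t / 2) * real k)))"
      by (simp add: exp_of_nat_mult[symmetric] mult.commute)
    show "(\<lambda>k. C * (2 * (real k + 1)) powr \<beta> * exp (- t * real k)) \<in> O(\<lambda>k. exp (- (t / 2) * real k))"
      using assms(3) by real_asymp
  qed
  ultimately show "(\<Sum>u\<in>F. exp (- t * (d x u / r))) \<le>
      (\<Sum>k. C * (2 * (real k + 1)) powr \<beta> * exp (- t * real k))"
    using * assms(3) by (intro sum_exp_le_counting) auto
qed

lemma maximal_separated_near:
  assumes "maximal_separated M d r S" "x \<in> M" "0 < r"
  obtains s where "s \<in> S" "d x s < r"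
proof (cases "x \<in> S")
  case True
  then show ?thesis using that[of x] assms by simp
next
  case False
  then have "\<not> separated_set M d r (insert x S)"
    using assms(1) unfolding maximal_separated_def by blast
  then obtain y z where yz: "y \<in> insert x S" "z \<in> insert x S" "y \<noteq> z" "d y z < r"
    using assms unfolding separated_set_def maximal_separated_def by force
  moreover have "separated_set M d r S" using assms unfolding maximal_separated_def by blast
  ultimately have "\<exists>s\<in>S. d x s < r"
    unfolding separated_set_def by (auto simp: commute not_le[symmetric])
  then show ?thesis using that by blast
qed

lemma compact_bounded_dist:
  assumes "compact_space mtopology"
  shows "\<exists>D>0. \<forall>x\<in>M. \<forall>y\<in>M. d x y < D"
proof -
  have "mbounded M" using assms compactin_imp_mbounded
    by (simp add: compact_space_def)
  then obtain B where "\<forall>x\<in>M. \<forall>y\<in>M. d x y \<le> B"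
    unfolding mbounded_alt by blast
  then have "\<forall>x\<in>M. \<forall>y\<in>M. d x y < \<bar>B\<bar> + 1" by fastforce
  then show ?thesis by (intro exI[of _ "\<bar>B\<bar> + 1"]) auto
qed

lemma separated_finite:
  assumes "compact_space mtopology" "assouad_dim M d < \<infinity>" "separated_set M d r S" "0 < r"
  shows "finite S"
proof (cases "S = {}")
  case False
  then obtain x where x: "x \<in> S" "x \<in> M" using assms(3) by (auto simp: separated_set_def)
  obtain D where D: "0 < D" "\<forall>x\<in>M. \<forall>y\<in>M. d x y < D" using compact_bounded_dist assms(1) by blast
  obtain \<beta> C where C: "\<And>x r R. \<lbrakk>x \<in> M; 0 < r; r < R\<rbrakk> \<Longrightarrow>
      cover_num M d r (mball x R) \<le> ereal (C * (R / r) powr \<beta>)"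
    using assouad_dim_lessD[OF assms(2)] by metis
  have c: "cover_num M d (r / 2) (mball x (D + r)) \<le> ereal (C * ((D + r) / (r / 2)) powr \<beta>)"
    using assms D x by (intro C) auto
  have "S \<subseteq> mball x (D + r)"
  proof
    fix y assume "y \<in> S"
    then have "y \<in> M" using assms(3) by (auto simp: separated_set_def)
    then have "d x y < D" using D(2) x(2) by blast
    then show "y \<in> mball x (D + r)" using \<open>y \<in> M\<close> x(2) assms(4) by simp
  qed
  then show ?thesis
    using separated_card_le(1)[OF c] assms(3) by simp
qed simp

end

section \<open>Weights from admissible functions\<close>

text \<open>Admissibility counts each vertex of a path once, the cost of a chain counts repetitions;
  the inequality goes in the useful direction.\<close>

lemma sum_set_le_sum_list:
  fixes f :: "'b \<Rightarrow> real"
  assumes "\<And>x. x \<in> set xs \<Longrightarrow> 0 \<le> f x"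
  shows "sum f (set xs) \<le> sum_list (map f xs)"
  using assms
proof (induction xs)
  case (Cons x xs)
  then have "sum f (set xs) \<le> sum_list (map f xs)" "0 \<le> f x" by auto
  then show ?case by (auto simp: sum.insert_if)
qed simp

text \<open>Level \<open>m\<close> of the weights is level \<open>N * m\<close> of the nets. The
  centres \<open>v\<close> of the annuli are taken \<open>j\<close> levels finer, so that the outer
  radius \<open>L / a ^ (N * m + j)\<close> is small against \<open>\<tau> / A ^ m\<close> and a
  path escaping from \<open>z\<close> crosses the annulus at a nearby \<open>v\<close>. The
  inequality \<open>small\<close> is what \<open>V_branch\<close> consumes.\<close>

locale weight_construction = Metric_space M d for M :: "'a set" and d +
  fixes a lam L p \<tau> \<eta> \<epsilon> :: real and Xs :: "nat \<Rightarrow> 'a set" and K :: "real \<Rightarrow> real"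
    and N j :: nat and \<rho> :: "nat \<Rightarrow> 'a \<Rightarrow> 'a \<Rightarrow> real"
  assumes a_gt: "1 < a" and L_gt: "1 < L" and p_pos: "0 < p"
    and tau: "0 < \<tau>" "2 * \<tau> \<le> 1" "1 + 3 * \<tau> \<le> lam"
    and j_large: "(L + 1) / a ^ j \<le> \<tau> / 4"
    and N_large: "12 + 8 / \<tau> \<le> a ^ N"
    and nets: "\<And>n. maximal_separated M d (1 / a ^ n) (Xs n)" "\<And>n. finite (Xs n)"
    and decay: "\<And>t x n. \<lbrakk>0 < t; x \<in> M\<rbrakk> \<Longrightarrow> (\<Sum>u\<in>Xs n. exp (- t * (d x u * a ^ n))) \<le> K t"
    and rho_nonneg: "\<And>m v u. 0 \<le> \<rho> m v u"
    and rho_sum: "\<And>m v. v \<in> Xs (N * m + j) \<Longrightarrow> (\<Sum>u\<in>Xs (N * Suc m). \<rho> m v u powr p) \<le> \<epsilon>"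
    and rho_adm: "\<And>m v us. \<lbrakk>v \<in> Xs (N * m + j); us \<noteq> []; set us \<subseteq> Xs (N * Suc m);
        successively (\<lambda>u u'. \<exists>z\<in>M. d u z < lam / a ^ (N * Suc m) \<and> d u' z < lam / a ^ (N * Suc m)) us;
        d v (hd us) < 1 / a ^ (N * m + j); L / a ^ (N * m + j) \<le> d v (last us)\<rbrakk>
        \<Longrightarrow> 1 \<le> (\<Sum>u\<in>set us. \<rho> m v u)"
    and eta: "0 < \<eta>" "\<eta> < 1"
    and small: "exp (3 * p) * K (p / 4) *
        (\<eta> * K (p / (4 * a ^ N)) + exp (3 * p) * \<epsilon> * K (p / (4 * a ^ j))) \<le> exp (- p) / 2"
begin

definition A :: real where "A = a ^ N"
definition Y :: "nat \<Rightarrow> 'a set" where "Y n = Xs (N * n)"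
definition Z :: "nat \<Rightarrow> 'a set" where "Z m = Xs (N * m + j)"

lemma A_pow: "A ^ n = a ^ (N * n)"
  by (simp add: A_def power_mult)

lemma A_ge: "12 \<le> A" "8 / \<tau> \<le> A"
proof -
  have "0 < 8 / \<tau>" using tau by simp
  then show "12 \<le> A" "8 / \<tau> \<le> A" using N_large unfolding A_def by linarith+
qed

lemma A_pow_pos: "0 < A ^ n"
  using A_ge by simp

lemma A_pow_Suc_ge: "c * A ^ n \<le> A ^ Suc n" if "c \<le> 12"
  using A_ge(1) A_pow_pos[of n] that by simp

lemma Y_sub: "Y n \<subseteq> M" and Z_sub: "Z n \<subseteq> M" and finite_Y: "finite (Y n)" and finite_Z: "finite (Z n)"
  using nets by (auto simp: Y_def Z_def maximal_separated_def separated_set_def)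

lemma Y_near: assumes "x \<in> M" obtains u where "u \<in> Y n" "d x u < 1 / A ^ n"
  using maximal_separated_near[OF nets(1)[of "N * n"] assms] a_gt by (auto simp: Y_def A_pow)

lemma Z_near: assumes "x \<in> M" obtains v where "v \<in> Z n" "d x v < 1 / a ^ (N * n + j)"
  using maximal_separated_near[OF nets(1)[of "N * n + j"] assms] a_gt by (auto simp: Z_def)

text \<open>The floor \<eta> gives the lower bound on the decay. Summing over all nearby
  \<open>v\<close>, instead of selecting one, allows \<open>W_path\<close> to use whichever centre
  lies near the start of its path.\<close>

definition s :: "nat \<Rightarrow> 'a \<Rightarrow> real" where
  "s m u = \<eta> + exp (2 * p) * (\<Sum>v\<in>{v\<in>Z m. d u v < 1 / A ^ m}. \<rho> m v u powr p)"

text \<open>\<open>V n\<close> is the \<open>p\<close>-th power of the weight of level \<open>n\<close>. The exponential kernel makes it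
  log-Lipschitz at scale \<open>1 / A ^ n\<close> with a constant not depending on \<open>\<eta>\<close> and \<open>\<epsilon>\<close>.\<close>

primrec V :: "nat \<Rightarrow> 'a \<Rightarrow> real" where
  "V 0 x = 1"
| "V (Suc n) x = (\<Sum>u\<in>Y (Suc n). exp (- (p * (d x u * A ^ Suc n))) * (s n u * V n u))"

lemma s_ge_eta: "\<eta> \<le> s m u" and s_pos: "0 < s m u"
proof -
  have "0 \<le> exp (2 * p) * (\<Sum>v\<in>{v\<in>Z m. d u v < 1 / A ^ m}. \<rho> m v u powr p)"
    by (intro mult_nonneg_nonneg sum_nonneg) auto
  then show "\<eta> \<le> s m u" "0 < s m u" using eta by (auto simp: s_def)
qed

lemma V_pos: "x \<in> M \<Longrightarrow> 0 < V n x"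
proof (induction n arbitrary: x)
  case (Suc n)
  obtain u where "u \<in> Y (Suc n)" using Y_near[OF Suc.prems] by blast
  then show ?case
    using Suc.IH Y_sub finite_Y s_pos unfolding V.simps
    by (intro sum_pos mult_pos_pos) auto
qed simp

lemma sV_nonneg: "u \<in> Y n \<Longrightarrow> 0 \<le> s m u * V m u"
  using Y_sub[of n] V_pos[of u m] s_pos[of m u] by (auto intro!: mult_nonneg_nonneg less_imp_le)

lemma V_lip:
  assumes "x \<in> M" "y \<in> M"
  shows "V n x \<le> exp (p * (d x y * A ^ n)) * V n y"
proof (cases n)
  case 0
  then show ?thesis using p_pos by simp
next
  case (Suc m)
  have "exp (- (p * (d x u * A ^ n))) \<le> exp (p * (d x y * A ^ n)) * exp (- (p * (d y u * A ^ n)))"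
    if "u \<in> M" for u
  proof -
    have "d y u * A ^ n \<le> (d x y + d x u) * A ^ n"
      using triangle[of y x u] assms that A_pow_pos[of n] by (intro mult_right_mono) (auto simp: commute)
    then have "p * (d y u * A ^ n) \<le> p * ((d x y + d x u) * A ^ n)"
      using p_pos by (intro mult_left_mono) auto
    then show ?thesis by (simp add: algebra_simps flip: exp_add)
  qed
  then show ?thesis
    unfolding Suc V.simps sum_distrib_left mult.assoc[symmetric]
    unfolding mult.assoc[of _ "s _ _"] using Y_sub sV_nonneg Suc
    by (intro sum_mono mult_right_mono) blast+
qed

lemma V_lip_near:
  assumes "x \<in> M" "y \<in> M" "d x y \<le> c / A ^ n"
  shows "V n x \<le> exp (p * c) * V n y"
proof -
  have "d x y * A ^ n \<le> c" using assms A_pow_pos[of n] by (simp add: field_simps)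
  then have "exp (p * (d x y * A ^ n)) * V n y \<le> exp (p * c) * V n y"
    using p_pos V_pos[OF assms(2), of n] by (intro mult_right_mono) auto
  with V_lip[OF assms(1,2), of n] show ?thesis by simp
qed

lemma V_Suc_ge:
  assumes "x \<in> M" "u \<in> Y (Suc n)" "d x u < 1 / A ^ Suc n"
  shows "exp (- p) * (s n u * V n u) \<le> V (Suc n) x"
proof -
  have "p * (d x u * A ^ Suc n) \<le> p * 1"
    using assms A_pow_pos[of "Suc n"] p_pos by (intro mult_left_mono) (auto simp: field_simps)
  then have "exp (- p) * (s n u * V n u) \<le> exp (- (p * (d x u * A ^ Suc n))) * (s n u * V n u)"
    using sV_nonneg[OF assms(2), of n] by (intro mult_right_mono) auto
  also have "\<dots> \<le> V (Suc n) x"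
    unfolding V.simps using assms(2) finite_Y sV_nonneg
    by (intro member_le_sum mult_nonneg_nonneg[of "exp _"]) auto
  finally show ?thesis .
qed

text \<open>Only the floor of \<open>s\<close> and one net point near \<open>x\<close> are used: one
  factor \<open>exp (- p)\<close> is the kernel at that point, the other moves \<open>V n\<close>
  there from \<open>x\<close>.\<close>

lemma V_lower:
  assumes "x \<in> M"
  shows "\<eta> * exp (- 2 * p) * V n x \<le> V (Suc n) x"
proof -
  obtain u where u: "u \<in> Y (Suc n)" "d x u < 1 / A ^ Suc n" using Y_near[OF assms] by blast
  have uM: "u \<in> M" using u Y_sub by blast
  have "1 / A ^ Suc n \<le> 1 / A ^ n"
    using A_pow_Suc_ge[of 1 n] A_pow_pos[of n] by (intro divide_left_mono) auto
  then have "V n x \<le> exp (p * 1) * V n u"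
    using u uM assms by (intro V_lip_near) auto
  then have 1: "exp (- p) * V n x \<le> V n u" by (simp add: exp_minus field_simps)
  have "\<eta> * exp (- 2 * p) * V n x = exp (- p) * (\<eta> * (exp (- p) * V n x))"
    by (simp flip: exp_add)
  also have "\<dots> \<le> exp (- p) * (s n u * V n u)"
    using 1 s_ge_eta[of n u] s_pos[of n u] eta V_pos[OF assms, of n]
    by (intro mult_left_mono mult_mono) auto
  also have "\<dots> \<le> V (Suc n) x" using V_Suc_ge assms u by blast
  finally show ?thesis .
qed

text \<open>Measured at the level of its net, the rate \<open>p / 4\<close> becomes
  \<open>p / (4 * a ^ N)\<close> in the sum with \<eta>. In the other sum \<open>u\<close> is
  replaced by the nearby \<open>v\<close> in the exponential; summing over \<open>u\<close> then
  yields \<epsilon> for each \<open>v\<close>, and the remaining sum over level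
  \<open>N * n + j\<close> has rate \<open>p / (4 * a ^ j)\<close>. So the factor of \<epsilon> does
  not involve \<open>N\<close>.\<close>

lemma s_decay_sum:
  assumes "x \<in> M"
  shows "(\<Sum>u\<in>Y (Suc n). s n u * exp (- (p / 4) * (d x u * A ^ n))) \<le>
    \<eta> * K (p / (4 * a ^ N)) + exp (3 * p) * \<epsilon> * K (p / (4 * a ^ j))"
proof -
  let ?e = "\<lambda>u. exp (- (p / 4) * (d x u * A ^ n))"
  have A0: "0 < a ^ N" "0 < a ^ j" using a_gt by auto
  have "(\<Sum>u\<in>Y (Suc n). ?e u) = (\<Sum>u\<in>Xs (N * Suc n). exp (- (p / (4 * a ^ N)) * (d x u * a ^ (N * Suc n))))"
    unfolding Y_def using a_gt by (intro sum.cong refl) (simp add: A_pow power_add)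
  also have "\<dots> \<le> K (p / (4 * a ^ N))"
    using A0 p_pos assms by (intro decay) auto
  finally have 1: "(\<Sum>u\<in>Y (Suc n). \<eta> * ?e u) \<le> \<eta> * K (p / (4 * a ^ N))"
    using eta by (simp flip: sum_distrib_left)
  have "(\<Sum>u\<in>Y (Suc n). (\<Sum>v\<in>{v\<in>Z n. d u v < 1 / A ^ n}. \<rho> n v u powr p) * ?e u) \<le>
      (\<Sum>u\<in>Y (Suc n). \<Sum>v\<in>Z n. \<rho> n v u powr p * (exp p * ?e v))"
  proof (intro sum_mono)
    fix u assume u: "u \<in> Y (Suc n)"
    have "(\<Sum>v\<in>{v\<in>Z n. d u v < 1 / A ^ n}. \<rho> n v u powr p) * ?e u \<le>
        (\<Sum>v\<in>{v\<in>Z n. d u v < 1 / A ^ n}. \<rho> n v u powr p * (exp p * ?e v))"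
      unfolding sum_distrib_right
    proof (intro sum_mono mult_left_mono)
      fix v assume v: "v \<in> {v\<in>Z n. d u v < 1 / A ^ n}"
      have "d x v \<le> d x u + 1 / A ^ n"
        using triangle[of x u v] assms u v Y_sub Z_sub by fastforce
      then have "d x v * A ^ n \<le> d x u * A ^ n + 1"
        using A_ge(1) A_pow_pos[of n] mult_right_mono[of "d x v" "d x u + 1 / A ^ n" "A ^ n"]
        by (simp add: distrib_right)
      then have "(p / 4) * (d x v * A ^ n) \<le> (p / 4) * (d x u * A ^ n + 1)"
        using p_pos by (intro mult_left_mono) auto
      then have "- (p / 4) * (d x u * A ^ n) \<le> p + - (p / 4) * (d x v * A ^ n)"
        using p_pos by (simp add: algebra_simps)
      then show "?e u \<le> exp p * ?e v" by (simp only: exp_le_cancel_iff flip: exp_add)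
    qed simp
    also have "\<dots> \<le> (\<Sum>v\<in>Z n. \<rho> n v u powr p * (exp p * ?e v))"
      using finite_Z by (intro sum_mono2) auto
    finally show "(\<Sum>v\<in>{v\<in>Z n. d u v < 1 / A ^ n}. \<rho> n v u powr p) * ?e u \<le>
        (\<Sum>v\<in>Z n. \<rho> n v u powr p * (exp p * ?e v))" .
  qed
  also have "\<dots> = (\<Sum>v\<in>Z n. (\<Sum>u\<in>Y (Suc n). \<rho> n v u powr p) * (exp p * ?e v))"
    by (subst sum.swap) (simp add: sum_distrib_right)
  also have "\<dots> \<le> (\<Sum>v\<in>Z n. \<epsilon> * (exp p * ?e v))"
    using rho_sum by (intro sum_mono mult_right_mono) (auto simp: Y_def Z_def)
  also have "\<dots> = exp p * \<epsilon> * (\<Sum>v\<in>Xs (N * n + j). exp (- (p / (4 * a ^ j)) * (d x v * a ^ (N * n + j))))"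
    unfolding sum_distrib_left Z_def using a_gt by (intro sum.cong refl) (simp add: A_pow power_add)
  finally have 2: "(\<Sum>u\<in>Y (Suc n). (\<Sum>v\<in>{v\<in>Z n. d u v < 1 / A ^ n}. \<rho> n v u powr p) * ?e u) \<le>
    exp p * \<epsilon> * (\<Sum>v\<in>Xs (N * n + j). exp (- (p / (4 * a ^ j)) * (d x v * a ^ (N * n + j))))" .
  have eps: "0 \<le> \<epsilon>"
  proof -
    obtain v where "v \<in> Z n" using Z_near[OF assms] by blast
    then show ?thesis using rho_sum[of v n] by (intro order_trans[OF sum_nonneg rho_sum]) (auto simp: Z_def)
  qed
  have "exp p * \<epsilon> * (\<Sum>v\<in>Xs (N * n + j). exp (- (p / (4 * a ^ j)) * (d x v * a ^ (N * n + j)))) \<le>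
      exp p * \<epsilon> * K (p / (4 * a ^ j))"
    using A0 p_pos assms eps by (intro mult_left_mono decay) auto
  note 3 = order_trans[OF 2 this]
  have "(\<Sum>u\<in>Y (Suc n). s n u * ?e u) = (\<Sum>u\<in>Y (Suc n). \<eta> * ?e u) +
      exp (2 * p) * (\<Sum>u\<in>Y (Suc n). (\<Sum>v\<in>{v\<in>Z n. d u v < 1 / A ^ n}. \<rho> n v u powr p) * ?e u)"
    by (simp add: s_def distrib_right sum.distrib mult.assoc flip: sum_distrib_left)
  also have "\<dots> \<le> \<eta> * K (p / (4 * a ^ N)) + exp (2 * p) * (exp p * \<epsilon> * K (p / (4 * a ^ j)))"
    using 1 3 by (intro add_mono mult_left_mono) auto
  also have "exp (2 * p) * (exp p * \<epsilon> * K (p / (4 * a ^ j))) = exp (3 * p) * \<epsilon> * K (p / (4 * a ^ j))"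
    by (simp flip: exp_add)
  finally show ?thesis .
qed

text \<open>The kernel of level \<open>Suc n\<close> decays at least 12 times faster than
  \<open>V n\<close> can grow. Three quarters of its exponent absorb that growth and leave decay in
  \<open>d x u\<close>, which \<open>s_decay_sum\<close> sums over \<open>u\<close>; the last
  quarter sums over \<open>w\<close>. The factor \<open>exp (- p) / 2\<close> instead of 1 is room
  for \<open>V_upper\<close>.\<close>

lemma V_branch:
  assumes "x \<in> M"
  shows "(\<Sum>w\<in>{w\<in>Y (Suc n). d x w < 2 / A ^ n}. V (Suc n) w) \<le> exp (- p) / 2 * V n x"
proof -
  let ?U = "{w\<in>Y (Suc n). d x w < 2 / A ^ n}"
  have Vx: "0 < V n x" using V_pos assms .
  have "V (Suc n) w \<le> (\<Sum>u\<in>Y (Suc n). exp (3 * p) * V n x * (s n u * exp (- (p / 4) * (d x u * A ^ n))) *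
      exp (- (p / 4) * (d u w * A ^ Suc n)))" if w: "w \<in> ?U" for w
    unfolding V.simps
  proof (intro sum_mono)
    fix u assume u: "u \<in> Y (Suc n)"
    have M: "u \<in> M" "w \<in> M" using u w Y_sub by auto
    define q where "q = d w u * A ^ n"
    have q0: "0 \<le> q" using A_pow_pos[of n] by (simp add: q_def)
    have "d x u \<le> d w u + 2 / A ^ n"
      using triangle[of x w u] assms M w by auto
    then have xu: "d x u * A ^ n \<le> q + 2"
      using A_ge(1) A_pow_pos[of n] mult_right_mono[of "d x u" "d w u + 2 / A ^ n" "A ^ n"]
      by (simp add: distrib_right q_def)
    have Aq: "12 * q \<le> d w u * A ^ Suc n"
      using A_ge(1) mult_right_mono[of 12 A q] q0 by (simp add: q_def mult_ac)
    define Q where "Q = d w u * A ^ Suc n"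
    have "V n u \<le> exp (p * (d x u * A ^ n)) * V n x"
      using V_lip[of u x n] M assms by (simp add: commute)
    then have "exp (- (p * Q)) * (s n u * V n u) \<le>
        exp (- (p * Q)) * (s n u * (exp (p * (d x u * A ^ n)) * V n x))"
      using s_pos[of n u] by (intro mult_left_mono) auto
    also have "\<dots> = exp (- (p * Q) + p * (d x u * A ^ n)) * (s n u * V n x)"
      unfolding exp_add by (simp only: mult_ac)
    also have "\<dots> \<le> exp (3 * p + - (p / 4) * (d x u * A ^ n) + - (p / 4) * Q) * (s n u * V n x)"
    proof (intro mult_right_mono)
      \<comment> \<open>This is the required inequality between the exponents, multiplied by
        \<open>4 / p\<close> and rearranged.\<close>
      have "5 * (d x u * A ^ n) \<le> 12 + 3 * Q"
        using xu Aq q0 unfolding Q_def[symmetric] by simp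
      then have "p / 4 * (5 * (d x u * A ^ n)) \<le> p / 4 * (12 + 3 * Q)"
        using p_pos by (intro mult_left_mono) auto
      then show "exp (- (p * Q) + p * (d x u * A ^ n)) \<le>
          exp (3 * p + - (p / 4) * (d x u * A ^ n) + - (p / 4) * Q)"
        by (simp add: field_simps)
    qed (use s_pos[of n u] Vx in auto)
    also have "\<dots> = exp (3 * p) * V n x * (s n u * exp (- (p / 4) * (d x u * A ^ n))) * exp (- (p / 4) * Q)"
      unfolding exp_add by (simp only: mult_ac)
    finally show "exp (- (p * (d w u * A ^ Suc n))) * (s n u * V n u) \<le>
        exp (3 * p) * V n x * (s n u * exp (- (p / 4) * (d x u * A ^ n))) * exp (- (p / 4) * (d u w * A ^ Suc n))"
      by (simp add: Q_def commute)
  qed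
  then have "(\<Sum>w\<in>?U. V (Suc n) w) \<le> (\<Sum>w\<in>?U. \<Sum>u\<in>Y (Suc n).
      exp (3 * p) * V n x * (s n u * exp (- (p / 4) * (d x u * A ^ n))) * exp (- (p / 4) * (d u w * A ^ Suc n)))"
    by (intro sum_mono)
  also have "\<dots> = (\<Sum>u\<in>Y (Suc n). exp (3 * p) * V n x * (s n u * exp (- (p / 4) * (d x u * A ^ n))) *
      (\<Sum>w\<in>?U. exp (- (p / 4) * (d u w * A ^ Suc n))))"
    by (subst sum.swap) (simp add: sum_distrib_left)
  also have "\<dots> \<le> (\<Sum>u\<in>Y (Suc n). exp (3 * p) * V n x * (s n u * exp (- (p / 4) * (d x u * A ^ n))) * K (p / 4))"
  proof (intro sum_mono mult_left_mono)
    fix u assume u: "u \<in> Y (Suc n)"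
    have "(\<Sum>w\<in>?U. exp (- (p / 4) * (d u w * A ^ Suc n))) \<le> (\<Sum>w\<in>Y (Suc n). exp (- (p / 4) * (d u w * A ^ Suc n)))"
      using finite_Y by (intro sum_mono2) auto
    also have "\<dots> \<le> K (p / 4)"
      unfolding Y_def A_pow using u Y_sub p_pos by (intro decay) auto
    finally show "(\<Sum>w\<in>?U. exp (- (p / 4) * (d u w * A ^ Suc n))) \<le> K (p / 4)" .
  qed (use s_pos Vx in \<open>auto intro: less_imp_le\<close>)
  also have "\<dots> = (exp (3 * p) * K (p / 4) * V n x) * (\<Sum>u\<in>Y (Suc n). s n u * exp (- (p / 4) * (d x u * A ^ n)))"
    by (simp add: sum_distrib_left mult_ac)
  also have "\<dots> \<le> (exp (3 * p) * K (p / 4) * V n x) *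
      (\<eta> * K (p / (4 * a ^ N)) + exp (3 * p) * \<epsilon> * K (p / (4 * a ^ j)))"
  proof (intro mult_left_mono s_decay_sum assms)
    have "0 \<le> K (p / 4)"
      using decay[of "p / 4" x 0] p_pos assms by (intro order_trans[OF sum_nonneg decay[of "p / 4" x 0]]) auto
    then show "0 \<le> exp (3 * p) * K (p / 4) * V n x" using Vx by simp
  qed
  also have "\<dots> \<le> exp (- p) / 2 * V n x"
    using mult_right_mono[OF small less_imp_le[OF Vx]] by (simp add: mult_ac)
  finally show ?thesis .
qed

text \<open>A net point near \<open>x\<close> is one of the children summed in
  \<open>V_branch\<close>; returning from it to \<open>x\<close> costs \<open>exp p\<close>, which
  cancels \<open>exp (- p)\<close> there.\<close>

lemma V_upper:
  assumes "x \<in> M"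
  shows "V (Suc n) x \<le> 1 / 2 * V n x"
proof -
  obtain u where u: "u \<in> Y (Suc n)" "d x u < 1 / A ^ Suc n" using Y_near[OF assms] by blast
  have uM: "u \<in> M" using u Y_sub by blast
  have "1 / A ^ Suc n \<le> 2 / A ^ n"
    using A_pow_Suc_ge[of 1 n] A_pow_pos[of n] by (intro frac_le) auto
  then have "u \<in> {w\<in>Y (Suc n). d x w < 2 / A ^ n}" using u by simp
  then have "V (Suc n) u \<le> (\<Sum>w\<in>{w\<in>Y (Suc n). d x w < 2 / A ^ n}. V (Suc n) w)"
    using finite_Y[of "Suc n"] V_pos[of _ "Suc n"] Y_sub[of "Suc n"]
    by (intro member_le_sum) (auto intro: less_imp_le simp del: V.simps)
  also have "\<dots> \<le> exp (- p) / 2 * V n x" using V_branch[OF assms] .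
  finally have 1: "V (Suc n) u \<le> exp (- p) / 2 * V n x" .
  have "V (Suc n) x \<le> exp (p * 1) * V (Suc n) u"
    using u uM assms by (intro V_lip_near) auto
  also have "\<dots> \<le> exp (p * 1) * (exp (- p) / 2 * V n x)"
    using 1 by (intro mult_left_mono) auto
  also have "\<dots> = 1 / 2 * V n x" by (simp add: exp_minus)
  finally show ?thesis .
qed

section \<open>The weights and their path condition\<close>

definition W :: "nat \<Rightarrow> 'a \<Rightarrow> real" where
  "W n x = V n x powr (1 / p)"

lemma W_powr: "x \<in> M \<Longrightarrow> W n x powr p = V n x"
  using p_pos V_pos[of x n] by (simp add: W_def powr_powr)

lemma W_le_iff:
  assumes "x \<in> M" "y \<in> M" "0 < c" "V m x \<le> c * V n y"
  shows "W m x \<le> c powr (1 / p) * W n y"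
  using assms p_pos V_pos[of x m]
  by (auto simp: W_def powr_mult[symmetric] intro!: powr_mono2)

text \<open>The kernel at \<open>u\<close> and the passage of \<open>V m\<close> from
  \<open>z\<close> to \<open>u\<close> lose \<open>exp (- p)\<close> each; the factor
  \<open>exp (2 * p)\<close> in \<open>s\<close> restores both, so the constant is exactly
  1.\<close>

lemma W_ge_rho:
  assumes z: "z \<in> M" and x: "x \<in> M" and u: "u \<in> Y (Suc m)" and v: "v \<in> Z m"
    and "d x u < 1 / A ^ Suc m" "d z u \<le> 1 / A ^ m" "d u v < 1 / A ^ m"
  shows "\<rho> m v u * W m z \<le> W (Suc m) x"
proof -
  have uM: "u \<in> M" using u Y_sub by blast
  have "V m z \<le> exp (p * 1) * V m u"
    using assms uM by (intro V_lip_near) auto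
  then have 1: "exp (- p) * V m z \<le> V m u" by (simp add: exp_minus field_simps)
  have "\<rho> m v u powr p \<le> (\<Sum>v\<in>{v\<in>Z m. d u v < 1 / A ^ m}. \<rho> m v u powr p)"
    using assms finite_Z by (intro member_le_sum) auto
  then have "exp (2 * p) * \<rho> m v u powr p \<le> exp (2 * p) * (\<Sum>v\<in>{v\<in>Z m. d u v < 1 / A ^ m}. \<rho> m v u powr p)"
    by (intro mult_left_mono) auto
  then have 2: "exp (2 * p) * \<rho> m v u powr p \<le> s m u"
    using eta unfolding s_def by linarith
  have "\<rho> m v u powr p * V m z = exp (- p) * ((exp (2 * p) * \<rho> m v u powr p) * (exp (- p) * V m z))"
    by (simp add: mult_ac flip: exp_add)
  also have "\<dots> \<le> exp (- p) * (s m u * V m u)"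
    using 1 2 s_pos[of m u] V_pos[OF z, of m] by (intro mult_left_mono mult_mono) auto
  also have "\<dots> \<le> V (Suc m) x" using V_Suc_ge assms by blast
  finally have "(\<rho> m v u powr p * V m z) powr (1 / p) \<le> W (Suc m) x"
    unfolding W_def using p_pos V_pos[OF z, of m] by (intro powr_mono2) auto
  moreover have "(\<rho> m v u powr p * V m z) powr (1 / p) = \<rho> m v u * W m z"
    using p_pos rho_nonneg[of m v u] by (simp add: powr_mult powr_powr W_def)
  ultimately show ?thesis by simp
qed

text \<open>Rounding \<open>ps\<close> to the net of level \<open>N * Suc m\<close> gives a path to
  which \<open>rho_adm\<close> applies at a centre \<open>v\<close> next to its first vertex.
  Consecutive vertices are adjacent because \<open>1 + 3 * \<tau> \<le> lam\<close>: the unrounded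
  point lies in both balls. Then \<open>W_ge_rho\<close> bounds the sum term by term.\<close>

lemma W_path:
  assumes z: "z \<in> M" and ps: "ps \<noteq> []" "set ps \<subseteq> M" and hd: "d z (hd ps) < \<tau> / A ^ Suc m"
    and succ: "successively (\<lambda>x y. d x y < 3 * \<tau> / A ^ Suc m) ps"
    and near: "\<forall>x\<in>set ps. d z x < \<tau> / A ^ m"
    and last: "(\<tau> / 2 - 2 * \<tau> / A) / A ^ m \<le> d z (last ps)"
  shows "W m z \<le> sum_list (map (W (Suc m)) ps)"
proof -
  have "\<exists>u\<in>Y (Suc m). d x u < 1 / A ^ Suc m" if "x \<in> M" for x
    using Y_near[OF that] by blast
  then obtain r where r: "\<And>x. x \<in> M \<Longrightarrow> r x \<in> Y (Suc m)" "\<And>x. x \<in> M \<Longrightarrow> d x (r x) < 1 / A ^ Suc m"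
    by metis
  have rM: "r x \<in> M" if "x \<in> M" for x using r(1)[OF that] Y_sub by blast
  define us where "us = map r ps"
  have us: "us \<noteq> []" "set us \<subseteq> Y (Suc m)" "hd us = r (hd ps)" "last us = r (last ps)"
    using ps r(1) by (auto simp: us_def hd_map last_map)
  have pM: "hd ps \<in> M" "last ps \<in> M" using ps by auto
  define b where "b = 1 / A ^ m"
  have b: "0 < b" using A_pow_pos[of m] by (simp add: b_def)
  have bA: "1 / A ^ Suc m = b / A" by (simp add: b_def)
  have A8: "1 / A \<le> \<tau> / 8" using A_ge tau by (simp add: field_simps)
  obtain v where v: "v \<in> Z m" "d (r (hd ps)) v < 1 / a ^ (N * m + j)"
    using Z_near[OF rM[OF pM(1)]] by blast
  have vM: "v \<in> M" using v Z_sub by blast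
  have bj: "1 / a ^ (N * m + j) = b * (1 / a ^ j)" by (simp add: b_def A_pow power_add)
  have j': "L * (1 / a ^ j) + 1 / a ^ j \<le> \<tau> / 4" using j_large by (simp add: add_divide_distrib)
  have aj: "0 < 1 / a ^ j" using a_gt by simp
  have aj': "1 / a ^ j \<le> \<tau> / 8"
  proof -
    have "1 * (1 / a ^ j) \<le> L * (1 / a ^ j)" using L_gt aj by (intro mult_right_mono) auto
    then show ?thesis using j' by linarith
  qed
  have t1: "\<tau> / A \<le> 1 / A" using tau A_ge by (intro divide_right_mono) auto
  have zu: "d z (r x) \<le> b * (\<tau> + 1 / A)" if "x \<in> set ps" for x
  proof -
    have "x \<in> M" using that ps by blast
    then have "d z (r x) \<le> d z x + d x (r x)" using z rM by (intro triangle) auto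
    also have "\<dots> \<le> \<tau> / A ^ m + b / A" using near that r(2)[OF \<open>x \<in> M\<close>] unfolding bA by (intro add_mono less_imp_le) auto
    finally show ?thesis by (simp add: b_def add_divide_distrib mult.commute)
  qed
  have zhd: "d z (hd ps) < b * (\<tau> / A)" using hd by (simp add: b_def mult.commute)
  have hdr: "d (hd ps) (r (hd ps)) < b * (1 / A)" using r(2)[OF pM(1)] unfolding bA by simp
  have zu1: "d z (r (hd ps)) < b * (\<tau> / A) + b * (1 / A)"
    using triangle[of z "hd ps" "r (hd ps)"] z pM rM zhd hdr by fastforce
  have zv: "d z v < b * (\<tau> / A) + b * (1 / A) + b * (1 / a ^ j)"
    using triangle[of z "r (hd ps)" v] z vM rM[OF pM(1)] zu1 v(2) unfolding bj by fastforce
  have rho: "1 \<le> (\<Sum>u\<in>set us. \<rho> m v u)"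
  proof (rule rho_adm)
    show "v \<in> Xs (N * m + j)" using v by (simp add: Z_def)
    show "us \<noteq> []" using us by simp
    show "set us \<subseteq> Xs (N * Suc m)" using us by (simp add: Y_def)
    show "d v (hd us) < 1 / a ^ (N * m + j)" using v(2) us by (simp add: commute)
    have lam: "(1 + 3 * \<tau>) * (1 / A ^ Suc m) \<le> lam * (1 / A ^ Suc m)"
      using tau A_pow_pos[of "Suc m"] by (intro mult_right_mono) auto
    have "successively (\<lambda>x y. \<exists>z\<in>M. d (r x) z < lam / a ^ (N * Suc m) \<and> d (r y) z < lam / a ^ (N * Suc m)) ps"
    proof (rule successively_mono[OF succ])
      fix x y assume xy: "x \<in> set ps" "y \<in> set ps" "d x y < 3 * \<tau> / A ^ Suc m"
      have M: "x \<in> M" "y \<in> M" using xy ps by auto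
      have "d (r x) y \<le> d (r x) x + d x y" using M rM by (intro triangle) auto
      also have "\<dots> < 1 / A ^ Suc m + 3 * \<tau> / A ^ Suc m"
        using xy r(2)[OF M(1)] by (intro add_strict_mono) (auto simp: commute)
      also have "\<dots> = (1 + 3 * \<tau>) * (1 / A ^ Suc m)" by (simp add: add_divide_distrib)
      finally have 1: "d (r x) y < lam / A ^ Suc m" using lam by simp
      have "1 * (1 / A ^ Suc m) \<le> (1 + 3 * \<tau>) * (1 / A ^ Suc m)"
        using tau A_pow_pos[of "Suc m"] by (intro mult_right_mono) auto
      then have 2: "d (r y) y < lam / A ^ Suc m"
        using r(2)[OF M(2)] lam by (simp add: commute)
      show "\<exists>z\<in>M. d (r x) z < lam / a ^ (N * Suc m) \<and> d (r y) z < lam / a ^ (N * Suc m)"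
        using 1 2 M(2) unfolding A_pow by blast
    qed
    then show "successively (\<lambda>u u'. \<exists>z\<in>M. d u z < lam / a ^ (N * Suc m) \<and> d u' z < lam / a ^ (N * Suc m)) us"
      by (simp add: us_def successively_map)
    have zl: "d z (last ps) \<le> d z v + d v (r (last ps)) + d (r (last ps)) (last ps)"
      using triangle[of z v "last ps"] triangle[of v "r (last ps)" "last ps"] z vM pM rM by fastforce
    have rl: "d (r (last ps)) (last ps) < b * (1 / A)"
      using r(2)[OF pM(2)] unfolding bA by (simp add: commute)
    have bl: "b * (\<tau> / 2 - 2 * (\<tau> / A)) \<le> d z (last ps)" using last by (simp add: b_def)
    have "b * (\<tau> / 2 - 2 * (\<tau> / A)) - (b * (\<tau> / A) + b * (1 / A) + b * (1 / a ^ j)) - b * (1 / A)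
        \<le> d v (r (last ps))"
    proof -
      have "B - C - E \<le> x" if "z \<le> w + x + y" "y < E" "B \<le> z" "w < C" for B C E w x y z :: real
        using that by linarith
      from this[OF zl rl bl zv] show ?thesis .
    qed
    then have "b * (\<tau> / 2 - 3 * (\<tau> / A) - 2 * (1 / A) - 1 / a ^ j) \<le> d v (r (last ps))"
      by (simp add: algebra_simps)
    moreover have "b * (L * (1 / a ^ j)) \<le> b * (\<tau> / 2 - 3 * (\<tau> / A) - 2 * (1 / A) - 1 / a ^ j)"
    proof (intro mult_left_mono)
      \<comment> \<open>Of the available \<open>\<tau> / 2\<close>, one quarter of \<tau> pays the
        errors of rounding and of the ends, by the choice of \<open>N\<close>; the other quarter is
        left for \<open>(L + 1) / a ^ j\<close>, by the choice of \<open>j\<close>.\<close>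
      have *: "12 * (\<tau> / A) + 8 * (1 / A) \<le> \<tau>"
        using N_large tau A_ge(1) unfolding A_def[symmetric] by (simp add: field_simps)
      have "x \<le> t / 2 - 3 * y - 2 * w - v" if "12 * y + 8 * w \<le> t" "x + v \<le> t / 4" for t v w x y :: real
        using that by linarith
      from this[OF * j'] show "L * (1 / a ^ j) \<le> \<tau> / 2 - 3 * (\<tau> / A) - 2 * (1 / A) - 1 / a ^ j" .
    qed (use b in simp)
    moreover have "L / a ^ (N * m + j) = b * (L * (1 / a ^ j))" using bj by (simp add: b_def A_pow power_add)
    ultimately show "L / a ^ (N * m + j) \<le> d v (last us)" using us by simp
  qed
  have each: "\<rho> m v (r x) * W m z \<le> W (Suc m) x" if x: "x \<in> set ps" for x
  proof (rule W_ge_rho[OF z _ _ v(1)])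
    show xM: "x \<in> M" using x ps by blast
    show "r x \<in> Y (Suc m)" "d x (r x) < 1 / A ^ Suc m" using r xM by auto
    have "b * (\<tau> + 1 / A) \<le> b * 1" using b tau A8 by (intro mult_left_mono) auto
    then show "d z (r x) \<le> 1 / A ^ m" using zu[OF x] by (simp add: b_def)
    have "d (r x) v \<le> d z (r x) + d z v"
      using triangle[of "r x" z v] rM[OF xM] z vM by (simp add: commute)
    also have "\<dots> < b * (\<tau> + 1 / A) + (b * (\<tau> / A) + b * (1 / A) + b * (1 / a ^ j))"
      using zu[OF x] zv by linarith
    also have "\<dots> = b * (\<tau> + 2 * (1 / A) + \<tau> / A + 1 / a ^ j)" by (simp add: algebra_simps)
    also have "\<dots> \<le> b * 1" using b tau A8 aj' t1 by (intro mult_left_mono) auto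
    finally show "d (r x) v < 1 / A ^ m" by (simp add: b_def)
  qed
  have W0: "0 \<le> W m z" by (simp add: W_def)
  have "W m z * 1 \<le> W m z * (\<Sum>u\<in>set us. \<rho> m v u)" using rho W0 by (intro mult_left_mono)
  also have "\<dots> \<le> W m z * sum_list (map (\<rho> m v) us)"
    using W0 rho_nonneg by (intro mult_left_mono sum_set_le_sum_list) auto
  also have "\<dots> = sum_list (map (\<lambda>x. \<rho> m v (r x) * W m z) ps)"
    by (simp add: us_def o_def sum_list_mult_const mult.commute)
  also have "\<dots> \<le> sum_list (map (W (Suc m)) ps)" using each by (intro sum_list_mono) auto
  finally show ?thesis by simp
qed

lemma weight_system: "weight_system M d A \<tau> p ((\<eta> * exp (- 2 * p)) powr (1 / p)) ((1 / 2) powr (1 / p)) W"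
proof (unfold_locales)
  show "2 \<le> A" using A_ge by simp
  show "0 < \<tau>" "2 * \<tau> \<le> 1" "0 < p" using tau p_pos by auto
  show "1 \<le> 2 * \<tau> * A" using A_ge(2) tau by (simp add: field_simps)
  show "0 < (\<eta> * exp (- 2 * p)) powr (1 / p)" using eta by simp
  have "\<eta> * exp (- 2 * p) < 1 * 1" using eta p_pos by (intro mult_strict_mono) auto
  then show "(\<eta> * exp (- 2 * p)) powr (1 / p) < 1"
    using powr_less_mono2[of "1 / p" "\<eta> * exp (- 2 * p)" 1] eta p_pos by simp
  show "0 < (1 / 2 :: real) powr (1 / p)" by simp
  show "(1 / 2 :: real) powr (1 / p) < 1"
    using powr_less_mono2[of "1 / p" "1 / 2" 1] p_pos by simp
  show "W 0 x = 1" for x by (simp add: W_def)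
  show "0 < W n x" if "x \<in> M" for x n using V_pos[OF that, of n] by (simp add: W_def)
  show "W n x \<le> exp (d x y * A ^ n) * W n y" if "x \<in> M" "y \<in> M" for x y n
    using W_le_iff[OF that _ V_lip[OF that, of n]] p_pos by (simp add: powr_def)
  show "(\<eta> * exp (- 2 * p)) powr (1 / p) * W n x \<le> W (Suc n) x" if x: "x \<in> M" for x n
  proof -
    have "0 < \<eta> * exp (- 2 * p)" using eta by simp
    then show ?thesis
      using V_lower[OF x, of n] V_pos[OF x, of n] p_pos unfolding W_def
      by (subst powr_mult[symmetric]) (auto intro!: powr_mono2)
  qed
  show "W (Suc n) x \<le> (1 / 2) powr (1 / p) * W n x" if "x \<in> M" for x n
    using V_upper[OF that, of n] that by (intro W_le_iff) auto
  show "W m z \<le> sum_list (map (W (Suc m)) ps)"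
    if "z \<in> M" "ps \<noteq> []" "set ps \<subseteq> M" "d z (hd ps) < \<tau> / A ^ Suc m"
      "successively (\<lambda>x y. d x y < 3 * \<tau> / A ^ Suc m) ps"
      "\<forall>x\<in>set ps. d z x < \<tau> / A ^ m" "(\<tau> / 2 - 2 * \<tau> / A) / A ^ m \<le> d z (last ps)" for z ps m
    by (rule W_path[OF that])
  show "\<exists>U. finite U \<and> U \<subseteq> M \<and> (\<forall>u\<in>U. d x u < 2 / A ^ n) \<and>
        mball x (1 / A ^ n) \<subseteq> (\<Union>u\<in>U. mball u (1 / A ^ Suc n)) \<and>
        (\<Sum>u\<in>U. W (Suc n) u powr p) \<le> W n x powr p" if x: "x \<in> M" for x n
  \<comment> \<open>Radius \<open>2 / A ^ n\<close> is enough to contain a net point near each point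
    of the ball of radius \<open>1 / A ^ n\<close>.\<close>
  proof (intro exI[of _ "{w\<in>Y (Suc n). d x w < 2 / A ^ n}"] conjI)
    show "mball x (1 / A ^ n) \<subseteq> (\<Union>u\<in>{w\<in>Y (Suc n). d x w < 2 / A ^ n}. mball u (1 / A ^ Suc n))"
    proof
      fix y assume y: "y \<in> mball x (1 / A ^ n)"
      then have yM: "y \<in> M" by simp
      obtain u where u: "u \<in> Y (Suc n)" "d y u < 1 / A ^ Suc n" using Y_near[OF yM] by blast
      have uM: "u \<in> M" using u Y_sub by blast
      have "1 / A ^ Suc n \<le> 1 / A ^ n"
        using A_pow_Suc_ge[of 1 n] A_pow_pos[of n] by (intro divide_left_mono) auto
      then have "d x u < 2 / A ^ n"
        using triangle[of x y u] x yM uM y u by auto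
      then show "y \<in> (\<Union>u\<in>{w\<in>Y (Suc n). d x w < 2 / A ^ n}. mball u (1 / A ^ Suc n))"
        using u uM yM by (auto simp: commute)
    qed
    have "(\<Sum>u\<in>{w\<in>Y (Suc n). d x w < 2 / A ^ n}. W (Suc n) u powr p) =
        (\<Sum>u\<in>{w\<in>Y (Suc n). d x w < 2 / A ^ n}. V (Suc n) u)"
      using Y_sub by (intro sum.cong refl W_powr) auto
    also have "\<dots> \<le> exp (- p) / 2 * V n x" by (rule V_branch[OF x])
    also have "\<dots> \<le> 1 * V n x"
    proof (intro mult_right_mono)
      have "exp (- p) \<le> 1" using p_pos by simp
      then show "exp (- p) / 2 \<le> 1" by linarith
    qed (use V_pos[OF x, of n] in simp)
    also have "\<dots> = W n x powr p" using W_powr[OF x] by simp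
    finally show "(\<Sum>u\<in>{w\<in>Y (Suc n). d x w < 2 / A ^ n}. W (Suc n) u powr p) \<le> W n x powr p" .
  qed (use finite_Y[of "Suc n"] Y_sub[of "Suc n"] in auto)
  show "\<exists>U. finite U \<and> U \<subseteq> M \<and> M \<subseteq> (\<Union>u\<in>U. mball u 1)"
  proof (intro exI[of _ "Y 0"] conjI subsetI)
    fix x assume x: "x \<in> M"
    obtain u where "u \<in> Y 0" "d x u < 1 / A ^ 0" using Y_near[OF x] by blast
    then show "x \<in> (\<Union>u\<in>Y 0. mball u 1)" using x Y_sub[of 0] by (auto simp: commute)
  qed (use finite_Y[of 0] Y_sub[of 0] in auto)
qed

end

section \<open>From small modulus to a metric\<close>

lemma level_vertices_alt: "level_vertices Xs n = (\<lambda>x. (x, n)) ` Xs n"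
  by (auto simp: level_vertices_def)

lemma sum_level_vertices: "(\<Sum>w\<in>level_vertices Xs n. f w) = (\<Sum>x\<in>Xs n. f (x, n))"
  unfolding level_vertices_alt by (subst sum.reindex) (auto simp: inj_on_def)

text \<open>A competitor is constrained only on \<open>S\<close>; its positive part is nonnegative
  everywhere and agrees with it on \<open>S\<close>.\<close>

lemma comb_modulus_lessD:
  assumes "comb_modulus p \<Gamma> S < ereal \<epsilon>"
  obtains \<rho> where "\<And>w. 0 \<le> \<rho> w" "\<And>\<gamma>. \<gamma> \<in> \<Gamma> \<Longrightarrow> set \<gamma> \<subseteq> S \<Longrightarrow> 1 \<le> (\<Sum>w\<in>set \<gamma>. \<rho> w)"
    "(\<Sum>w\<in>S. \<rho> w powr p) < \<epsilon>"
proof -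
  obtain \<rho> where \<rho>: "\<forall>w\<in>S. 0 \<le> \<rho> w" "\<forall>\<gamma>\<in>\<Gamma>. 1 \<le> (\<Sum>w\<in>set \<gamma>. \<rho> w)" "(\<Sum>w\<in>S. \<rho> w powr p) < \<epsilon>"
    using assms unfolding comb_modulus_def Inf_less_iff by auto
  show ?thesis
  proof (rule that[of "\<lambda>w. max 0 (\<rho> w)"])
    fix \<gamma> assume "\<gamma> \<in> \<Gamma>" "set \<gamma> \<subseteq> S"
    then have "1 \<le> (\<Sum>w\<in>set \<gamma>. \<rho> w)" using \<rho> by blast
    also have "\<dots> \<le> (\<Sum>w\<in>set \<gamma>. max 0 (\<rho> w))" by (intro sum_mono) simp
    finally show "1 \<le> (\<Sum>w\<in>set \<gamma>. max 0 (\<rho> w))" .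
  next
    have "(\<Sum>w\<in>S. max 0 (\<rho> w) powr p) = (\<Sum>w\<in>S. \<rho> w powr p)"
      using \<rho>(1) by (intro sum.cong refl) (simp add: max_def)
    then show "(\<Sum>w\<in>S. max 0 (\<rho> w) powr p) < \<epsilon>" using \<rho>(3) by simp
  qed simp
qed

lemma comb_modulus_le_M_pk:
  assumes "v \<in> Xs n"
  shows "comb_modulus p (Gamma_kL X d a lam L Xs k (v, n)) (level_vertices Xs (n + k)) \<le> M_pk X d a lam L Xs p k"
proof -
  have "(v, n) \<in> all_vertices Xs" using assms by (auto simp: all_vertices_def level_vertices_def)
  then show ?thesis
    unfolding M_pk_def by (intro Sup_upper insertI2 rev_image_eqI[of "(v, n)"]) auto
qed

lemma M_p_zeroD:
  assumes "M_p X d a lam L Xs p = 0" "0 < \<epsilon>"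
  obtains k where "n \<le> k" "M_pk X d a lam L Xs p k < ereal \<epsilon>"
proof -
  have "\<exists>k\<ge>n. M_pk X d a lam L Xs p k < ereal \<epsilon>"
  proof (rule ccontr)
    assume "\<not> (\<exists>k\<ge>n. M_pk X d a lam L Xs p k < ereal \<epsilon>)"
    then have "\<forall>\<^sub>F k in sequentially. ereal \<epsilon> \<le> M_pk X d a lam L Xs p k"
      unfolding eventually_sequentially by (metis linorder_not_less)
    then have "ereal \<epsilon> \<le> liminf (\<lambda>k. M_pk X d a lam L Xs p k)" by (rule Liminf_bounded)
    then show False using assms by (simp add: M_p_def)
  qed
  then show ?thesis using that by blast
qed

context Metric_space begin

text \<open>Rounding may repeat a vertex, while adjacent vertices have to be distinct. Deleting
  immediate repetitions preserves the ends, the set of vertices and hence the sum in the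
  modulus.\<close>

lemma weak_path_in_Gamma:
  assumes us: "us \<noteq> []" "set us \<subseteq> Xs n'" "Xs n' \<subseteq> M" and n': "n' = n + k"
    and pos: "0 < lam / a ^ n'"
    and succ: "successively (\<lambda>u u'. \<exists>z\<in>M. d u z < lam / a ^ n' \<and> d u' z < lam / a ^ n') us"
    and v: "v \<in> M" "d v (hd us) < 1 / a ^ n" "L / a ^ n \<le> d v (last us)"
  shows "remdups_adj (map (\<lambda>u. (u, n')) us) \<in> Gamma_kL M d a lam L Xs k (v, n)"
proof -
  define g where "g = (\<lambda>u::'a. (u, n'))"
  define \<gamma> where "\<gamma> = remdups_adj (map g us)"
  have fg: "fst (g u) = u" for u by (simp add: g_def)
  have usM: "u \<in> M" if "u \<in> set us" for u using that us by blast
  have set: "set \<gamma> = g ` set us" by (simp add: \<gamma>_def)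
  define P where "P w w' \<longleftrightarrow> (\<exists>z\<in>M. d (fst w) z < lam / a ^ n' \<and> d (fst w') z < lam / a ^ n')" for w w' :: "'a \<times> nat"
  have "successively P (map g us)"
    using succ unfolding successively_map P_def fg .
  moreover have "P w w" if "w \<in> set (map g us)" for w
    using that usM pos unfolding P_def by (auto simp: fg intro!: bexI)
  ultimately have "successively P \<gamma>"
    unfolding \<gamma>_def by (simp only: successively_remdups_adj_iff)
  then have "level_adj M d a lam n' (\<gamma> ! i) (\<gamma> ! Suc i)" if i: "Suc i < length \<gamma>" for i
  proof -
    have "\<gamma> ! i \<noteq> \<gamma> ! Suc i"
      using distinct_adj_remdups_adj i unfolding \<gamma>_def by (rule distinct_adj_nth)
    moreover have "P (\<gamma> ! i) (\<gamma> ! Suc i)" using \<open>successively P \<gamma>\<close> i by (rule successively_nth)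
    moreover have "\<gamma> ! i \<in> set \<gamma>" "\<gamma> ! Suc i \<in> set \<gamma>" using i by auto
    then have "fst (\<gamma> ! i) \<in> M" "fst (\<gamma> ! Suc i) \<in> M" using usM unfolding set by (auto simp: fg)
    ultimately show ?thesis unfolding level_adj_def P_def by (auto simp: disjoint_iff)
  qed
  then have "is_path (level_vertices Xs n') (level_adj M d a lam n') \<gamma>"
    using us set unfolding is_path_def level_vertices_alt by (auto simp: \<gamma>_def g_def)
  moreover have "hd \<gamma> = g (hd us)" "last \<gamma> = g (last us)"
    using us by (auto simp: \<gamma>_def hd_map last_map)
  moreover have "hd us \<in> M" using usM us by simp
  ultimately have "\<gamma> \<in> Gamma_kL M d a lam L Xs k (v, n)"
    using v n' by (simp add: Gamma_kL_def fg)
  then show ?thesis by (simp add: \<gamma>_def g_def)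
qed

theorem exists_metric_of_M_p_zero:
  assumes compact: "compact_space mtopology" and dim: "assouad_dim M d < \<infinity>"
    and a: "a > 1" and lam: "lam > 1" and L: "L > 1"
    and nets: "\<And>k. maximal_separated M d (1 / a ^ k) (Xs k)"
    and p: "0 < p" "M_p M d a lam L Xs p = 0"
  shows "\<exists>\<theta>\<in>power_conformal_gauge M d. assouad_dim M \<theta> \<le> ereal p"
proof -
  have a0: "0 < a ^ n" for n using a by simp
  have sep: "separated_set M d (1 / a ^ k) (Xs k)" for k
    using nets[of k] by (simp add: maximal_separated_def)
  have XM: "Xs k \<subseteq> M" for k using sep[of k] by (simp add: separated_set_def)
  have fin: "finite (Xs k)" for k
    using separated_finite[OF compact dim sep[of k]] a0[of k] by simp
  obtain \<beta> C where C: "0 < C" "\<And>x r R. \<lbrakk>x \<in> M; 0 < r; r < R\<rbrakk> \<Longrightarrow>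
      cover_num M d r (mball x R) \<le> ereal (C * (R / r) powr \<beta>)"
    using assouad_dim_lessD[OF dim] by metis
  have "\<exists>K. \<forall>x r F. x \<in> M \<and> 0 < r \<and> finite F \<and> separated_set M d r F \<longrightarrow>
    (\<Sum>u\<in>F. exp (- t * (d x u / r))) \<le> K" if "0 < t" for t
    using exp_decay_sum[OF C that] by metis
  then obtain K0 where K0: "\<And>t x r F. \<lbrakk>0 < t; x \<in> M; 0 < r; finite F; separated_set M d r F\<rbrakk> \<Longrightarrow>
    (\<Sum>u\<in>F. exp (- t * (d x u / r))) \<le> K0 t"
    by metis
  \<comment> \<open>Raised to at least 1 because \<epsilon> and \<eta> are defined by dividing by
    it.\<close>
  define K where "K t = max 1 (K0 t)" for t
  have K1: "1 \<le> K t" for t by (simp add: K_def)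
  have decay: "(\<Sum>u\<in>Xs n. exp (- t * (d x u * a ^ n))) \<le> K t" if "0 < t" "x \<in> M" for t x n
    using K0[OF that _ fin[of n] sep[of n]] a0[of n] by (simp add: K_def)
  define \<tau> where "\<tau> = min (1 / 2) ((lam - 1) / 3)"
  have "\<tau> \<le> (lam - 1) / 3" unfolding \<tau>_def by (rule min.cobounded2)
  then have "1 + 3 * \<tau> \<le> lam" by simp
  moreover have "0 < \<tau>" "2 * \<tau> \<le> 1" using lam by (auto simp: \<tau>_def)
  ultimately have tau: "0 < \<tau>" "2 * \<tau> \<le> 1" "1 + 3 * \<tau> \<le> lam" by auto
  obtain j where "(L + 1) * 4 / \<tau> < a ^ j" using real_arch_pow[OF a] by blast
  then have j: "(L + 1) / a ^ j \<le> \<tau> / 4" using tau a0[of j] by (simp add: field_simps)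
  \<comment> \<open>Half of the right-hand side of \<open>small\<close>; \<epsilon> and \<eta> are
    chosen so that each of the two terms is at most \<open>c\<close>.\<close>
  define c where "c = exp (- p) / 4"
  have c: "0 < c" by (simp add: c_def)
  define \<epsilon> where "\<epsilon> = c / (exp (3 * p) * K (p / 4) * exp (3 * p) * K (p / (4 * a ^ j)))"
  have Kpos: "0 < K t" for t using K1[of t] by linarith
  have eps: "0 < \<epsilon>" unfolding \<epsilon>_def using c Kpos by simp
  obtain k0 where k0: "12 + 8 / \<tau> < a ^ k0" using real_arch_pow[OF a] by blast
  obtain k where k: "k0 \<le> k" "M_pk M d a lam L Xs p k < ereal \<epsilon>"
    using M_p_zeroD[OF p(2) eps] by blast
  \<comment> \<open>From level \<open>N * m + j\<close> it is exactly \<open>k\<close> levels down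
    to \<open>N * Suc m\<close>, so the modulus at level difference \<open>k\<close> supplies the
    admissible functions.\<close>
  define N where "N = j + k"
  have "a ^ k0 \<le> a ^ N" using a k(1) by (intro power_increasing) (auto simp: N_def)
  then have N: "12 + 8 / \<tau> \<le> a ^ N" using k0 by linarith
  define \<eta> where "\<eta> = min (1 / 2) (c / (exp (3 * p) * K (p / 4) * K (p / (4 * a ^ N))))"
  have eta: "0 < \<eta>" "\<eta> < 1" unfolding \<eta>_def using c Kpos by auto
  have lev: "N * m + j + k = N * Suc m" for m by (simp add: N_def)
  define Q where "Q m v R \<longleftrightarrow> (\<forall>w. 0 \<le> R w) \<and> (\<forall>\<gamma>. \<gamma> \<in> Gamma_kL M d a lam L Xs k (v, N * m + j) \<and>
        set \<gamma> \<subseteq> level_vertices Xs (N * Suc m) \<longrightarrow> 1 \<le> (\<Sum>w\<in>set \<gamma>. R w)) \<and>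
      (\<Sum>w\<in>level_vertices Xs (N * Suc m). R w powr p) < \<epsilon>" for m v R
  have ex_Q: "\<exists>R. Q m v R" if "v \<in> Xs (N * m + j)" for m v
  proof -
    have "comb_modulus p (Gamma_kL M d a lam L Xs k (v, N * m + j)) (level_vertices Xs (N * Suc m)) < ereal \<epsilon>"
      using comb_modulus_le_M_pk[where Xs = Xs, OF that, of p M d a lam L k] k(2) unfolding lev by (rule le_less_trans)
    from comb_modulus_lessD[OF this] show ?thesis unfolding Q_def by metis
  qed
  define R where "R m v = (SOME R. Q m v R)" for m v
  have "Q m v (R m v)" if "v \<in> Xs (N * m + j)" for m v
    unfolding R_def using ex_Q[OF that] by (rule someI_ex)
  then have R: "\<And>m v w. v \<in> Xs (N * m + j) \<Longrightarrow> 0 \<le> R m v w"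
    "\<And>m v \<gamma>. \<lbrakk>v \<in> Xs (N * m + j); \<gamma> \<in> Gamma_kL M d a lam L Xs k (v, N * m + j);
        set \<gamma> \<subseteq> level_vertices Xs (N * Suc m)\<rbrakk> \<Longrightarrow> 1 \<le> (\<Sum>w\<in>set \<gamma>. R m v w)"
    "\<And>m v. v \<in> Xs (N * m + j) \<Longrightarrow> (\<Sum>w\<in>level_vertices Xs (N * Suc m). R m v w powr p) < \<epsilon>"
    unfolding Q_def by blast+
  define \<rho> where "\<rho> m v u = (if v \<in> Xs (N * m + j) then R m v (u, N * Suc m) else 0)" for m v u
  interpret C: weight_construction M d a lam L p \<tau> \<eta> \<epsilon> Xs K N j \<rho>
  proof unfold_locales
    show "1 < a" "1 < L" "0 < p" using a L p by auto
    show "0 < \<tau>" "2 * \<tau> \<le> 1" "1 + 3 * \<tau> \<le> lam" by (rule tau)+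
    show "(L + 1) / a ^ j \<le> \<tau> / 4" "12 + 8 / \<tau> \<le> a ^ N" by (rule j N)+
    show "0 < \<eta>" "\<eta> < 1" by (rule eta)+
    show "maximal_separated M d (1 / a ^ n) (Xs n)" "finite (Xs n)" for n by (rule nets fin)+
    show "(\<Sum>u\<in>Xs n. exp (- t * (d x u * a ^ n))) \<le> K t" if "0 < t" "x \<in> M" for t x n
      by (rule decay[OF that])
    show "0 \<le> \<rho> m v u" for m v u using R(1) by (simp add: \<rho>_def)
    show "(\<Sum>u\<in>Xs (N * Suc m). \<rho> m v u powr p) \<le> \<epsilon>" if "v \<in> Xs (N * m + j)" for m v
      using R(3)[OF that] that unfolding sum_level_vertices \<rho>_def by simp
    show "1 \<le> (\<Sum>u\<in>set us. \<rho> m v u)"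
      if v: "v \<in> Xs (N * m + j)" and us: "us \<noteq> []" "set us \<subseteq> Xs (N * Suc m)"
        and succ: "successively (\<lambda>u u'. \<exists>z\<in>M. d u z < lam / a ^ (N * Suc m) \<and> d u' z < lam / a ^ (N * Suc m)) us"
        and ends: "d v (hd us) < 1 / a ^ (N * m + j)" "L / a ^ (N * m + j) \<le> d v (last us)" for m v us
    proof -
      let ?\<gamma> = "remdups_adj (map (\<lambda>u. (u, N * Suc m)) us)"
      have "v \<in> M" using v XM by blast
      moreover have "0 < lam / a ^ (N * Suc m)" using lam a0 by simp
      ultimately have "?\<gamma> \<in> Gamma_kL M d a lam L Xs k (v, N * m + j)"
        using us succ ends XM by (intro weak_path_in_Gamma) (auto simp: lev)
      moreover have set: "set ?\<gamma> = (\<lambda>u. (u, N * Suc m)) ` set us" by simp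
      moreover have "set ?\<gamma> \<subseteq> level_vertices Xs (N * Suc m)"
        using us unfolding set level_vertices_alt by blast
      ultimately have "1 \<le> (\<Sum>w\<in>set ?\<gamma>. R m v w)" using R(2) v by blast
      also have "\<dots> = (\<Sum>u\<in>set us. R m v (u, N * Suc m))"
        unfolding set by (subst sum.reindex) (auto simp: inj_on_def)
      finally show ?thesis using v by (simp add: \<rho>_def)
    qed
    have "exp (3 * p) * K (p / 4) * (\<eta> * K (p / (4 * a ^ N))) =
        \<eta> * (exp (3 * p) * K (p / 4) * K (p / (4 * a ^ N)))" by simp
    also have "\<dots> \<le> c / (exp (3 * p) * K (p / 4) * K (p / (4 * a ^ N))) *
        (exp (3 * p) * K (p / 4) * K (p / (4 * a ^ N)))"
      unfolding \<eta>_def using Kpos by (intro mult_right_mono) (auto intro!: mult_nonneg_nonneg less_imp_le)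
    also have "\<dots> = c" using Kpos[of "p / 4"] Kpos[of "p / (4 * a ^ N)"] by simp
    finally have 1: "exp (3 * p) * K (p / 4) * (\<eta> * K (p / (4 * a ^ N))) \<le> c" .
    have 2: "exp (3 * p) * K (p / 4) * (exp (3 * p) * \<epsilon> * K (p / (4 * a ^ j))) = c"
      unfolding \<epsilon>_def using Kpos[of "p / 4"] Kpos[of "p / (4 * a ^ j)"] by simp
    show "exp (3 * p) * K (p / 4) *
        (\<eta> * K (p / (4 * a ^ N)) + exp (3 * p) * \<epsilon> * K (p / (4 * a ^ j))) \<le> exp (- p) / 2"
      using 1 2 unfolding distrib_left c_def by simp
  qed
  interpret W: weight_system M d C.A \<tau> p "(\<eta> * exp (- 2 * p)) powr (1 / p)" "(1 / 2) powr (1 / p)" C.W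
    by (rule C.weight_system)
  show ?thesis using W.theta_in_power_conformal_gauge W.assouad_dim_theta by blast
qed

end

section \<open>From a metric to small modulus\<close>

lemma half_line_homeomorphism:
  fixes \<eta> :: "real \<Rightarrow> real"
  assumes "homeomorphism {0..} {0..} \<eta> \<eta>'"
  shows "\<eta> 0 = 0" "\<exists>H\<ge>1. \<forall>t\<in>{0..R}. \<eta> t \<le> H"
    "0 < e \<Longrightarrow> \<exists>\<delta>>0. \<forall>t\<in>{0..\<delta>}. \<eta> t \<le> e"
proof -
  have cont: "continuous_on {0..} \<eta>" and img: "\<eta> ` {0..} = {0..}"
    and inj: "\<And>x. x \<in> {0..} \<Longrightarrow> \<eta>' (\<eta> x) = x"
    using assms by (auto simp: homeomorphism_def)
  have nonneg: "0 \<le> \<eta> t" if "0 \<le> t" for t using img that by blast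
  show z: "\<eta> 0 = 0"
  proof (rule ccontr)
    assume *: "\<eta> 0 \<noteq> 0"
    have "0 \<in> \<eta> ` {0..}" unfolding img by simp
    then obtain s where s: "0 \<le> s" "\<eta> s = 0" by auto
    then have "0 < s" using * by (cases "s = 0") auto
    \<comment> \<open>A zero at \<open>s > 0\<close> would be interior to this interval, on which
      \<eta> is strictly monotone; one endpoint would then have a negative value.\<close>
    have "inj_on \<eta> {0..s + 1}"
      using inj by (intro inj_on_inverseI[of _ \<eta>']) auto
    moreover have "continuous_on {0..s + 1} \<eta>"
      using cont by (rule continuous_on_subset) auto
    ultimately have "\<eta> 0 < \<eta> s \<and> \<eta> s < \<eta> (s + 1) \<or> \<eta> (s + 1) < \<eta> s \<and> \<eta> s < \<eta> 0"
      using \<open>0 < s\<close> by (intro continuous_inj_imp_mono) auto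
    then show False using nonneg[of 0] nonneg[of "s + 1"] s by auto
  qed
  have "compact (\<eta> ` {0..R})"
    using continuous_on_subset[OF cont, of "{0..R}"] by (intro compact_continuous_image) auto
  then have "bdd_above (\<eta> ` {0..R})" by (intro bounded_imp_bdd_above compact_imp_bounded)
  then obtain B where "\<forall>t\<in>{0..R}. \<eta> t \<le> B" unfolding bdd_above_def by blast
  then show "\<exists>H\<ge>1. \<forall>t\<in>{0..R}. \<eta> t \<le> H"
    by (intro exI[of _ "max 1 B"]) (auto simp: le_max_iff_disj)
  show "\<exists>\<delta>>0. \<forall>t\<in>{0..\<delta>}. \<eta> t \<le> e" if "0 < e"
  proof -
    have "\<exists>\<delta>>0. \<forall>t\<in>{0..}. t < \<delta> \<longrightarrow> dist (\<eta> t) (\<eta> 0) < e"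
      using cont[unfolded continuous_on_iff, rule_format, of 0 e] that by simp
    then obtain \<delta> where \<delta>: "0 < \<delta>" "\<forall>t\<in>{0..}. t < \<delta> \<longrightarrow> dist (\<eta> t) (\<eta> 0) < e" by blast
    have "\<eta> t \<le> e" if "t \<in> {0..\<delta> / 2}" for t
      using \<delta>(2)[rule_format, of t] that \<delta>(1) z by (auto simp: dist_real_def)
    then show ?thesis using \<delta>(1) by (intro exI[of _ "\<delta> / 2"]) auto
  qed
qed

lemma Gamma_kL_path:
  assumes "Metric_space M d" "\<gamma> \<in> Gamma_kL M d a lam L Xs k (v, n)" "v \<in> M" "Xs (n + k) \<subseteq> M"
  obtains us where "us \<noteq> []" "set us \<subseteq> Xs (n + k)" "set \<gamma> = (\<lambda>u. (u, n + k)) ` set us"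
    "successively (\<lambda>u u'. \<exists>z\<in>M. d u z < lam / a ^ (n + k) \<and> d u' z < lam / a ^ (n + k)) us"
    "d v (hd us) < 1 / a ^ n" "L / a ^ n \<le> d v (last us)"
proof -
  interpret Metric_space M d by fact
  define us where "us = map fst \<gamma>"
  have \<gamma>: "\<gamma> \<noteq> []" "set \<gamma> \<subseteq> level_vertices Xs (n + k)"
    "\<And>i. Suc i < length \<gamma> \<Longrightarrow> level_adj M d a lam (n + k) (\<gamma> ! i) (\<gamma> ! Suc i)"
    "fst (hd \<gamma>) \<in> mball v (1 / a ^ n)" "fst (last \<gamma>) \<notin> mball v (L * (1 / a ^ n))"
    using assms(2) by (auto simp: Gamma_kL_def is_path_def)
  have snd: "w = (fst w, n + k)" "fst w \<in> Xs (n + k)" if "w \<in> set \<gamma>" for w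
    using that \<gamma>(2) by (auto simp: level_vertices_def)
  show ?thesis
  proof (rule that[of us])
    show "us \<noteq> []" using \<gamma> by (simp add: us_def)
    show "set us \<subseteq> Xs (n + k)" using snd by (auto simp: us_def)
    show "set \<gamma> = (\<lambda>u. (u, n + k)) ` set us"
      unfolding us_def set_map image_image using snd(1) by (simp add: image_cong[of _ _ "\<lambda>w. (fst w, n + k)" "\<lambda>w. w"])
    show "successively (\<lambda>u u'. \<exists>z\<in>M. d u z < lam / a ^ (n + k) \<and> d u' z < lam / a ^ (n + k)) us"
      unfolding us_def successively_map unfolding successively_conv_nth
    proof (intro allI impI)
      fix i assume "Suc i < length \<gamma>"
      then obtain z where "z \<in> mball (fst (\<gamma> ! i)) (lam * (1 / a ^ (n + k)))"
        "z \<in> mball (fst (\<gamma> ! Suc i)) (lam * (1 / a ^ (n + k)))"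
        using \<gamma>(3) unfolding level_adj_def by blast
      then show "\<exists>z\<in>M. d (fst (\<gamma> ! i)) z < lam / a ^ (n + k) \<and> d (fst (\<gamma> ! Suc i)) z < lam / a ^ (n + k)"
        by auto
    qed
    show "d v (hd us) < 1 / a ^ n" using \<gamma> by (simp add: us_def hd_map)
    have "fst (last \<gamma>) \<in> M" using snd(2)[of "last \<gamma>"] \<gamma>(1) assms(4) by auto
    then show "L / a ^ n \<le> d v (last us)" using \<gamma> assms(3) by (simp add: us_def last_map)
  qed
qed

text \<open>The sum runs over the set of vertices, so repetitions must not be paid twice. The claim
  for every \<open>x\<close> on the path handles this: if the first vertex occurs again, the
  induction hypothesis at the later occurrence suffices. The extra \<open>\<delta> x\<close> pays
  for the step onto the path.\<close>

lemma (in Metric_space) path_weight: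
  assumes "xs \<noteq> []" "set xs \<subseteq> M" "successively (\<lambda>x y. d x y \<le> \<delta> x + \<delta> y) xs"
    and "\<And>x. x \<in> set xs \<Longrightarrow> 0 \<le> \<delta> x" "x \<in> set xs"
  shows "d x (last xs) + \<delta> x \<le> 2 * (\<Sum>w\<in>set xs. \<delta> w)"
  using assms
proof (induction xs arbitrary: x rule: list_nonempty_induct)
  case (single y)
  then show ?case by simp
next
  case (cons y ys)
  have IH: "d x (last ys) + \<delta> x \<le> 2 * (\<Sum>w\<in>set ys. \<delta> w)" if "x \<in> set ys" for x
    using cons.IH[of x] cons.prems cons.hyps that by (auto simp: successively_Cons)
  have mono: "(\<Sum>w\<in>set ys. \<delta> w) \<le> (\<Sum>w\<in>set (y # ys). \<delta> w)"
    using cons.prems by (intro sum_mono2) auto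
  show ?case
  proof (cases "x \<in> set ys")
    case True
    then show ?thesis using IH[OF True] mono cons.hyps by simp
  next
    case False
    then have x: "x = y" using cons.prems by simp
    have hd: "hd ys \<in> set ys" using cons.hyps by simp
    have last: "last ys \<in> set ys" using cons.hyps by simp
    have "d x (last ys) \<le> d x (hd ys) + d (hd ys) (last ys)"
      using cons.prems x hd last by (intro triangle) auto
    moreover have "d x (hd ys) \<le> \<delta> x + \<delta> (hd ys)"
      using cons.prems cons.hyps x by (simp add: successively_Cons)
    ultimately have "d x (last ys) + \<delta> x \<le> 2 * \<delta> x + 2 * (\<Sum>w\<in>set ys. \<delta> w)"
      using IH[OF hd] by linarith
    also have "\<dots> = 2 * (\<Sum>w\<in>set (y # ys). \<delta> w)" using False x by simp
    finally show ?thesis using cons.hyps by simp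
  qed
qed

section \<open>Modulus bounds from a metric of small dimension\<close>

context Metric_space begin

text \<open>Quasisymmetry controls theta-sizes only at bounded relative distance from the centre, so
  a path is cut after its first vertex outside the ball; that vertex overshoots by at most two radii
  \<open>l\<close>.\<close>

lemma first_exit:
  assumes us: "us \<noteq> []" "set us \<subseteq> M" "x \<in> M"
    and succ: "successively (\<lambda>u u'. \<exists>z\<in>M. d u z < l \<and> d u' z < l) us"
    and ends: "d x (hd us) < r" "r \<le> d x (last us)"
  obtains xs where "xs \<noteq> []" "set xs \<subseteq> set us" "hd xs = hd us"
    "successively (\<lambda>u u'. \<exists>z\<in>M. d u z < l \<and> d u' z < l) xs"
    "r \<le> d x (last xs)" "\<forall>u\<in>set xs. d x u < r + 2 * l"
proof -
  have "\<exists>u\<in>set us. r \<le> d x u" using us ends by (intro bexI[of _ "last us"]) auto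
  from split_list_first_prop[where P = "\<lambda>u. r \<le> d x u", OF this]
  obtain ys y zs where y: "us = ys @ y # zs" "r \<le> d x y" "\<forall>u\<in>set ys. \<not> r \<le> d x u"
    by (elim exE conjE) (rule that)
  have ys: "ys \<noteq> []" using y ends by (cases ys) auto
  have succ': "successively (\<lambda>u u'. \<exists>z\<in>M. d u z < l \<and> d u' z < l) ys"
    "\<exists>z\<in>M. d (last ys) z < l \<and> d y z < l"
    using succ ys unfolding y(1) successively_append_iff by auto
  obtain z where z: "z \<in> M" "d (last ys) z < l" "d y z < l" using succ'(2) by blast
  have M: "last ys \<in> M" "y \<in> M" using us(2) ys y(1) by auto
  have "d x y \<le> d x (last ys) + d (last ys) z + d y z"
    using triangle[of x "last ys" y] triangle[of "last ys" z y] M z(1) us(3) by (simp add: commute)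
  moreover have "d x (last ys) < r" using y(3) ys by (meson last_in_set not_le)
  ultimately have xy: "d x y < r + 2 * l" using z by linarith
  have l: "0 < l" using z(2) by (metis nonneg order_le_less_trans)
  show ?thesis
  proof (rule that[of "ys @ [y]"])
    show "successively (\<lambda>u u'. \<exists>z\<in>M. d u z < l \<and> d u' z < l) (ys @ [y])"
      using succ' ys by (simp add: successively_append_iff)
    show "\<forall>u\<in>set (ys @ [y]). d x u < r + 2 * l"
      using xy y(3) l by fastforce
  qed (use y ys in auto)
qed

text \<open>Let \<open>\<delta> u\<close> be the theta-radius of the ball at \<open>u\<close> and
  \<open>D\<close> the theta-size of the ball at \<open>v\<close>. The sum of
  \<open>(\<delta> u / D) powr p\<close> is at most \<open>\<omega> powr (p - q)\<close>, from the
  uniform bound \<omega> on the ratios, times the sum of the \<open>q\<close>-th powers, which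
  converges because \<open>\<beta> < q\<close>. Only the first factor depends on how small the
  ratios are.\<close>

lemma comb_modulus_le:
  assumes \<theta>: "Metric_space M \<theta>"
    and qs: "\<And>x y b. \<lbrakk>x \<in> M; y \<in> M; b \<in> M; x \<noteq> b\<rbrakk> \<Longrightarrow> \<theta> x y / \<theta> x b \<le> \<eta> (d x y / d x b)"
    and cov: "0 < C" "\<And>x r R. \<lbrakk>x \<in> M; 0 < r; r < R\<rbrakk> \<Longrightarrow>
      cover_num M \<theta> r (Metric_space.mball M \<theta> x R) \<le> ereal (C * (R / r) powr \<beta>)"
    and exps: "0 < \<beta>" "\<beta> < q" "q < p"
    and par: "1 < a" "1 < lam" "1 < L"
    and net: "separated_set M d (1 / a ^ (n + k)) (Xs (n + k))" "finite (Xs (n + k))"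
    and H: "1 \<le> H" "\<And>t. \<lbrakk>0 \<le> t; t \<le> (L + 2 * lam) / (L - 1) + lam\<rbrakk> \<Longrightarrow> \<eta> t \<le> H"
    and \<omega>: "0 < \<omega>" "\<omega> \<le> 1" "\<And>t. \<lbrakk>0 \<le> t; t \<le> 2 * lam / (L * a ^ k)\<rbrakk> \<Longrightarrow> \<eta> t \<le> \<omega> / (H + 1)"
    and v: "v \<in> M"
  shows "comb_modulus p (Gamma_kL M d a lam L Xs k (v, n)) (level_vertices Xs (n + k)) \<le>
    ereal ((2 * H\<^sup>2) powr p * (\<omega> powr (p - q) *
      (\<Sum>i. C * (4 * H\<^sup>2 * exp 1) powr \<beta> * exp (\<beta> * real i) * exp (- q * real i))))"
proof -
  have summ: "summable (\<lambda>i. C * (4 * H\<^sup>2 * exp 1) powr \<beta> * exp (\<beta> * real i) * exp (- q * real i))"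
  proof -
    have *: "exp (\<beta> * real i) * exp (- q * real i) = exp (\<beta> - q) ^ i" for i
      by (simp add: exp_of_nat_mult[symmetric] algebra_simps flip: exp_add)
    show ?thesis unfolding mult.assoc[of _ "exp _"] *
    proof -
      show "summable (\<lambda>i. C * (4 * H\<^sup>2 * exp 1) powr \<beta> * exp (\<beta> - q) ^ i)"
        using exps by (intro summable_mult summable_geometric) simp
    qed
  qed
  show ?thesis
  proof (cases "Gamma_kL M d a lam L Xs k (v, n) = {}")
    case True
    have "comb_modulus p (Gamma_kL M d a lam L Xs k (v, n)) (level_vertices Xs (n + k)) \<le>
        ereal (\<Sum>w\<in>level_vertices Xs (n + k). 0 powr p)"
      unfolding comb_modulus_def True by (intro Inf_lower image_eqI[of _ _ "\<lambda>_. 0"]) auto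
    also have "\<dots> \<le> ereal ((2 * H\<^sup>2) powr p * (\<omega> powr (p - q) *
        (\<Sum>i. C * (4 * H\<^sup>2 * exp 1) powr \<beta> * exp (\<beta> * real i) * exp (- q * real i))))"
    proof -
      have "0 \<le> (\<Sum>i. C * (4 * H\<^sup>2 * exp 1) powr \<beta> * exp (\<beta> * real i) * exp (- q * real i))"
        using cov(1) by (intro suminf_nonneg summ) simp
      then show ?thesis by simp
    qed
    finally show ?thesis .
  next
    case False
    interpret T: Metric_space M \<theta> by (rule \<theta>)
    define r where "r = 1 / a ^ n"
    define s where "s = 1 / a ^ (n + k)"
    define R where "R = L + 2 * lam"
    define near where "near u \<longleftrightarrow> u \<in> M \<and> d v u < R * r" for u
    have r: "0 < r" and s: "0 < s" using par by (auto simp: r_def s_def)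
    have sr: "s = r / a ^ k" by (simp add: r_def s_def power_add)
    have "1 \<le> a ^ k" using par by simp
    then have "s \<le> r" unfolding sr using r by (simp add: divide_le_eq)
    have XM: "Xs (n + k) \<subseteq> M" using net by (simp add: separated_set_def)
    have exit: "\<exists>xs. xs \<noteq> [] \<and> set xs \<subseteq> Xs (n + k) \<and> (\<lambda>u. (u, n + k)) ` set xs \<subseteq> set \<gamma> \<and>
        successively (\<lambda>u u'. \<exists>z\<in>M. d u z < lam * s \<and> d u' z < lam * s) xs \<and>
        d v (hd xs) < r \<and> L * r \<le> d v (last xs) \<and> (\<forall>u\<in>set xs. near u)"
      if \<gamma>: "\<gamma> \<in> Gamma_kL M d a lam L Xs k (v, n)" for \<gamma>
    proof -
      obtain us where us: "us \<noteq> []" "set us \<subseteq> Xs (n + k)" "set \<gamma> = (\<lambda>u. (u, n + k)) ` set us"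
        "successively (\<lambda>u u'. \<exists>z\<in>M. d u z < lam / a ^ (n + k) \<and> d u' z < lam / a ^ (n + k)) us"
        "d v (hd us) < 1 / a ^ n" "L / a ^ n \<le> d v (last us)"
        using Gamma_kL_path[OF Metric_space_axioms \<gamma> v XM] .
      have eqs: "lam / a ^ (n + k) = lam * s" "1 / a ^ n = r" "L / a ^ n = L * r"
        by (simp_all add: r_def s_def)
      have "set us \<subseteq> M" using us(2) XM by blast
      moreover have "d v (hd us) < L * r"
      proof -
        have "1 * r < L * r" using par r by (intro mult_strict_right_mono) auto
        then show ?thesis using us(5) unfolding eqs by simp
      qed
      ultimately obtain xs where xs: "xs \<noteq> []" "set xs \<subseteq> set us" "hd xs = hd us"
        "successively (\<lambda>u u'. \<exists>z\<in>M. d u z < lam * s \<and> d u' z < lam * s) xs"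
        "L * r \<le> d v (last xs)" "\<forall>u\<in>set xs. d v u < L * r + 2 * (lam * s)"
        by (rule first_exit[OF us(1) _ v us(4)[unfolded eqs] _ us(6)[unfolded eqs]])
      have "lam * s \<le> lam * r" using \<open>s \<le> r\<close> par by (intro mult_left_mono) auto
      then have "L * r + 2 * (lam * s) \<le> R * r" by (simp add: R_def distrib_right)
      then have "near u" if "u \<in> set xs" for u
        using that xs(2,6) \<open>set us \<subseteq> M\<close> unfolding near_def by (meson less_le_trans subsetD)
      moreover have "(\<lambda>u. (u, n + k)) ` set xs \<subseteq> set \<gamma>" unfolding us(3) using xs(2) by (rule image_mono)
      moreover have "set xs \<subseteq> Xs (n + k)" using xs(2) us(2) by (rule order_trans)
      ultimately show ?thesis using xs us(5) unfolding eqs by (intro exI[of _ xs]) simp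
    qed
    obtain \<gamma>0 where "\<gamma>0 \<in> Gamma_kL M d a lam L Xs k (v, n)" using False by blast
    from exit[OF this] obtain xs0 where xs0: "xs0 \<noteq> []" "L * r \<le> d v (last xs0)" "\<forall>u\<in>set xs0. near u"
      by (elim exE conjE) (rule that)
    \<comment> \<open>The ball at \<open>v\<close> may contain no second point, so its theta-size is
      measured at the end of a path, which exists as the family is nonempty.\<close>
    define y0 where "y0 = last xs0"
    have y0: "L * r \<le> d v y0" "near y0" using xs0 by (auto simp: y0_def)
    have y0M: "y0 \<in> M" using y0 by (simp add: near_def)
    define D where "D = \<theta> v y0"
    have Lr: "r < L * r" using par r by simp
    have "0 < d v y0" using y0(1) Lr r by linarith
    then have "v \<noteq> y0" using v by auto
    then have D: "0 < D" using v y0M by (simp add: D_def)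
    have qsH: "\<theta> x y \<le> H * \<theta> x b" if M: "x \<in> M" "y \<in> M" "b \<in> M" and c: "0 < c" "c \<le> d x b" "d x y \<le> t * c"
      and t: "t \<le> (L + 2 * lam) / (L - 1) + lam" for x y b c t
    proof -
      have "x \<noteq> b" using c M by auto
      then have pos: "0 < \<theta> x b" using M by simp
      have "d x y / d x b \<le> (t * c) / c"
        using c by (intro frac_le order_trans[OF nonneg c(3)]) auto
      then have "\<eta> (d x y / d x b) \<le> H" using c t by (intro H) auto
      then have "\<theta> x y / \<theta> x b \<le> H" using qs[OF M \<open>x \<noteq> b\<close>] by linarith
      then show ?thesis using pos by (simp add: divide_le_eq)
    qed
    have L1: "0 < L - 1" using par by simp
    have R0: "0 < R" using par by (simp add: R_def)
    \<comment> \<open>\<open>H\<close> bounds \<eta> on an interval that contains the three ratios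
      to be used: \<open>R / L\<close>, \<open>R / (L - 1)\<close> and \<open>lam\<close>.\<close>
    have "R / L \<le> R / (L - 1)" using par R0 by (intro divide_left_mono) auto
    then have T1: "R / L \<le> (L + 2 * lam) / (L - 1) + lam" using par by (simp add: R_def)
    have T2: "R / (L - 1) \<le> (L + 2 * lam) / (L - 1) + lam" using par by (simp add: R_def)
    have T3: "lam \<le> (L + 2 * lam) / (L - 1) + lam" using par by simp
    have near_le: "\<theta> v z \<le> H * \<theta> v y" if "near z" "y \<in> M" "L * r \<le> d v y" for z y
      using that v Lr r par by (intro qsH[of v z y "L * r" "R / L"] T1) (auto simp: near_def)
    have far_ge: "D \<le> H\<^sup>2 * \<theta> u y" if u: "u \<in> M" "d v u < r" and y: "near y" "L * r \<le> d v y" for u y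
    proof -
      have yM: "y \<in> M" using y by (simp add: near_def)
      have "d v y \<le> d v u + d u y" using v u yM by (intro triangle)
      then have "(L - 1) * r \<le> d y u" using u(2) y(2) by (simp add: commute left_diff_distrib)
      moreover have "0 < (L - 1) * r" using L1 r by simp
      moreover have "d y v \<le> R / (L - 1) * ((L - 1) * r)" using y(1) L1 by (simp add: near_def commute)
      ultimately have "\<theta> y v \<le> H * \<theta> y u" using qsH[OF yM v u(1) _ _ _ T2] by blast
      then have "\<theta> v y \<le> H * \<theta> u y" by (simp add: T.commute)
      then have "H * \<theta> v y \<le> H * (H * \<theta> u y)" using H(1) by (intro mult_left_mono) auto
      moreover have "D \<le> H * \<theta> v y" unfolding D_def using near_le[OF y0(2) yM y(2)] .
      ultimately show ?thesis by (simp add: power2_eq_square)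
    qed
    have small: "\<theta> u z \<le> \<omega> * D" if u: "near u" and z: "z \<in> M" "d u z < lam * s" for u z
    proof -
      have uM: "u \<in> M" using u by (simp add: near_def)
      have uv: "\<theta> u v \<le> H * D" using near_le[OF u y0M y0(1)] by (simp add: D_def T.commute)
      \<comment> \<open>The reference point for \<open>u\<close> must be far from it, and one of
        \<open>v\<close> and \<open>y0\<close> is; this gives the ratio
        \<open>2 * lam / (L * a ^ k)\<close> at which \<eta> is small.\<close>
      have "L * r \<le> d u v + d u y0"
        using triangle[of v u y0] v uM y0M y0(1) by (simp add: commute)
      then have "L * r / 2 \<le> d u v \<or> L * r / 2 \<le> d u y0" by linarith
      then obtain y where y: "y \<in> {v, y0}" "L * r / 2 \<le> d u y" by blast
      have yM: "y \<in> M" using y v y0M by auto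
      have Lr0: "0 < L * r / 2" using Lr r by simp
      then have "u \<noteq> y" using y(2) uM by auto
      have "\<theta> u y \<le> (H + 1) * D"
      proof (cases "y = v")
        case True
        then show ?thesis using uv D by (simp add: distrib_right)
      next
        case False
        then have "\<theta> u y \<le> \<theta> u v + D" using T.triangle[of u v y0] uM v y0M y by (simp add: D_def)
        then show ?thesis using uv by (simp add: distrib_right)
      qed
      moreover have "\<theta> u z \<le> \<omega> / (H + 1) * \<theta> u y"
      proof -
        have pos: "0 < \<theta> u y" using uM yM \<open>u \<noteq> y\<close> by simp
        have "d u z / d u y \<le> (lam * s) / (L * r / 2)"
          using z y Lr0 by (intro frac_le order_trans[OF nonneg less_imp_le[OF z(2)]]) auto
        also have "\<dots> = 2 * lam / (L * a ^ k)" using r par by (simp add: sr field_simps)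
        finally have "\<eta> (d u z / d u y) \<le> \<omega> / (H + 1)" by (intro \<omega>(3)) auto
        then have "\<theta> u z / \<theta> u y \<le> \<omega> / (H + 1)" using qs[OF uM z(1) yM \<open>u \<noteq> y\<close>] by linarith
        then show ?thesis using pos by (simp only: pos_divide_le_eq)
      qed
      moreover have "\<omega> / (H + 1) * \<theta> u y \<le> \<omega> / (H + 1) * ((H + 1) * D)"
        using calculation(1) \<omega>(1) H(1) by (intro mult_left_mono) auto
      ultimately show ?thesis using H(1) by simp
    qed
    define \<delta> where "\<delta> u = Sup {\<theta> u z | z. z \<in> M \<and> d u z < lam * s}" for u
    have ls: "0 < lam * s" using par s by simp
    have \<delta>_ge: "\<theta> u z \<le> \<delta> u" if "near u" "z \<in> M" "d u z < lam * s" for u z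
      unfolding \<delta>_def using that small[OF that(1)] by (intro cSup_upper bdd_aboveI[of _ "\<omega> * D"]) auto
    have \<delta>_le: "\<delta> u \<le> b" if "near u" "\<And>z. \<lbrakk>z \<in> M; d u z < lam * s\<rbrakk> \<Longrightarrow> \<theta> u z \<le> b" for u b
      unfolding \<delta>_def using that ls by (intro cSup_least) (auto simp: near_def intro!: exI[of _ u])
    have \<delta>_nonneg: "0 \<le> \<delta> u" if "near u" for u
      using \<delta>_ge[OF that, of u] that ls by (simp add: near_def)
    \<comment> \<open>The factor 2 comes from \<open>path_weight\<close>; \<open>H\<^sup>2\<close>
      comes from \<open>far_ge\<close>, which bounds \<open>D\<close> by the theta-distance between
      the ends of a crossing.\<close>
    define \<rho> where "\<rho> w = (if near (fst w) then 2 * H\<^sup>2 * \<delta> (fst w) / D else 0)" for w :: "'a \<times> nat"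
    have \<rho>_nonneg: "0 \<le> \<rho> w" for w using \<delta>_nonneg D by (simp add: \<rho>_def)
    have adm: "1 \<le> (\<Sum>w\<in>set \<gamma>. \<rho> w)" if \<gamma>: "\<gamma> \<in> Gamma_kL M d a lam L Xs k (v, n)" for \<gamma>
    proof -
      from exit[OF \<gamma>] obtain xs where xs: "xs \<noteq> []" "(\<lambda>u. (u, n + k)) ` set xs \<subseteq> set \<gamma>"
        "successively (\<lambda>u u'. \<exists>z\<in>M. d u z < lam * s \<and> d u' z < lam * s) xs"
        "d v (hd xs) < r" "L * r \<le> d v (last xs)" "\<forall>u\<in>set xs. near u"
        by (elim exE conjE) (rule that)
      have sub: "set xs \<subseteq> M" using xs(6) by (auto simp: near_def)
      have "successively (\<lambda>x y. \<theta> x y \<le> \<delta> x + \<delta> y) xs"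
      proof (rule successively_mono[OF xs(3)])
        fix x y assume xy: "x \<in> set xs" "y \<in> set xs" "\<exists>z\<in>M. d x z < lam * s \<and> d y z < lam * s"
        then obtain z where z: "z \<in> M" "d x z < lam * s" "d y z < lam * s" by blast
        have "\<theta> x y \<le> \<theta> x z + \<theta> y z"
          using T.triangle[of x z y] xy z sub by (auto simp: T.commute)
        moreover have "near x" "near y" using xy xs(6) by auto
        ultimately show "\<theta> x y \<le> \<delta> x + \<delta> y"
          using \<delta>_ge z by (meson add_mono order_trans)
      qed
      then have "\<theta> (hd xs) (last xs) + \<delta> (hd xs) \<le> 2 * (\<Sum>w\<in>set xs. \<delta> w)"
        using xs(1,6) sub \<delta>_nonneg by (intro T.path_weight) auto
      moreover have "0 \<le> \<delta> (hd xs)" using \<delta>_nonneg xs(1,6) by simp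
      ultimately have "\<theta> (hd xs) (last xs) \<le> 2 * (\<Sum>w\<in>set xs. \<delta> w)" by linarith
      then have "H\<^sup>2 * \<theta> (hd xs) (last xs) \<le> H\<^sup>2 * (2 * (\<Sum>w\<in>set xs. \<delta> w))"
        by (intro mult_left_mono) auto
      moreover have "D \<le> H\<^sup>2 * \<theta> (hd xs) (last xs)"
        using xs sub by (intro far_ge) auto
      ultimately have "D \<le> (\<Sum>w\<in>set xs. 2 * H\<^sup>2 * \<delta> w)" by (simp add: sum_distrib_left mult_ac)
      then have "1 \<le> (\<Sum>w\<in>set xs. 2 * H\<^sup>2 * \<delta> w) / D" using D by simp
      also have "\<dots> = (\<Sum>w\<in>(\<lambda>u. (u, n + k)) ` set xs. \<rho> w)"
        using xs(6) by (subst sum.reindex) (auto simp: inj_on_def \<rho>_def sum_divide_distrib)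
      also have "\<dots> \<le> (\<Sum>w\<in>set \<gamma>. \<rho> w)" using xs(2) \<rho>_nonneg by (intro sum_mono2) auto
      finally show ?thesis .
    qed
    \<comment> \<open>Vertices with \<open>\<delta> u = 0\<close> contribute nothing and are removed
      so that the logarithm \<open>f\<close> turns powers of \<open>\<delta> u / D\<close> into
      exponentials.\<close>
    define F where "F = {u\<in>Xs (n + k). near u \<and> 0 < \<delta> u}"
    have finF: "finite F" using net by (simp add: F_def)
    define f where "f u = - ln (\<delta> u / D)" for u
    have \<delta>\<omega>: "\<delta> u \<le> \<omega> * D" if "near u" for u using small that by (intro \<delta>_le) auto
    have expf: "exp (- t * f u) = (\<delta> u / D) powr t" if "u \<in> F" for t u
      using that D by (simp add: f_def F_def powr_def)
    have card: "real (card {u\<in>F. f u < real i + 1}) \<le> C * (4 * H\<^sup>2 * exp 1) powr \<beta> * exp (\<beta> * real i)" for i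
    proof -
      \<comment> \<open>Net points have \<open>d\<close>-distance at least \<open>s\<close>, so
        \<open>\<delta> u\<close> is at most \<open>H\<close> times the theta-distance to any other
        one. Those with \<open>\<delta> u > exp (- (real i + 1)) * D\<close> are thus
        \<open>2 * b\<close>-separated in theta, and the dimension bound counts them.\<close>
      define b where "b = exp (- (real i + 1)) * D / (2 * H)"
      have b: "0 < b" using D H(1) by (simp add: b_def)
      have "b < 2 * H * D"
      proof -
        have "exp (- (real i + 1)) \<le> 1" by simp
        then have "exp (- (real i + 1)) * D \<le> 1 * D" using D by (intro mult_right_mono) auto
        moreover have "1 * D \<le> H * D" using D H(1) by (intro mult_right_mono) auto
        moreover have "b \<le> exp (- (real i + 1)) * D / 1"
          unfolding b_def using D H(1) by (intro divide_left_mono) auto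
        ultimately have "b \<le> H * D" "0 < H * D" using D by linarith+
        then show ?thesis by simp
      qed
      then have c: "cover_num M \<theta> b (T.mball v (2 * H * D)) \<le> ereal (C * (2 * H * D / b) powr \<beta>)"
        using b v by (intro cov) auto
      have big: "exp (- (real i + 1)) * D < \<delta> u" if u: "u \<in> {u\<in>F. f u < real i + 1}" for u
      proof -
        have "exp (- (real i + 1)) < exp (- f u)" using u by simp
        also have "\<dots> = \<delta> u / D" using u D by (simp add: f_def F_def)
        finally show ?thesis using D by (simp add: less_divide_eq)
      qed
      have ball: "{u\<in>F. f u < real i + 1} \<subseteq> T.mball v (2 * H * D)"
      proof
        fix u assume u: "u \<in> {u\<in>F. f u < real i + 1}"
        then have "near u" by (simp add: F_def)
        then have "\<theta> v u \<le> H * D" using near_le[OF _ y0M y0(1)] by (simp add: D_def)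
        also have "\<dots> < 2 * H * D" using D H(1) by simp
        finally show "u \<in> T.mball v (2 * H * D)" using v \<open>near u\<close> by (simp add: near_def)
      qed
      have "separated_set M \<theta> (2 * b) {u\<in>F. f u < real i + 1}"
        unfolding separated_set_def
      proof (intro conjI ballI impI)
        show "{u\<in>F. f u < real i + 1} \<subseteq> M" by (auto simp: F_def near_def)
        fix u u' assume u: "u \<in> {u\<in>F. f u < real i + 1}" "u' \<in> {u\<in>F. f u < real i + 1}" "u \<noteq> u'"
        have uX: "u \<in> Xs (n + k)" "u' \<in> Xs (n + k)" "near u" using u by (auto simp: F_def)
        then have uM: "u \<in> M" "u' \<in> M" using XM by auto
        have "s \<le> d u u'" using net(1) uX u(3) by (simp add: separated_set_def s_def)
        then have "\<delta> u \<le> H * \<theta> u u'"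
          using uM s by (intro \<delta>_le[OF uX(3)] qsH[OF _ _ _ s _ _ T3]) auto
        then have "exp (- (real i + 1)) * D \<le> H * \<theta> u u'" using big[OF u(1)] by linarith
        moreover have "2 * b * H = exp (- (real i + 1)) * D" using H(1) by (simp add: b_def)
        ultimately have "H * (2 * b) \<le> H * \<theta> u u'" by (simp only: mult.commute)
        then show "2 * b \<le> \<theta> u u'" using H(1) by simp
      qed
      from T.separated_card_le(2)[OF c ball this]
      have "real (card {u\<in>F. f u < real i + 1}) \<le> C * (2 * H * D / b) powr \<beta>" .
      also have "2 * H * D / b = (4 * H\<^sup>2 * exp 1) * exp (real i)"
        using D H(1) unfolding b_def exp_minus
        by (simp add: exp_add field_simps power2_eq_square)
      also have "C * ((4 * H\<^sup>2 * exp 1) * exp (real i)) powr \<beta> = C * (4 * H\<^sup>2 * exp 1) powr \<beta> * exp (\<beta> * real i)"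
        by (simp add: powr_mult exp_powr_real mult_ac)
      finally show ?thesis .
    qed
    have f0: "0 \<le> f u" if "u \<in> F" for u
    proof -
      have "\<delta> u \<le> \<omega> * D" using that by (intro \<delta>\<omega>) (simp add: F_def)
      also have "\<dots> \<le> 1 * D" using \<omega>(2) D by (intro mult_right_mono) auto
      finally have "\<delta> u / D \<le> 1" using D by simp
      then show ?thesis using that D by (simp add: f_def F_def)
    qed
    have count: "(\<Sum>u\<in>F. exp (- q * f u)) \<le>
        (\<Sum>i. C * (4 * H\<^sup>2 * exp 1) powr \<beta> * exp (\<beta> * real i) * exp (- q * real i))"
      using exps by (intro sum_exp_le_counting finF f0 card summ) auto
    have "(\<Sum>w\<in>level_vertices Xs (n + k). \<rho> w powr p) = (\<Sum>u\<in>Xs (n + k). \<rho> (u, n + k) powr p)"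
      by (rule sum_level_vertices)
    also have "\<dots> = (\<Sum>u\<in>F. \<rho> (u, n + k) powr p)"
    proof (rule sum.mono_neutral_right[OF net(2)])
      show "\<forall>u\<in>Xs (n + k) - F. \<rho> (u, n + k) powr p = 0"
      proof
        fix u assume "u \<in> Xs (n + k) - F"
        then have "\<delta> u = 0" if "near u" using that \<delta>_nonneg[OF that] by (auto simp: F_def)
        then show "\<rho> (u, n + k) powr p = 0" by (simp add: \<rho>_def)
      qed
    qed (auto simp: F_def)
    also have "\<dots> \<le> (\<Sum>u\<in>F. (2 * H\<^sup>2) powr p * (\<omega> powr (p - q) * exp (- q * f u)))"
    proof (intro sum_mono)
      fix u assume u: "u \<in> F"
      then have nu: "near u" "0 < \<delta> u" by (auto simp: F_def)
      have "\<delta> u / D \<le> \<omega>" using \<delta>\<omega>[OF nu(1)] D by (simp add: divide_le_eq)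
      then have 1: "(\<delta> u / D) powr (p - q) \<le> \<omega> powr (p - q)"
        using exps D nu by (intro powr_mono2) auto
      have "\<rho> (u, n + k) powr p = ((2 * H\<^sup>2) * (\<delta> u / D)) powr p" using nu by (simp add: \<rho>_def)
      also have "\<dots> = (2 * H\<^sup>2) powr p * ((\<delta> u / D) powr (p - q) * (\<delta> u / D) powr q)"
        unfolding powr_mult[of "2 * H\<^sup>2"] using nu D by (simp flip: powr_add)
      also have "\<dots> \<le> (2 * H\<^sup>2) powr p * (\<omega> powr (p - q) * (\<delta> u / D) powr q)"
        using 1 by (intro mult_left_mono mult_right_mono) auto
      finally show "\<rho> (u, n + k) powr p \<le> (2 * H\<^sup>2) powr p * (\<omega> powr (p - q) * exp (- q * f u))"
        unfolding expf[OF u] .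
    qed
    also have "\<dots> = (2 * H\<^sup>2) powr p * (\<omega> powr (p - q) * (\<Sum>u\<in>F. exp (- q * f u)))"
      by (simp add: sum_distrib_left)
    also have "\<dots> \<le> (2 * H\<^sup>2) powr p * (\<omega> powr (p - q) *
        (\<Sum>i. C * (4 * H\<^sup>2 * exp 1) powr \<beta> * exp (\<beta> * real i) * exp (- q * real i)))"
      by (intro mult_left_mono count) auto
    finally have le: "(\<Sum>w\<in>level_vertices Xs (n + k). \<rho> w powr p) \<le> (2 * H\<^sup>2) powr p * (\<omega> powr (p - q) *
        (\<Sum>i. C * (4 * H\<^sup>2 * exp 1) powr \<beta> * exp (\<beta> * real i) * exp (- q * real i)))" .
    have "comb_modulus p (Gamma_kL M d a lam L Xs k (v, n)) (level_vertices Xs (n + k)) \<le>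
        ereal (\<Sum>w\<in>level_vertices Xs (n + k). \<rho> w powr p)"
      unfolding comb_modulus_def using adm \<rho>_nonneg by (intro Inf_lower image_eqI[OF refl] CollectI conjI ballI)
    also have "\<dots> \<le> ereal ((2 * H\<^sup>2) powr p * (\<omega> powr (p - q) *
        (\<Sum>i. C * (4 * H\<^sup>2 * exp 1) powr \<beta> * exp (\<beta> * real i) * exp (- q * real i))))"
      using le by (rule ereal_less_eq(3)[THEN iffD2])
    finally show ?thesis .
  qed
qed

theorem M_p_zero_of_assouad_dim:
  assumes compact: "compact_space mtopology" and dim: "assouad_dim M d < \<infinity>"
    and par: "1 < a" "1 < lam" "1 < L"
    and nets: "\<And>k. maximal_separated M d (1 / a ^ k) (Xs k)"
    and \<theta>: "\<theta> \<in> conformal_gauge M d"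
    and cov: "0 < \<beta>" "0 < C" "\<And>x r R. \<lbrakk>x \<in> M; 0 < r; r < R\<rbrakk> \<Longrightarrow>
      cover_num M \<theta> r (Metric_space.mball M \<theta> x R) \<le> ereal (C * (R / r) powr \<beta>)"
    and p: "\<beta> < p"
  shows "M_p M d a lam L Xs p = 0"
proof -
  have sep: "separated_set M d (1 / a ^ k) (Xs k)" for k
    using nets[of k] by (simp add: maximal_separated_def)
  have XM: "Xs k \<subseteq> M" for k using sep[of k] by (simp add: separated_set_def)
  have fin: "finite (Xs k)" for k
    using separated_finite[OF compact dim sep[of k]] par by simp
  obtain \<eta> \<eta>' where hom: "homeomorphism {0..} {0..} \<eta> \<eta>'" and
    qs: "\<And>x y b. \<lbrakk>x \<in> M; y \<in> M; b \<in> M; x \<noteq> b\<rbrakk> \<Longrightarrow> \<theta> x y / \<theta> x b \<le> \<eta> (d x y / d x b)"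
    using \<theta> unfolding conformal_gauge_def quasisymmetric_def by blast
  have \<theta>_metric: "Metric_space M \<theta>" using \<theta> by (simp add: conformal_gauge_def)
  obtain H where H: "1 \<le> H" "\<forall>t\<in>{0..(L + 2 * lam) / (L - 1) + lam}. \<eta> t \<le> H"
    using half_line_homeomorphism(2)[OF hom] by blast
  \<comment> \<open>The gap from \<beta> to \<open>q\<close> makes the series \<open>S\<close>
    converge; the gap from \<open>q\<close> to \<open>p\<close> leaves a positive power of
    \<omega>.\<close>
  define q where "q = (\<beta> + p) / 2"
  have q: "\<beta> < q" "q < p" using p by (auto simp: q_def)
  define S where "S = (\<Sum>i. C * (4 * H\<^sup>2 * exp 1) powr \<beta> * exp (\<beta> * real i) * exp (- q * real i))"
  define c where "c = (2 * H\<^sup>2) powr p * \<bar>S\<bar> + 1"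
  have c: "1 \<le> c" by (simp add: c_def)
  have upper: "M_p M d a lam L Xs p \<le> ereal \<epsilon>" if \<epsilon>: "0 < \<epsilon>" for \<epsilon>
  proof -
    \<comment> \<open>Chosen so that \<open>\<omega> powr (p - q) * c \<le> \<epsilon>\<close>;
      \<open>H\<close>, \<open>S\<close> and \<open>c\<close> do not depend on the level difference,
      so a large \<open>k\<close> then suffices at every vertex.\<close>
    define \<omega> where "\<omega> = min 1 ((\<epsilon> / c) powr (1 / (p - q)))"
    have \<omega>: "0 < \<omega>" "\<omega> \<le> 1" using \<epsilon> c by (auto simp: \<omega>_def)
    have "\<omega> powr (p - q) \<le> ((\<epsilon> / c) powr (1 / (p - q))) powr (p - q)"
      using q \<omega> by (intro powr_mono2) (auto simp: \<omega>_def)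
    also have "\<dots> = \<epsilon> / c" using q \<epsilon> c by (simp add: powr_powr)
    finally have w: "\<omega> powr (p - q) \<le> \<epsilon> / c" .
    have "(2 * H\<^sup>2) powr p * (\<omega> powr (p - q) * S) \<le> (2 * H\<^sup>2) powr p * (\<omega> powr (p - q) * \<bar>S\<bar>)"
      by (intro mult_left_mono) auto
    also have "\<dots> = \<omega> powr (p - q) * ((2 * H\<^sup>2) powr p * \<bar>S\<bar>)" by simp
    also have "\<dots> \<le> \<omega> powr (p - q) * c" by (intro mult_left_mono) (auto simp: c_def)
    also have "\<dots> \<le> \<epsilon> / c * c" using w c by (intro mult_right_mono) auto
    also have "\<dots> = \<epsilon>" using c by simp
    finally have bound: "(2 * H\<^sup>2) powr p * (\<omega> powr (p - q) * S) \<le> \<epsilon>" .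
    obtain \<delta> where \<delta>: "0 < \<delta>" "\<forall>t\<in>{0..\<delta>}. \<eta> t \<le> \<omega> / (H + 1)"
      using half_line_homeomorphism(3)[OF hom, of "\<omega> / (H + 1)"] \<omega>(1) H(1) by auto
    obtain k0 where k0: "2 * lam / (L * \<delta>) < a ^ k0" using real_arch_pow[OF par(1)] by blast
    have "M_pk M d a lam L Xs p k \<le> ereal \<epsilon>" if k: "k0 \<le> k" for k
    proof -
      have "a ^ k0 \<le> a ^ k" using par k by (intro power_increasing) auto
      then have "2 * lam / (L * \<delta>) < a ^ k" using k0 by linarith
      then have t: "2 * lam / (L * a ^ k) \<le> \<delta>"
        using par \<delta>(1) by (simp add: divide_less_eq divide_le_eq mult_ac)
      have "comb_modulus p (Gamma_kL M d a lam L Xs k (v, n)) (level_vertices Xs (n + k)) \<le> ereal \<epsilon>"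
        if v: "v \<in> Xs n" for v n
      proof -
        have "comb_modulus p (Gamma_kL M d a lam L Xs k (v, n)) (level_vertices Xs (n + k)) \<le>
            ereal ((2 * H\<^sup>2) powr p * (\<omega> powr (p - q) * S))"
          unfolding S_def
        proof (rule comb_modulus_le[where Xs = Xs and n = n and k = k, OF \<theta>_metric qs cov(2,3) cov(1) q par sep fin H(1) _ \<omega>])
          show "\<eta> t \<le> H" if "0 \<le> t" "t \<le> (L + 2 * lam) / (L - 1) + lam" for t
            using H(2) that by simp
          show "\<eta> t' \<le> \<omega> / (H + 1)" if "0 \<le> t'" "t' \<le> 2 * lam / (L * a ^ k)" for t'
            using \<delta>(2) that t by simp
          show "v \<in> M" using v XM by blast
        qed
        also have "\<dots> \<le> ereal \<epsilon>" using bound by simp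
        finally show ?thesis .
      qed
      then show ?thesis
        unfolding M_pk_def using \<epsilon> by (intro Sup_least) (auto simp: all_vertices_def level_vertices_def)
    qed
    then have "\<forall>\<^sub>F k in sequentially. M_pk M d a lam L Xs p k \<le> ereal \<epsilon>"
      unfolding eventually_sequentially by blast
    then have "limsup (\<lambda>k. M_pk M d a lam L Xs p k) \<le> ereal \<epsilon>" by (rule Limsup_bounded)
    then show ?thesis
      unfolding M_p_def using Liminf_le_Limsup[of sequentially "\<lambda>k. M_pk M d a lam L Xs p k"] by simp
  qed
  have "0 \<le> M_p M d a lam L Xs p"
    unfolding M_p_def by (intro Liminf_bounded always_eventually allI) (auto simp: M_pk_def intro: Sup_upper)
  moreover have "M_p M d a lam L Xs p \<le> 0"
    by (rule ereal_le_epsilon2) (simp add: upper)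
  ultimately show ?thesis by simp
qed

end

section \<open>The cycle of inequalities between the three quantities\<close>

theorem theorem1p2:
  fixes X :: "'a set" and d :: "'a \<Rightarrow> 'a \<Rightarrow> real"
    and a lam L :: real and Xs :: "nat \<Rightarrow> 'a set"
  assumes "Metric_space X d"
    and "compact_space (Metric_space.mtopology X d)"
    and "assouad_dim X d < \<infinity>"
    and "a > 1" and "lam > 1" and "L > 1"
    and "\<And>k. maximal_separated X d (1 / a ^ k) (Xs k)"
  shows "conf_assouad_dim X d = crit_exp X d a lam L Xs \<and>
         crit_exp X d a lam L Xs = Inf (assouad_dim X ` power_conformal_gauge X d)"
proof -
  interpret Metric_space X d by fact
  have "crit_exp X d a lam L Xs \<le> assouad_dim X \<theta>" if \<theta>: "\<theta> \<in> conformal_gauge X d" for \<theta>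
  proof (rule ccontr)
    assume "\<not> ?thesis"
    then obtain \<beta> C where \<beta>: "0 < \<beta>" "ereal \<beta> < crit_exp X d a lam L Xs" "0 < C"
      "\<And>x r R. \<lbrakk>x \<in> X; 0 < r; r < R\<rbrakk> \<Longrightarrow>
        cover_num X \<theta> r (Metric_space.mball X \<theta> x R) \<le> ereal (C * (R / r) powr \<beta>)"
      using assouad_dim_lessD[of X \<theta> "crit_exp X d a lam L Xs"] by (metis not_le)
    \<comment> \<open>An exponent strictly between is needed: it exceeds \<beta>, so its modulus
      vanishes, yet it lies below the infimum of such exponents.\<close>
    obtain p where p: "ereal \<beta> < ereal p" "ereal p < crit_exp X d a lam L Xs"
      using ereal_dense2[OF \<beta>(2)] by blast
    have "M_p X d a lam L Xs p = 0"
      using p(1) by (intro M_p_zero_of_assouad_dim[OF assms(2-7) \<theta> \<beta>(1,3,4)]) auto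
    then have "crit_exp X d a lam L Xs \<le> ereal p"
      unfolding crit_exp_def using p(1) \<beta>(1) by (intro Inf_lower imageI CollectI) auto
    then show False using p(2) by simp
  qed
  then have 1: "crit_exp X d a lam L Xs \<le> conf_assouad_dim X d"
    unfolding conf_assouad_dim_def by (intro INF_greatest)
  have 2: "conf_assouad_dim X d \<le> Inf (assouad_dim X ` power_conformal_gauge X d)"
    unfolding conf_assouad_dim_def by (intro INF_superset_mono) (auto simp: power_conformal_gauge_def)
  have 3: "Inf (assouad_dim X ` power_conformal_gauge X d) \<le> crit_exp X d a lam L Xs"
    unfolding crit_exp_def
  proof (rule Inf_greatest)
    fix y assume "y \<in> ereal ` {p. 0 < p \<and> M_p X d a lam L Xs p = 0}"
    then obtain p where p: "y = ereal p" "0 < p" "M_p X d a lam L Xs p = 0" by blast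
    obtain \<theta> where "\<theta> \<in> power_conformal_gauge X d" "assouad_dim X \<theta> \<le> ereal p"
      using exists_metric_of_M_p_zero[OF assms(2-7) p(2,3)] by blast
    then show "Inf (assouad_dim X ` power_conformal_gauge X d) \<le> y"
      unfolding p(1) by (intro INF_lower2)
  qed
  show ?thesis using 1 order.trans[OF 2 3] order.trans[OF 1 2] 3 by (intro conjI order.antisym)
qed

end
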